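(* Let $K\subset\mathbb{R}^3$ be a tetrahedron and let $$\Sigma_K=\{T\in\mathcal{P}_4(K;\mathbb{S}) : \operatorname{div}T\in\mathcal{P}_1(K;\mathbb{R}^3)\}.$$ A matrix field $T\in\Sigma_K$ is uniquely determined by the following degrees of freedom: (1) the values of $T$ at the vertices of $K$ ($4\times6=24$ degrees of freedom); (2) for each edge $e$ of $K$, with unit tangent vector $s$ and linearly independent normal vectors $n_-$ and $n_+$, the constant, linear and quadratic moments over $e$ of $s'Tn_-$, $s'Tn_+$, $n_-'Tn_-$, $n_+'Tn_+$, $n_-'Tn_+$ ($6\times3\times5=90$ degrees of freedom); (3) for each face $f$ of $K$, with normal $n$, the constant and linear moments over $f$ of $Tn$ ($4\times3\times3=36$ degrees of freedom); (4) the average of $T$ over $K$ ($6$ degrees of freedom); (5) the values of the moments $\int_KT:U\,dx$, $U\in\mathcal{M}(K)$ ($6$ degrees of freedom).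
   Context: $\mathbb{S}$ is the space of real symmetric $3\times3$ matrices; a prime denotes transpose; $S:T$ is the Frobenius product. $\mathcal{P}_j(K;X)$ denotes polynomials of degree at most $j$ on $K$ with values in $X$. The divergence of a matrix field is taken row by row. The space $\mathcal{M}(K)$ is $$\mathcal{M}(K)=\{T\in\mathcal{P}_4(K;\mathbb{S}) : \operatorname{div}T=0,\ Tn=0\text{ on }\partial K\},$$ where $n$ is the outward unit normal on $\partial K$. *)

theory Defs
  imports "HOL-Analysis.Analysis" "HOL-Library.Function_Algebras"
begin

definition sym_matrices :: "(real^3^3) set" where
  "sym_matrices = {A. transpose A = A}"

text \<open>
  Polynomials of degree at most \<open>j\<close> with values in \<open>X\<close>, written in monomials with
  exponent vector \<open>\<alpha>\<close>.  A tetrahedron has nonempty interior, so restriction to it is injective on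
  polynomials; an element of \<open>P\<^sub>j(K;X)\<close> is therefore represented by its unique
  polynomial extension to the whole space, and \<open>K\<close> is not an argument.
\<close>
definition polys :: "nat \<Rightarrow> 'b::real_vector set \<Rightarrow> (real^3 \<Rightarrow> 'b) set" where
  "polys j X = {f. (\<exists>c. \<forall>x. f x = (\<Sum>\<alpha>::3 \<Rightarrow> nat | sum \<alpha> UNIV \<le> j. (\<Prod>i\<in>UNIV. (x $ i) ^ \<alpha> i) *\<^sub>R c \<alpha>))
                 \<and> (\<forall>x. f x \<in> X)}"

definition row_div :: "(real^3 \<Rightarrow> real^3^3) \<Rightarrow> real^3 \<Rightarrow> real^3" where
  "row_div T x = (\<chi> i. \<Sum>j\<in>UNIV. frechet_derivative (\<lambda>y. T y $ i $ j) (at x) (axis j 1))"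

definition Sigma_space :: "(real^3 \<Rightarrow> real^3^3) set" where
  "Sigma_space = {T \<in> polys 4 sym_matrices. row_div T \<in> polys 1 UNIV}"

text \<open>For a face \<open>f\<close> of dimension 2 of a tetrahedron \<open>K\<close>, exactly one vector satisfies this.\<close>
definition outward_unit_normal :: "(real^3) set \<Rightarrow> (real^3) set \<Rightarrow> real^3 \<Rightarrow> bool" where
  "outward_unit_normal K f n \<longleftrightarrow> norm n = 1 \<and> (\<forall>x\<in>f. \<forall>y\<in>K. n \<bullet> (y - x) \<le> 0)"

definition M_space :: "(real^3) set \<Rightarrow> (real^3 \<Rightarrow> real^3^3) set" where
  "M_space K = {T \<in> polys 4 sym_matrices.
     (\<forall>x\<in>K. row_div T x = 0) \<and>
     (\<forall>f n. f facet_of K \<longrightarrow> outward_unit_normal K f n \<longrightarrow> (\<forall>x\<in>f. T x *v n = 0))}"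

text \<open>
  Matrix fields as a real vector space under pointwise operations, giving the dimension
  \<open>field.dim\<close> of a space of fields.
\<close>
interpretation field: vector_space "\<lambda>(c::real) (T::real^3 \<Rightarrow> real^3^3) x. c *\<^sub>R T x"
  by unfold_locales (auto simp: fun_eq_iff scaleR_add_right scaleR_add_left)

text \<open>
  Linearity of a functional on a subspace \<open>M\<close> only, with no condition on its values outside \<open>M\<close>.
\<close>
definition linear_functional_on ::
    "(real^3 \<Rightarrow> real^3^3) set \<Rightarrow> ((real^3 \<Rightarrow> real^3^3) \<Rightarrow> real) \<Rightarrow> bool" where
  "linear_functional_on M l \<longleftrightarrow>
     (\<forall>U\<in>M. \<forall>W\<in>M. l (\<lambda>x. U x + W x) = l U + l W) \<and>
     (\<forall>c. \<forall>U\<in>M. l (\<lambda>x. c *\<^sub>R U x) = c * l U)"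

text \<open>
  The moment of order \<open>k\<close> over the edge \<open>[a,b]\<close>, with respect to arc length, the weight being
  the \<open>k\<close>-th power of the affine coordinate that is 0 at \<open>a\<close> and 1 at \<open>b\<close>.  The weights
  with \<open>k \<le> m\<close> are a basis of the polynomials of degree at most \<open>m\<close> on the edge.
\<close>
definition edge_moment :: "real^3 \<Rightarrow> real^3 \<Rightarrow> nat \<Rightarrow> (real^3 \<Rightarrow> real) \<Rightarrow> real" where
  "edge_moment a b k g = norm (b - a) * integral {0..1} (\<lambda>t. t ^ k * g (a + t *\<^sub>R (b - a)))"

text \<open>
  The surface integral over the triangle \<open>abc\<close> of \<open>u\<^sup>p w\<^sup>q g\<close>, where \<open>u\<close> and \<open>w\<close> are the
  barycentric coordinates belonging to \<open>b\<close> and \<open>c\<close>; the norm of the cross product is the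
  area element of this parametrization.  The weights with \<open>p + q \<le> 1\<close> are a
  basis of the polynomials of degree at most 1 on the triangle.
\<close>
definition face_moment ::
    "real^3 \<Rightarrow> real^3 \<Rightarrow> real^3 \<Rightarrow> nat \<Rightarrow> nat \<Rightarrow> (real^3 \<Rightarrow> real^3) \<Rightarrow> real^3" where
  "face_moment a b c p q g =
     norm (cross3 (b - a) (c - a)) *\<^sub>R
       integral {(u, w). 0 \<le> u \<and> 0 \<le> w \<and> u + w \<le> 1}
         (\<lambda>(u, w). (u ^ p * w ^ q) *\<^sub>R g (a + u *\<^sub>R (b - a) + w *\<^sub>R (c - a)))"

definition average :: "(real^3) set \<Rightarrow> (real^3 \<Rightarrow> real^3^3) \<Rightarrow> real^3^3" where
  "average K T = (1 / measure lebesgue K) *\<^sub>R integral K T"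

text \<open>
  The separate condition \<open>nm \<noteq> np\<close> is needed since \<open>independent\<close> is about the set \<open>{nm, np}\<close>.
\<close>
definition edge_frame :: "real^3 \<Rightarrow> real^3 \<Rightarrow> real^3 \<Rightarrow> real^3 \<Rightarrow> real^3 \<Rightarrow> bool" where
  "edge_frame a b s nm np \<longleftrightarrow>
     norm s = 1 \<and> (\<exists>c. s = c *\<^sub>R (b - a)) \<and>
     nm \<bullet> (b - a) = 0 \<and> np \<bullet> (b - a) = 0 \<and> nm \<noteq> np \<and> independent {nm, np}"

definition face_unit_normal :: "real^3 \<Rightarrow> real^3 \<Rightarrow> real^3 \<Rightarrow> real^3 \<Rightarrow> bool" where
  "face_unit_normal a b c n \<longleftrightarrow> norm n = 1 \<and> n \<bullet> (b - a) = 0 \<and> n \<bullet> (c - a) = 0"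

end

theory Submission
  imports Defs
begin

text \<open>
  Let \<open>lam i\<close> be the barycentric coordinates, \<open>g i\<close> their gradients (normal to the faces) and
  \<open>t = tv i j\<close> the edge vectors. The six matrices \<open>t t'\<close> are a basis of the symmetric
  matrices, with coordinates \<open>- g i' T g j\<close>; hence a quartic \<open>T\<close> with \<open>T n = 0\<close> on all
  faces is a sum of \<open>lam i * lam j * q * t t'\<close> with \<open>q\<close> quadratic.

  Vanishing vertex, edge and face degrees of freedom force \<open>T n = 0\<close> on the faces. Integrating
  \<open>div T\<close> against itself by parts then leaves the constant gradient of \<open>div T\<close> paired with the
  average of \<open>T\<close>, so \<open>div T = 0\<close>; thus \<open>T\<close> lies in \<open>M(K)\<close> and is orthogonal to itself.

  As \<open>dim P\<^sub>4 = 210\<close> and \<open>div T \<in> P\<^sub>1\<close> amounts to \<open>48\<close> linear equations, injectivity gives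
  bijectivity as soon as \<open>dim M(K) \<le> 6\<close>, and then also \<open>dim M(K) = 6\<close>. The upper bound holds
  because the adjoint of the divergence on the \<open>60\<close>-dimensional space of bubbles is the symmetric
  gradient on cubic vector fields, also of dimension \<open>60\<close>, whose kernel is the
  \<open>6\<close>-dimensional space of rigid motions.
\<close>

section \<open>Polynomial functions of bounded degree\<close>

text \<open>Integration by parts uses no surface integrals: the divergence of a bubble consists of
  derivatives of \<open>lam i * lam j * r\<close> along the edge \<open>tv i j\<close>, and each of
  these integrates to zero over \<open>K\<close>. The count looks circular, since the number of
  moments in (5) is the dimension of M(K), while injectivity yields surjectivity only for at most
  210 functionals. A spanning family of six fields, some of which may a priori be zero, takes the
  place of a basis. Then 24 + 90 + 36 + 6 + 6 degrees of freedom and 48 = 3 * (20 - 4) divergence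
  equations add up to 210 = 35 * 6, interpolation with arbitrary values becomes possible, and the
  independence of the six fields follows from it. Both numbers 60 in the dimension bound are
  monomial counts: 10 quadratic coefficients for each of 6 edges, and 20 cubic coefficients for each
  of 3 components.\<close>

text \<open>An inductive degree bound on any Euclidean space, so that one notion covers fields on
  \<open>K\<close> and their pullbacks to an interval or to the reference triangle. The factors are
  arbitrary linear forms instead of coordinates, which makes closure under affine substitution a
  direct induction.\<close>

inductive polf :: "nat \<Rightarrow> ('a::euclidean_space \<Rightarrow> real) \<Rightarrow> bool" where
  const: "polf k (\<lambda>_. c)"
| add: "polf k f \<Longrightarrow> polf k g \<Longrightarrow> polf k (\<lambda>x. f x + g x)"
| linear_mult: "linear l \<Longrightarrow> polf k f \<Longrightarrow> polf (Suc k) (\<lambda>x. l x * f x)"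

lemma polf_Suc: "polf k f \<Longrightarrow> polf (Suc k) f"
  by (induction rule: polf.induct) (auto intro: polf.intros)

lemma polf_mono: "polf j f \<Longrightarrow> j \<le> k \<Longrightarrow> polf k f"
  by (induction k rule: nat_induct) (auto simp: le_Suc_eq intro: polf_Suc)

lemma polf_0_const: "polf k f \<Longrightarrow> k = 0 \<Longrightarrow> \<exists>c. f = (\<lambda>_. c)"
  by (induction rule: polf.induct) auto

lemma polf_cmult: "polf k f \<Longrightarrow> polf k (\<lambda>x. c * f x)"
proof (induction rule: polf.induct)
  case (const k d)
  then show ?case by (rule polf.const)
next
  case (add k f g)
  then show ?case by (auto simp: distrib_left intro: polf.add)
next
  case (linear_mult l k f)
  then show ?case using polf.linear_mult[of l k "\<lambda>x. c * f x"] by (simp add: mult.left_commute)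
qed

lemma polf_minus: "polf k f \<Longrightarrow> polf k (\<lambda>x. - f x)"
  using polf_cmult[of k f "-1"] by simp

lemma polf_mult_const: "polf k f \<Longrightarrow> polf k (\<lambda>x. f x * c)"
  using polf_cmult[of k f c] by (simp add: mult.commute)

lemma polf_sum: "(\<And>i. i \<in> A \<Longrightarrow> polf k (f i)) \<Longrightarrow> polf k (\<lambda>x. \<Sum>i\<in>A. f i x)"
  by (induction A rule: infinite_finite_induct) (auto intro: polf.const polf.add)

lemma polf_mult: "polf j f \<Longrightarrow> polf k g \<Longrightarrow> polf (j + k) (\<lambda>x. f x * g x)"
proof (induction rule: polf.induct)
  case (const j c)
  then show ?case by (auto intro: polf_cmult polf_mono)
next
  case (add j f g)
  then show ?case by (auto simp: distrib_right intro: polf.add)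
next
  case (linear_mult l j f)
  then show ?case
    using polf.linear_mult[of l "j + k"] by (simp add: mult.assoc)
qed

lemma polf_linear: "linear l \<Longrightarrow> polf 1 l"
  using polf.linear_mult[OF _ polf.const, of l 0 1] by simp

lemma polf_affine: "linear l \<Longrightarrow> polf 1 (\<lambda>x. c + l x)"
  by (intro polf.add polf.const polf_linear)

lemma polf_compose_affine: "polf k f \<Longrightarrow> linear m \<Longrightarrow> polf k (\<lambda>x. f (a + m x))"
proof (induction rule: polf.induct)
  case (const k d)
  then show ?case by (intro polf.const)
next
  case (add k f g)
  then show ?case by (auto intro: polf.add)
next
  case (linear_mult l k f)
  have "polf (1 + k) (\<lambda>x. (l a + (l \<circ> m) x) * f (a + m x))"
    using linear_mult by (intro polf_mult[OF polf_affine[OF linear_compose]]) auto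
  then show ?case using linear_mult by (simp add: linear_add)
qed

lemma polf_continuous_on: "polf k f \<Longrightarrow> continuous_on S f"
proof (induction rule: polf.induct)
  case (linear_mult l k f)
  then show ?case
    by (intro continuous_on_mult linear_continuous_on[of l]) (auto simp: linear_conv_bounded_linear)
qed (auto intro: continuous_intros)

text \<open>The induction needs the derivative to be exactly 0 at degree 0: for constant
  \<open>f\<close>, the truncated \<open>k - 1\<close> would otherwise give the term
  \<open>l x * D x t\<close> of the product rule the bound 1 instead of 0.\<close>

lemma polf_has_derivative_aux:
  "polf k f \<Longrightarrow> \<exists>D. (\<forall>x. (f has_derivative D x) (at x)) \<and>
     (\<forall>t. polf (k - 1) (\<lambda>x. D x t) \<and> (k = 0 \<longrightarrow> (\<lambda>x. D x t) = (\<lambda>x. 0)))"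
proof (induction rule: polf.induct)
  case (const k c)
  show ?case by (rule exI[of _ "\<lambda>x t. 0"]) (auto intro: polf.const)
next
  case (add k f g)
  then obtain D E where D: "\<forall>x. (f has_derivative D x) (at x)"
     "\<forall>t. polf (k - 1) (\<lambda>x. D x t) \<and> (k = 0 \<longrightarrow> (\<lambda>x. D x t) = (\<lambda>x. 0))"
     and E: "\<forall>x. (g has_derivative E x) (at x)"
     "\<forall>t. polf (k - 1) (\<lambda>x. E x t) \<and> (k = 0 \<longrightarrow> (\<lambda>x. E x t) = (\<lambda>x. 0))" by blast
  show ?case
    by (rule exI[of _ "\<lambda>x t. D x t + E x t"])
      (use D E in \<open>auto intro!: derivative_intros polf.add simp: fun_eq_iff\<close>)
next
  case (linear_mult l k f)
  then obtain D where D: "\<forall>x. (f has_derivative D x) (at x)"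
     "\<forall>t. polf (k - 1) (\<lambda>x. D x t) \<and> (k = 0 \<longrightarrow> (\<lambda>x. D x t) = (\<lambda>x. 0))" by blast
  have l: "bounded_linear l" using linear_mult by (simp add: linear_conv_bounded_linear)
  have "polf k (\<lambda>x. l x * D x t + l t * f x)" for t
  proof (cases k)
    case 0
    then show ?thesis using D(2)[rule_format, of t] linear_mult by (auto simp: fun_eq_iff intro: polf_cmult)
  next
    case (Suc m)
    then show ?thesis using D(2)[rule_format, of t] linear_mult
      by (auto intro!: polf.add polf_cmult polf.linear_mult)
  qed
  then show ?case
    by (intro exI[of _ "\<lambda>x t. l x * D x t + l t * f x"])
      (use D bounded_linear_imp_has_derivative[OF l] in \<open>auto intro!: has_derivative_mult\<close>)
qed

lemma polf_differentiable: "polf k f \<Longrightarrow> f differentiable (at x within S)"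
  using polf_has_derivative_aux[of k f] has_derivative_at_withinI unfolding differentiable_def by blast

lemma polf_has_derivative:
  "polf k f \<Longrightarrow> (f has_derivative frechet_derivative f (at x)) (at x)"
  using frechet_derivative_works polf_differentiable[of k f x UNIV] by blast

lemma polf_frechet_derivative:
  assumes "polf k f" shows "polf (k - 1) (\<lambda>x. frechet_derivative f (at x) t)"
proof -
  obtain D where D: "\<And>x. (f has_derivative D x) (at x)" "polf (k - 1) (\<lambda>x. D x t)"
    using polf_has_derivative_aux[OF assms] by metis
  then show ?thesis using frechet_derivative_at[OF D(1)] by simp
qed

section \<open>Restriction to lines and the identity theorem\<close>

lemma polf_line:
  "polf k f \<Longrightarrow> \<exists>c. \<forall>t. f (a + t *\<^sub>R b) = (\<Sum>i\<le>k. c i * t ^ i)"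
proof (induction rule: polf.induct)
  case (const k d)
  show ?case
    by (rule exI[of _ "\<lambda>i. if i = 0 then d else 0"]) (simp add: sum.delta' if_distrib if_distribR cong: if_cong)
next
  case (add k f g)
  then obtain c d where "\<forall>t. f (a + t *\<^sub>R b) = (\<Sum>i\<le>k. c i * t ^ i)"
    "\<forall>t. g (a + t *\<^sub>R b) = (\<Sum>i\<le>k. d i * t ^ i)" by blast
  then show ?case
    by (intro exI[of _ "\<lambda>i. c i + d i"]) (simp add: distrib_right sum.distrib)
next
  case (linear_mult l k f)
  then obtain c where c: "\<forall>t. f (a + t *\<^sub>R b) = (\<Sum>i\<le>k. c i * t ^ i)" by blast
  \<comment> \<open>Coefficients of the product of \<open>l a + t * l b\<close> with the polynomial
    whose coefficients are \<open>c\<close>.\<close>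
  let ?c = "\<lambda>i. (if i \<le> k then l a * c i else 0) + (case i of 0 \<Rightarrow> 0 | Suc j \<Rightarrow> l b * c j)"
  show ?case
  proof (rule exI[of _ ?c], rule allI)
    fix t
    have "(\<Sum>i\<le>Suc k. ?c i * t ^ i) = (\<Sum>i\<le>k. l a * c i * t ^ i) + (\<Sum>i\<le>k. l b * c i * t ^ Suc i)"
      unfolding distrib_right sum.distrib
      by (subst (2) sum.atMost_Suc_shift) simp
    also have "\<dots> = (l a + t * l b) * (\<Sum>i\<le>k. c i * t ^ i)"
      unfolding distrib_right sum_distrib_left by (simp add: sum_distrib_left sum.distrib algebra_simps)
    finally show "l (a + t *\<^sub>R b) * f (a + t *\<^sub>R b) = (\<Sum>i\<le>Suc k. ?c i * t ^ i)"
      using linear_mult.hyps(1) by (simp add: c linear_add linear_scale)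
  qed
qed

lemma polf_line_infinite_zeros:
  assumes "polf k f" "infinite {t. f (a + t *\<^sub>R b) = 0}"
  shows "f (a + t *\<^sub>R b) = 0"
proof -
  obtain c where c: "\<And>t. f (a + t *\<^sub>R b) = (\<Sum>i\<le>k. c i * t ^ i)"
    using polf_line[OF assms(1), of a b] by blast
  have "\<forall>i\<le>k. c i = 0"
    using assms(2) polyfun_rootbound[where c = c] unfolding c by blast
  then show ?thesis unfolding c by simp
qed

text \<open>Every point lies on a line through an interior point of \<open>S\<close>. Near that
  interior point the line stays in \<open>S\<close>, so the restriction to the line is a univariate
  polynomial with infinitely many zeros.\<close>

lemma polf_eq_0_if_interior:
  assumes "polf k f" "\<And>x. x \<in> S \<Longrightarrow> f x = 0" "interior S \<noteq> {}"
  shows "f x = 0"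
proof -
  obtain a e where e: "e > 0" "ball a e \<subseteq> S"
    using assms(3) by (meson ex_in_conv mem_interior)
  \<comment> \<open>Parameters below \<open>d\<close> stay in the ball of radius \<open>e\<close>;
    the summand 1 keeps the denominator positive when \<open>x = a\<close>.\<close>
  define d where "d = e / (1 + norm (x - a))"
  have d: "d > 0" using e by (simp add: d_def add_pos_nonneg)
  have "f (a + t *\<^sub>R (x - a)) = 0" if "t \<in> {0<..<d}" for t
  proof (rule assms(2))
    have "norm (t *\<^sub>R (x - a)) < e"
    proof -
      have "t * (1 + norm (x - a)) < e"
        using that e by (simp add: d_def pos_less_divide_eq add_pos_nonneg)
      then show ?thesis using that by (simp add: distrib_left)
    qed
    then show "a + t *\<^sub>R (x - a) \<in> S" using e(2) by (auto simp: dist_norm)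
  qed
  then have "{0<..<d} \<subseteq> {t. f (a + t *\<^sub>R (x - a)) = 0}" by blast
  then have "infinite {t. f (a + t *\<^sub>R (x - a)) = 0}"
    using d by (meson infinite_Ioo infinite_super)
  from polf_line_infinite_zeros[OF assms(1) this, of 1] show ?thesis by simp
qed

section \<open>Division by affine factors\<close>

text \<open>A difference quotient in direction \<open>d\<close> with the variable step
  \<open>c + m x\<close>, built by a discrete product rule. The clause for \<open>k = 0\<close>
  again compensates for truncated subtraction.\<close>

lemma polf_difference_quotient:
  assumes "polf k f" "linear m"
  shows "\<exists>g. polf (k - 1) g \<and> (k = 0 \<longrightarrow> g = (\<lambda>_. 0)) \<and>
    (\<forall>x. f x - f (x - (c + m x) *\<^sub>R d) = (c + m x) * g x)"
  using assms
proof (induction rule: polf.induct)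
  case (const k c)
  show ?case by (rule exI[of _ "\<lambda>_. 0"]) (auto intro: polf.const)
next
  case (add k f g)
  then obtain f' g' where "polf (k - 1) f'" "k = 0 \<longrightarrow> f' = (\<lambda>_. 0)"
    "\<forall>x. f x - f (x - (c + m x) *\<^sub>R d) = (c + m x) * f' x"
    "polf (k - 1) g'" "k = 0 \<longrightarrow> g' = (\<lambda>_. 0)"
    "\<forall>x. g x - g (x - (c + m x) *\<^sub>R d) = (c + m x) * g' x" by blast
  then show ?case
    by (intro exI[of _ "\<lambda>x. f' x + g' x"] conjI polf.add) (simp_all add: distrib_left add_diff_add)
next
  case (linear_mult l k f)
  then obtain g where g: "polf (k - 1) g" "k = 0 \<longrightarrow> g = (\<lambda>_. 0)"
    "\<forall>x. f x - f (x - (c + m x) *\<^sub>R d) = (c + m x) * g x" by blast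
  \<comment> \<open>With \<open>s = c + m x\<close> the product rule gives
    \<open>l d * f x + l (x - s *\<^sub>R d) * g x\<close>; the factor before \<open>g x\<close> is
    written as a constant plus a linear form to expose its degree.\<close>
  let ?g = "\<lambda>x. l d * f x + ((- c * l d) + (l x - m x * l d)) * g x"
  have "linear (\<lambda>x. l x - m x * l d)"
    using linear_mult by (simp add: linear_iff algebra_simps)
  then have "polf (1 + (k - 1)) (\<lambda>x. ((- c * l d) + (l x - m x * l d)) * g x)"
    using polf_mult[OF polf_affine g(1)] by blast
  then have "polf k (\<lambda>x. ((- c * l d) + (l x - m x * l d)) * g x)"
    using g(2) by (cases "k = 0") (simp_all add: polf.const)
  then have "polf k ?g"
    using linear_mult.hyps(2) by (intro polf.add polf_cmult)
  moreover have "l x * f x - l (x - (c + m x) *\<^sub>R d) * f (x - (c + m x) *\<^sub>R d) = (c + m x) * ?g x" for x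
  proof -
    have 1: "l (x - (c + m x) *\<^sub>R d) = l x - (c + m x) * l d"
      using linear_mult by (simp add: linear_diff linear_scale)
    have 2: "f (x - (c + m x) *\<^sub>R d) = f x - (c + m x) * g x" using g(3)[rule_format, of x] by simp
    show ?thesis unfolding 1 2 by (simp add: algebra_simps)
  qed
  ultimately show ?case by (intro exI[of _ ?g]) simp
qed

text \<open>
  Every \<open>x\<close> is moved along \<open>d\<close> to the zero plane of the divisor; the difference of the values
  of \<open>f\<close> has the divisor as a factor.
\<close>
lemma polf_divide_affine:
  assumes "polf (Suc k) f" "linear m" "m d = 1" "\<And>x. c + m x = 0 \<Longrightarrow> f x = 0"
  shows "\<exists>g. polf k g \<and> (\<forall>x. f x = (c + m x) * g x)"
proof -
  obtain g where g: "polf k g" "\<And>x. f x - f (x - (c + m x) *\<^sub>R d) = (c + m x) * g x"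
    using polf_difference_quotient[OF assms(1,2), of c d] by auto
  have "f (x - (c + m x) *\<^sub>R d) = 0" for x
    by (rule assms(4)) (use assms(2,3) in \<open>simp add: linear_diff linear_scale\<close>)
  then show ?thesis using g by auto
qed

lemma polf_1_affine:
  assumes "polf k f" "k \<le> 1"
  shows "\<exists>c l. linear l \<and> f = (\<lambda>x. c + l x)"
  using assms
proof (induction rule: polf.induct)
  case (const k c)
  show ?case by (intro exI[of _ c] exI[of _ "\<lambda>_. 0"]) (simp add: linear_iff)
next
  case (add k f g)
  then obtain c l c' l' where *: "linear l" "f = (\<lambda>x. c + l x)" "linear l'" "g = (\<lambda>x. c' + l' x)"
    by blast
  show ?case
    by (intro exI[of _ "c + c'"] exI[of _ "\<lambda>x. l x + l' x"]) (simp add: * linear_compose_add fun_eq_iff)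
next
  case (linear_mult l k f)
  then obtain c where "f = (\<lambda>_. c)" using polf_0_const[of k f] by auto
  moreover have "linear (\<lambda>x. l x * c)"
    using linear_mult.hyps(1) by (simp add: linear_iff algebra_simps)
  ultimately show ?case
    by (intro exI[of _ 0] exI[of _ "\<lambda>x. l x * c"]) simp
qed

section \<open>Integrability on compact sets\<close>

lemma continuous_on_compact_absolutely_integrable_on:
  fixes f :: "'a::euclidean_space \<Rightarrow> 'b::euclidean_space"
  assumes "compact S" "continuous_on S f"
  shows "f absolutely_integrable_on S"
proof -
  have "integrable lborel (\<lambda>x. indicator S x *\<^sub>R f x)"
    by (rule borel_integrable_compact[OF assms])
  then show ?thesis
    unfolding set_integrable_def by (subst integrable_completion) (auto dest: borel_measurable_integrable)
qed

lemma continuous_on_compact_integrable_on: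
  fixes f :: "'a::euclidean_space \<Rightarrow> 'b::euclidean_space"
  assumes "compact S" "continuous_on S f"
  shows "f integrable_on S"
  using continuous_on_compact_absolutely_integrable_on[OF assms] set_lebesgue_integral_eq_integral(1) by blast

lemma polf_integrable_on: "polf k f \<Longrightarrow> compact S \<Longrightarrow> f integrable_on S"
  by (rule continuous_on_compact_integrable_on) (auto intro: polf_continuous_on)

section \<open>Barycentric coordinates and integration by parts along an edge\<close>

text \<open>Extending \<open>f\<close> by zero to a box around the image reduces the claim to affine
  substitution on boxes.\<close>

lemma integral_scale_translate:
  fixes f :: "'a::euclidean_space \<Rightarrow> 'b::euclidean_space"
  assumes "m > 0" "bounded S" "f integrable_on ((\<lambda>x. m *\<^sub>R x + a) ` S)"
  shows "integral ((\<lambda>x. m *\<^sub>R x + a) ` S) f = m ^ DIM('a) *\<^sub>R integral S (\<lambda>x. f (m *\<^sub>R x + a))"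
proof -
  let ?T = "\<lambda>x. m *\<^sub>R x + a"
  let ?h = "\<lambda>y. if y \<in> ?T ` S then f y else 0"
  define I where "I = integral (?T ` S) f"
  have "bounded (?T ` S)"
    using bounded_translation[OF bounded_scaling[OF assms(2)], of a m] by (simp add: image_image add.commute)
  then obtain p q where pq: "?T ` S \<subseteq> cbox p q" using bounded_subset_cbox_symmetric by metis
  have "(f has_integral I) (?T ` S)" using assms(3) by (simp add: I_def integrable_integral)
  then have "(?h has_integral I) (cbox p q)" by (simp add: has_integral_restrict[OF pq])
  then have 1: "((\<lambda>x. ?h (?T x)) has_integral (I /\<^sub>R m ^ DIM('a))) (cbox ((p - a) /\<^sub>R m) ((q - a) /\<^sub>R m))"
    by (rule has_integral_affinity'[OF _ assms(1)])
  have 2: "S \<subseteq> cbox ((p - a) /\<^sub>R m) ((q - a) /\<^sub>R m)"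
    using pq assms(1) by (force simp: mem_box inner_diff_left inner_add_left field_simps)
  have 3: "(\<lambda>x. ?h (?T x)) = (\<lambda>x. if x \<in> S then f (?T x) else 0)"
  proof
    have "inj ?T" using assms(1) by (auto simp: inj_on_def)
    then show "?h (?T x) = (if x \<in> S then f (?T x) else 0)" for x
      using inj_image_mem_iff[of ?T x S] by simp
  qed
  have "((\<lambda>x. f (?T x)) has_integral (I /\<^sub>R m ^ DIM('a))) S"
    using 1 unfolding 3 by (simp only: has_integral_restrict[OF 2])
  then have "integral S (\<lambda>x. f (?T x)) = I /\<^sub>R m ^ DIM('a)" by (rule integral_unique)
  then show ?thesis using assms(1) by (simp add: I_def)
qed

text \<open>The map sending weights \<open>u\<close> to the pair of the weighted vertex sum and the
  total weight is injective by affine independence, hence bijective from \<open>real^4\<close> to a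
  space of the same dimension. Its inverse at \<open>(x, 1)\<close> lists the barycentric
  coordinates of \<open>x\<close>.\<close>

lemma barycentric_coordinates_exist:
  fixes v :: "4 \<Rightarrow> real^3"
  assumes "inj v" "\<not> affine_dependent (range v)"
  obtains c :: "4 \<Rightarrow> real" and g :: "4 \<Rightarrow> real^3"
  where "\<And>i j. c i + g i \<bullet> v j = (if i = j then 1 else 0)"
    and "\<And>x. (\<Sum>i\<in>UNIV. c i + g i \<bullet> x) = 1"
    and "\<And>x. (\<Sum>i\<in>UNIV. (c i + g i \<bullet> x) *\<^sub>R v i) = x"
proof -
  define \<Phi> :: "real^4 \<Rightarrow> (real^3) \<times> real" where "\<Phi> u = (\<Sum>i\<in>UNIV. (u $ i) *\<^sub>R v i, \<Sum>i\<in>UNIV. u $ i)" for u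
  have lin: "linear \<Phi>"
    by (intro linearI) (simp_all add: \<Phi>_def scaleR_add_left sum.distrib scaleR_sum_right sum_distrib_left)
  have "u = 0" if "\<Phi> u = 0" for u
  proof (rule ccontr)
    assume "u \<noteq> 0"
    then obtain k where k: "u $ k \<noteq> 0" by (auto simp: vec_eq_iff)
    define U where "U y = u $ (inv v y)" for y
    have U: "U (v i) = u $ i" for i by (simp add: U_def assms(1))
    have "sum U (range v) = 0" "(\<Sum>y\<in>range v. U y *\<^sub>R y) = 0"
      using that assms(1) by (simp_all add: sum.reindex U \<Phi>_def zero_prod_def)
    then have "affine_dependent (range v)"
      unfolding affine_dependent_explicit_finite[OF finite_imageI[OF finite]]
      using k U[of k] by (intro exI[of _ U] conjI bexI[of _ "v k"]) simp_all
    then show False using assms(2) by simp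
  qed
  then have inj: "inj \<Phi>" using lin by (simp add: linear_injective_0)
  have dim: "DIM(real^4) = DIM((real^3) \<times> real)" by simp
  have "range \<Phi> = UNIV"
  proof -
    have "dim (range \<Phi>) = DIM((real^3) \<times> real)"
      using dim_image_eq[OF lin, of UNIV] inj dim by (simp add: inj_on_def)
    then show ?thesis
      using linear_subspace_image[OF lin subspace_UNIV] by (metis dim_eq_full span_eq_iff)
  qed
  then obtain \<Psi> where \<Psi>: "linear \<Psi>" "\<Phi> \<circ> \<Psi> = id"
    using linear_surjective_right_inverse[OF lin] by (auto simp: surj_def)
  have \<Phi>\<Psi>: "\<Phi> (\<Psi> z) = z" for z using \<Psi>(2) by (metis comp_apply id_apply)
  have \<Psi>\<Phi>: "\<Psi> (\<Phi> u) = u" for u using \<Phi>\<Psi>[of "\<Phi> u"] inj by (simp add: inj_eq)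
  define c where "c i = \<Psi> (0, 1) $ i" for i
  \<comment> \<open>The adjoint of a real-valued functional, evaluated at 1, is its Riesz vector;
    here it is the gradient of the coordinate.\<close>
  define g where "g i = adjoint (\<lambda>x. \<Psi> (x, 0) $ i) 1" for i
  have lg: "linear (\<lambda>x. \<Psi> (x, 0) $ i)" for i
  proof (rule linearI)
    fix x y and r :: real
    show "\<Psi> (x + y, 0) $ i = \<Psi> (x, 0) $ i + \<Psi> (y, 0) $ i"
      using linear_add[OF \<Psi>(1), of "(x,0)" "(y,0)"] by simp
    show "\<Psi> (r *\<^sub>R x, 0) $ i = r *\<^sub>R \<Psi> (x, 0) $ i"
      using linear_scale[OF \<Psi>(1), of r "(x,0)"] by simp
  qed
  have lam: "c i + g i \<bullet> x = \<Psi> (x, 1) $ i" for i x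
    using adjoint_works[OF lg, of x i 1] linear_add[OF \<Psi>(1), of "(0,1)" "(x,0)"]
    by (simp add: c_def g_def inner_commute)
  show ?thesis
  proof (rule that)
    fix i j x
    have "\<Psi> (v j, 1) = axis j 1"
      using \<Psi>\<Phi>[of "axis j 1"] by (simp add: \<Phi>_def axis_def if_distrib if_distribR cong: if_cong)
    then show "c i + g i \<bullet> v j = (if i = j then 1 else 0)" by (simp add: lam axis_def)
    show "(\<Sum>i\<in>UNIV. c i + g i \<bullet> x) = 1" "(\<Sum>i\<in>UNIV. (c i + g i \<bullet> x) *\<^sub>R v i) = x"
      using \<Phi>\<Psi>[of "(x, 1)"] by (simp_all add: lam \<Phi>_def)
  qed
qed

section \<open>The tetrahedron in barycentric coordinates\<close>

locale tetrahedron =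
  fixes v :: "4 \<Rightarrow> real^3" and K :: "(real^3) set" and c :: "4 \<Rightarrow> real" and g :: "4 \<Rightarrow> real^3"
  assumes inj_v: "inj v" and indep: "\<not> affine_dependent (range v)" and K_hull: "K = convex hull (range v)"
    and dual: "c i + g i \<bullet> v j = (if i = j then 1 else 0)"
    and sum_bary: "(\<Sum>i\<in>UNIV. c i + g i \<bullet> x) = 1"
    and bary: "(\<Sum>i\<in>UNIV. (c i + g i \<bullet> x) *\<^sub>R v i) = x"
begin

definition lam :: "4 \<Rightarrow> real^3 \<Rightarrow> real" where "lam i x = c i + g i \<bullet> x"

definition tv :: "4 \<Rightarrow> 4 \<Rightarrow> real^3" where "tv i j = v j - v i"

lemma lam_v: "lam i (v j) = (if i = j then 1 else 0)" by (simp add: lam_def dual)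

lemma sum_lam: "(\<Sum>i\<in>UNIV. lam i x) = 1" by (simp add: lam_def sum_bary)

lemma sum_lam_v: "(\<Sum>i\<in>UNIV. lam i x *\<^sub>R v i) = x" by (simp add: lam_def bary)

lemma lam_diff: "lam i x - lam i y = g i \<bullet> (x - y)" by (simp add: lam_def inner_diff_right)

lemma g_tv: "g k \<bullet> tv i j = (if k = j then 1 else 0) - (if k = i then 1 else 0)"
  using lam_diff[of k "v j" "v i"] by (simp add: lam_v tv_def)

lemma sum_g: "(\<Sum>i\<in>UNIV. g i) = 0"
proof -
  have "(\<Sum>i\<in>UNIV. g i) \<bullet> y = 0" for y
    using sum_lam[of y] sum_lam[of 0] by (simp add: lam_def inner_sum_left sum.distrib)
  then show ?thesis using inner_eq_zero_iff by blast
qed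

lemma sum_g_v: "(\<Sum>i\<in>UNIV. (g i \<bullet> x) *\<^sub>R v i) = x"
  using sum_lam_v[of x] sum_lam_v[of 0] by (simp add: lam_def scaleR_add_left sum.distrib)

text \<open>The transpose of \<open>sum_g_v\<close>: the matrices \<open>v i (g i)'\<close> add up
  to the identity, hence so do the matrices \<open>g i (v i)'\<close>.\<close>

lemma sum_v_g: "(\<Sum>i\<in>UNIV. (v i \<bullet> x) *\<^sub>R g i) = x"
proof -
  have "(\<Sum>i\<in>UNIV. (v i \<bullet> x) *\<^sub>R g i) \<bullet> y = x \<bullet> y" for y
  proof -
    have "x \<bullet> y = x \<bullet> (\<Sum>i\<in>UNIV. (g i \<bullet> y) *\<^sub>R v i)" by (simp add: sum_g_v)
    then show ?thesis by (simp add: inner_sum_left inner_sum_right inner_commute mult.commute)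
  qed
  then show ?thesis using vector_eq_rdot by blast
qed

lemma lam_affine: "a + b = 1 \<Longrightarrow> lam i (a *\<^sub>R x + b *\<^sub>R y) = a * lam i x + b * lam i y"
proof -
  assume "a + b = 1"
  then have "c i = a * c i + b * c i" by (simp flip: distrib_right)
  then show ?thesis by (simp add: lam_def inner_add_right distrib_left)
qed

lemma K_eq: "K = {x. \<forall>i. 0 \<le> lam i x}"
proof (intro equalityI subsetI)
  fix x assume "x \<in> K"
  have "convex {x. \<forall>i. 0 \<le> lam i x}"
    by (auto simp: convex_def lam_affine)
  then have "convex hull (range v) \<subseteq> {x. \<forall>i. 0 \<le> lam i x}"
    by (intro hull_minimal) (auto simp: lam_v)
  then show "x \<in> {x. \<forall>i. 0 \<le> lam i x}" using \<open>x \<in> K\<close> K_hull by auto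
next
  fix x assume x: "x \<in> {x. \<forall>i. 0 \<le> lam i x}"
  have "(\<Sum>i\<in>UNIV. lam i x *\<^sub>R v i) \<in> K"
    unfolding K_hull using x
    by (intro convex_sum) (auto simp: sum_lam hull_inc)
  then show "x \<in> K" by (simp add: sum_lam_v)
qed

lemma compact_K: "compact K"
  unfolding K_hull by (intro compact_convex_hull finite_imp_compact) simp

lemma convex_K: "convex K" by (simp add: K_hull)

lemma continuous_on_lam: "continuous_on S (lam i)"
  unfolding lam_def by (intro continuous_intros)

lemma polf_lam: "polf 1 (lam i)"
  unfolding lam_def by (intro polf_affine) (simp add: linear_iff inner_add_right)

lemma interior_K: "interior K \<noteq> {}"
proof -
  let ?b = "(1/4) *\<^sub>R (\<Sum>i\<in>UNIV. v i)"
  have b: "lam i ?b = 1/4" for i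
  proof -
    have "lam i ?b = (1/4) * (\<Sum>j\<in>UNIV. lam i (v j))"
      by (simp add: lam_def inner_sum_right sum.distrib flip: sum_divide_distrib)
    then show ?thesis by (simp add: lam_v)
  qed
  have "open (\<Inter>i. {x. 0 < lam i x})"
    by (simp add: open_INT open_Collect_less continuous_on_lam)
  then have "(\<Inter>i. {x. 0 < lam i x}) \<subseteq> interior K"
    by (intro interior_maximal) (auto simp: K_eq less_imp_le)
  moreover have "?b \<in> (\<Inter>i. {x. 0 < lam i x})" by (simp only: INT_iff mem_Collect_eq b) simp
  ultimately show ?thesis by blast
qed


section \<open>Homotheties and derivatives along an edge\<close>

text \<open>The homothety with centre \<open>v i\<close> and ratio \<open>1 - h\<close> maps
  \<open>K\<close> onto the part where \<open>lam i\<close> is at least \<open>h\<close>, with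
  Jacobian \<open>(1 - h) ^ 3\<close>.\<close>

lemma integral_K_scale:
  assumes "0 < h" "h < 1" "continuous_on K f"
  shows "(1 - h) ^ 3 * integral K (\<lambda>x. f (h *\<^sub>R v i + (1 - h) *\<^sub>R x)) =
    integral {x\<in>K. h \<le> lam i x} (f :: _ \<Rightarrow> real)"
proof -
  let ?T = "\<lambda>x. (1 - h) *\<^sub>R x + h *\<^sub>R v i"
  have img: "?T ` K = {x\<in>K. h \<le> lam i x}"
  proof (intro equalityI subsetI)
    fix y assume "y \<in> ?T ` K"
    then obtain x where x: "y = ?T x" "x \<in> K" by blast
    have "lam k y = (1 - h) * lam k x + h * lam k (v i)" for k
      unfolding x by (rule lam_affine) simp
    then show "y \<in> {x\<in>K. h \<le> lam i x}"
      using x(2) assms by (auto simp: K_eq lam_v)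
  next
    fix y assume y: "y \<in> {x\<in>K. h \<le> lam i x}"
    define x where "x = (1 / (1 - h)) *\<^sub>R y + (- h / (1 - h)) *\<^sub>R v i"
    have "lam k x = (1 / (1 - h)) * lam k y + (- h / (1 - h)) * lam k (v i)" for k
      unfolding x_def by (rule lam_affine) (use assms in \<open>simp add: field_simps\<close>)
    then have "lam k x = (lam k y - h * (if k = i then 1 else 0)) / (1 - h)" for k
      by (simp add: lam_v divide_simps)
    then have "x \<in> K" using y assms by (auto simp: K_eq)
    moreover have "y = ?T x"
      using assms by (simp add: x_def scaleR_diff_right)
    ultimately show "y \<in> ?T ` K" by blast
  qed
  have "compact (?T ` K)"
    by (intro compact_continuous_image compact_K continuous_intros)
  moreover have "continuous_on (?T ` K) f"
    using assms(3) by (rule continuous_on_subset) (auto simp: img)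
  ultimately have "f integrable_on (?T ` K)" by (rule continuous_on_compact_integrable_on)
  then have "integral (?T ` K) f = (1 - h) ^ DIM(real^3) *\<^sub>R integral K (\<lambda>x. f (?T x))"
    using assms by (intro integral_scale_translate compact_imp_bounded compact_K) auto
  then show ?thesis by (simp add: img add.commute[of "h *\<^sub>R v i"])
qed

text \<open>The slab where \<open>lam i < h\<close> has \<open>1 - (1 - h) ^ 3\<close> times the
  volume of \<open>K\<close>, hence at most \<open>3 * h\<close> times it, and on the slab
  \<open>f\<close> is bounded by \<open>C * h\<close>.\<close>

lemma integral_K_edge_difference_bound:
  assumes "0 < h" "h < 1" and f: "continuous_on K f"
    and C: "\<And>x. x \<in> K \<Longrightarrow> \<bar>f x\<bar> \<le> C * lam i x"
  shows "\<bar>integral K f - integral {x\<in>K. h \<le> lam i x} f\<bar> \<le> 3 * C * integral K (\<lambda>_. 1) * h\<^sup>2"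
proof -
  let ?A = "{x\<in>K. h \<le> lam i x}"
  have "\<bar>f (v i)\<bar> \<le> C * lam i (v i)" by (rule C) (simp add: K_eq lam_v)
  then have C0: "0 \<le> C" by (simp add: lam_v)
  have A: "compact ?A"
  proof -
    have "closed {x. h \<le> lam i x}" by (intro closed_Collect_le continuous_intros continuous_on_lam)
    then have "compact (K \<inter> {x. h \<le> lam i x})" using compact_K by blast
    then show ?thesis by (simp add: Int_def)
  qed
  have res: "integral ?A u = integral K (\<lambda>x. if x \<in> ?A then u x else 0)"
     "(\<lambda>x. if x \<in> ?A then u x else 0) integrable_on K" if "continuous_on K u" for u :: "_ \<Rightarrow> real"
  proof -
    show "integral ?A u = integral K (\<lambda>x. if x \<in> ?A then u x else 0)"
      unfolding integral_restrict_Int by (rule arg_cong[where f = "\<lambda>S. integral S u"]) auto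
    have "u integrable_on ?A"
      by (intro continuous_on_compact_integrable_on A continuous_on_subset[OF that]) auto
    then show "(\<lambda>x. if x \<in> ?A then u x else 0) integrable_on K"
      unfolding integrable_restrict_Int by (rule back_subst[where P = "\<lambda>S. u integrable_on S"]) auto
  qed
  have i1: "f integrable_on K" "(\<lambda>_. 1::real) integrable_on K"
    using f by (auto intro!: continuous_on_compact_integrable_on compact_K)
  have "\<bar>integral K f - integral ?A f\<bar> = norm (integral K (\<lambda>x. f x - (if x \<in> ?A then f x else 0)))"
    using res[OF f] i1 by (subst integral_diff) auto
  also have "\<dots> \<le> integral K (\<lambda>x. C * h * (1 - (if x \<in> ?A then 1 else 0)))"
  proof (rule integral_norm_bound_integral)
    show "(\<lambda>x. f x - (if x \<in> ?A then f x else 0)) integrable_on K"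
      using res(2)[OF f] i1 by (intro integrable_diff)
    show "(\<lambda>x. C * h * (1 - (if x \<in> ?A then 1 else 0))) integrable_on K"
      using res(2)[of "\<lambda>_. 1"] i1 by (intro integrable_on_mult_right integrable_diff) auto
    fix x assume x: "x \<in> K"
    have "\<bar>f x\<bar> \<le> C * h" if "lam i x < h"
      using C[OF x] C0 that mult_left_mono[of "lam i x" h C] by linarith
    then show "norm (f x - (if x \<in> ?A then f x else 0)) \<le> C * h * (1 - (if x \<in> ?A then 1 else 0))"
      using x by auto
  qed
  also have "\<dots> = C * h * (integral K (\<lambda>_. 1) - integral ?A (\<lambda>_. 1))"
    using res[of "\<lambda>_. 1"] i1 by (simp add: integral_diff)
  also have "integral ?A (\<lambda>_. 1) = (1 - h) ^ 3 * integral K (\<lambda>_. 1::real)"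
    using integral_K_scale[OF assms(1,2), of "\<lambda>_. 1" i] by simp
  also have "C * h * (integral K (\<lambda>_. 1) - (1 - h) ^ 3 * integral K (\<lambda>_. 1)) =
    C * h * integral K (\<lambda>_. 1) * (1 - (1 - h) ^ 3)" by (simp add: algebra_simps)
  also have "\<dots> \<le> C * h * integral K (\<lambda>_. 1) * (3 * h)"
  proof (rule mult_left_mono)
    have "1 - (1 - h) ^ 3 = 3 * h - h\<^sup>2 * (3 - h)" by (simp add: power2_eq_square power3_eq_cube algebra_simps)
    also have "\<dots> \<le> 3 * h" using assms by simp
    finally show "1 - (1 - h) ^ 3 \<le> 3 * h" .
    show "0 \<le> C * h * integral K (\<lambda>_. 1)"
      using C0 assms i1 by (intro mult_nonneg_nonneg integral_nonneg) auto
  qed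
  finally show ?thesis by (simp add: power2_eq_square mult_ac)
qed

text \<open>
  With \<open>f\<close> the function being differentiated and \<open>A i h\<close> the image of \<open>K\<close> under the homothety with centre
  \<open>v i\<close> and ratio \<open>1 - h\<close>, the difference of the integrals of \<open>f\<close> over \<open>A j h\<close>
  and \<open>A i h\<close> is \<open>O(h\<^sup>2)\<close> since \<open>f = O(h)\<close> on the complements, whereas its
  derivative at \<open>h = 0\<close> is the integral in question.
\<close>
lemma integral_edge_derivative:
  assumes r: "polf k r" and "i \<noteq> j"
  shows "integral K (\<lambda>x. frechet_derivative (\<lambda>x. lam i x * lam j x * r x) (at x) (tv i j)) = 0"
proof -
  define f where "f x = lam i x * lam j x * r x" for x
  have pf: "polf (1 + 1 + k) f"
    unfolding f_def by (intro polf_mult polf_lam r)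
  define D where "D x = frechet_derivative f (at x)" for x
  have D: "(f has_derivative D x) (at x)" for x
    unfolding D_def by (rule polf_has_derivative[OF pf])
  have cf: "continuous_on S f" for S by (rule polf_continuous_on[OF pf])
  \<comment> \<open>The shift by 2 puts every \<open>h n\<close> strictly between 0 and 1.\<close>
  define h :: "nat \<Rightarrow> real" where "h n = 1 / (real n + 2)" for n
  have h: "0 < h n" "h n < 1" for n by (simp_all add: h_def)
  have h0: "h \<longlonglongrightarrow> 0" 
    using LIMSEQ_ignore_initial_segment[OF lim_1_over_n[where 'a = real], of 2]
    by (simp add: h_def[abs_def] add.commute)
  \<comment> \<open>The difference quotient between the two homotheties. Its limit is the derivative
    towards \<open>v j\<close> minus the derivative towards \<open>v i\<close>, that is, the
    derivative along \<open>tv i j\<close>.\<close>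
  define \<Delta> where "\<Delta> n x = (f (h n *\<^sub>R v j + (1 - h n) *\<^sub>R x) - f (h n *\<^sub>R v i + (1 - h n) *\<^sub>R x)) / h n" for n x
  obtain C where C: "\<And>l x. x \<in> K \<Longrightarrow> l \<in> {i, j} \<Longrightarrow> \<bar>f x\<bar> \<le> C * lam l x"
  proof -
    have bdd: "\<exists>B. \<forall>x\<in>K. \<bar>lam l x * r x\<bar> \<le> B" for l
    proof -
      have "compact ((\<lambda>x. lam l x * r x) ` K)"
        by (intro compact_continuous_image compact_K continuous_intros continuous_on_lam polf_continuous_on[OF r])
      then have "bounded ((\<lambda>x. lam l x * r x) ` K)" by (rule compact_imp_bounded)
      then show ?thesis by (auto simp: bounded_iff)
    qed
    obtain B1 B2 where B: "\<And>x. x \<in> K \<Longrightarrow> \<bar>lam i x * r x\<bar> \<le> B1" "\<And>x. x \<in> K \<Longrightarrow> \<bar>lam j x * r x\<bar> \<le> B2"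
      using bdd by metis
    show ?thesis
    proof (rule that)
      fix l x assume x: "x \<in> K" "l \<in> {i, j}"
      have pos: "0 \<le> lam i x" "0 \<le> lam j x" using x by (auto simp: K_eq)
      have "\<bar>f x\<bar> = \<bar>lam j x * r x\<bar> * lam i x" "\<bar>f x\<bar> = \<bar>lam i x * r x\<bar> * lam j x"
        using pos by (simp_all add: f_def abs_mult)
      moreover have "\<bar>lam j x * r x\<bar> * lam i x \<le> (\<bar>B1\<bar> + \<bar>B2\<bar>) * lam i x"
        "\<bar>lam i x * r x\<bar> * lam j x \<le> (\<bar>B1\<bar> + \<bar>B2\<bar>) * lam j x"
        using B[OF x(1)] pos by (auto intro!: mult_right_mono)
      ultimately show "\<bar>f x\<bar> \<le> (\<bar>B1\<bar> + \<bar>B2\<bar>) * lam l x"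
        using x(2) by auto
    qed
  qed
  \<comment> \<open>A Lipschitz constant on the convex set \<open>K\<close> supplies the dominating
    constant for the passage to the limit.\<close>
  obtain L where L: "\<And>x y. x \<in> K \<Longrightarrow> y \<in> K \<Longrightarrow> \<bar>f x - f y\<bar> \<le> L * norm (x - y)"
  proof -
    have "\<exists>B. \<forall>x\<in>K. \<bar>D x b\<bar> \<le> B" for b
    proof -
      have "compact ((\<lambda>x. D x b) ` K)"
        unfolding D_def by (intro compact_continuous_image compact_K polf_continuous_on[OF polf_frechet_derivative[OF pf]])
      then have "bounded ((\<lambda>x. D x b) ` K)" by (rule compact_imp_bounded)
      then show ?thesis by (auto simp: bounded_iff)
    qed
    then obtain B where B: "\<And>b x. x \<in> K \<Longrightarrow> \<bar>D x b\<bar> \<le> B b" by metis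
    show ?thesis
    proof (rule that)
      fix x y assume "x \<in> K" "y \<in> K"
      then show "\<bar>f x - f y\<bar> \<le> (\<Sum>b\<in>Basis. B b) * norm (x - y)"
        unfolding real_norm_def[symmetric]
      proof (intro differentiable_bound[OF convex_K])
        fix x assume x: "x \<in> K"
        show "(f has_derivative D x) (at x within K)" by (rule has_derivative_at_withinI[OF D])
        have lD: "linear (D x)" using D has_derivative_linear by blast
        show "onorm (D x) \<le> (\<Sum>b\<in>Basis. B b)"
        proof (rule onorm_le)
          fix y
          have "D x y = (\<Sum>b\<in>Basis. (y \<bullet> b) * D x b)"
            by (subst euclidean_representation[of y, symmetric])
              (simp only: linear_sum[OF lD] linear_scale[OF lD] real_scaleR_def)
          also have "norm \<dots> \<le> (\<Sum>b\<in>Basis. B b * norm y)"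
          proof (rule sum_norm_le)
            fix b :: "real^3" assume b: "b \<in> Basis"
            have "\<bar>D x b\<bar> * \<bar>y \<bullet> b\<bar> \<le> B b * norm y"
              using B[OF x, of b] by (intro mult_mono Basis_le_norm b) auto
            then show "norm ((y \<bullet> b) * D x b) \<le> B b * norm y" by (simp add: abs_mult mult.commute)
          qed
          finally show "norm (D x y) \<le> (\<Sum>b\<in>Basis. B b) * norm y" by (simp add: sum_distrib_right)
        qed
      qed
    qed
  qed
  have inK: "h n *\<^sub>R v l + (1 - h n) *\<^sub>R x \<in> K" if "x \<in> K" for n l x
    using that h[of n] convexD[OF convex_K, of "v l" x "h n" "1 - h n"] hull_inc[of "v l" "range v" convex]
    by (simp add: K_hull)
  have int\<Delta>: "\<Delta> n integrable_on K" for n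
    unfolding \<Delta>_def
    by (intro continuous_on_compact_integrable_on compact_K continuous_intros
        continuous_on_compose2[OF cf[of UNIV]]) (use h[of n] in auto)
  have bound\<Delta>: "norm (\<Delta> n x) \<le> L * norm (tv i j)" if "x \<in> K" for n x
  proof -
    have "\<bar>f (h n *\<^sub>R v j + (1 - h n) *\<^sub>R x) - f (h n *\<^sub>R v i + (1 - h n) *\<^sub>R x)\<bar> \<le> L * norm (h n *\<^sub>R tv i j)"
      using L[OF inK[OF that, of n j] inK[OF that, of n i]] by (simp add: tv_def scaleR_diff_right)
    then show ?thesis using h[of n] by (simp add: \<Delta>_def divide_simps mult_ac)
  qed
  have lim\<Delta>: "(\<lambda>n. \<Delta> n x) \<longlonglongrightarrow> D x (tv i j)" for x
  proof -
    have 1: "(\<lambda>n. (f (h n *\<^sub>R v l + (1 - h n) *\<^sub>R x) - f x) / h n) \<longlonglongrightarrow> D x (v l - x)" for l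
    proof -
      have "((\<lambda>s. f (x + s *\<^sub>R (v l - x))) has_derivative (\<lambda>s. D x (s *\<^sub>R (v l - x)))) (at 0)"
        by (rule has_derivative_compose[where g = f and f = "\<lambda>s. x + s *\<^sub>R (v l - x)"])
          (auto intro!: derivative_eq_intros D)
      then have "((\<lambda>s. f (x + s *\<^sub>R (v l - x))) has_real_derivative D x (v l - x)) (at 0)"
        using linear_scale[OF has_derivative_linear[OF D]]
        by (simp add: has_field_derivative_def mult_commute_abs)
      then have "((\<lambda>s. (f (x + s *\<^sub>R (v l - x)) - f x) / s) \<longlongrightarrow> D x (v l - x)) (at 0)"
        by (simp add: DERIV_def)
      then have "((\<lambda>n. (f (x + h n *\<^sub>R (v l - x)) - f x) / h n) \<longlongrightarrow> D x (v l - x)) sequentially"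
        by (rule filterlim_compose) (use h0 h in \<open>auto simp: filterlim_at intro!: always_eventually less_imp_neq[symmetric]\<close>)
      then show ?thesis by (simp add: algebra_simps)
    qed
    have "\<Delta> n x = (f (h n *\<^sub>R v j + (1 - h n) *\<^sub>R x) - f x) / h n - (f (h n *\<^sub>R v i + (1 - h n) *\<^sub>R x) - f x) / h n" for n
      by (simp add: \<Delta>_def diff_divide_distrib)
    then have "(\<lambda>n. \<Delta> n x) \<longlonglongrightarrow> D x (v j - x) - D x (v i - x)"
      using tendsto_diff[OF 1[of j] 1[of i]] by simp
    then show ?thesis
      using linear_diff[OF has_derivative_linear[OF D[of x]], of "v j - x" "v i - x"] by (simp add: tv_def)
  qed
  have "(\<lambda>n. integral K (\<Delta> n)) \<longlonglongrightarrow> integral K (\<lambda>x. D x (tv i j))"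
    by (rule dominated_convergence(2)[OF int\<Delta> _ bound\<Delta> lim\<Delta>])
      (auto intro!: continuous_on_compact_integrable_on compact_K)
  moreover have "(\<lambda>n. integral K (\<Delta> n)) \<longlonglongrightarrow> 0"
  proof (rule Lim_null_comparison)
    \<comment> \<open>Each of the two slabs contributes \<open>3 * C\<close> times the
      volume.\<close>
    define B where "B = 6 * C * integral K (\<lambda>_. 1)"
    have eq: "(1 - h n) ^ 3 * (h n * integral K (\<Delta> n)) =
        integral {x\<in>K. h n \<le> lam j x} f - integral {x\<in>K. h n \<le> lam i x} f" for n
    proof -
      have intl: "(\<lambda>x. f (h n *\<^sub>R v l + (1 - h n) *\<^sub>R x)) integrable_on K" for l
        by (intro continuous_on_compact_integrable_on compact_K continuous_intros
          continuous_on_compose2[OF cf[of UNIV]]) auto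
      have "h n * integral K (\<Delta> n) = integral K (\<lambda>x. f (h n *\<^sub>R v j + (1 - h n) *\<^sub>R x)) -
          integral K (\<lambda>x. f (h n *\<^sub>R v i + (1 - h n) *\<^sub>R x))"
        using h[of n] unfolding \<Delta>_def by (simp add: integral_diff[OF intl intl])
      then show ?thesis
        by (simp only: right_diff_distrib integral_K_scale[OF h cf])
    qed
    have le: "\<bar>integral {x\<in>K. h n \<le> lam j x} f - integral {x\<in>K. h n \<le> lam i x} f\<bar> \<le> B * (h n)\<^sup>2" for n
    proof -
      have "\<bar>integral K f - integral {x\<in>K. h n \<le> lam l x} f\<bar> \<le> 3 * C * integral K (\<lambda>_. 1) * (h n)\<^sup>2"
        if "l \<in> {i, j}" for l
        using that by (intro integral_K_edge_difference_bound h cf C)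
      from this[of i, simplified] this[of j, simplified] show ?thesis unfolding B_def by linarith
    qed
    have 1: "(1 - h n) ^ 3 * h n * \<bar>integral K (\<Delta> n)\<bar> \<le> B * (h n)\<^sup>2" for n
    proof -
      have "(1 - h n) ^ 3 * h n * \<bar>integral K (\<Delta> n)\<bar> = \<bar>(1 - h n) ^ 3 * (h n * integral K (\<Delta> n))\<bar>"
        using h[of n] by (simp add: abs_mult power_abs)
      then show ?thesis using le[of n] unfolding eq by simp
    qed
    show "\<forall>\<^sub>F n in sequentially. norm (integral K (\<Delta> n)) \<le> B * h n / (1 - h n) ^ 3"
    proof (rule always_eventually, rule allI)
      fix n show "norm (integral K (\<Delta> n)) \<le> B * h n / (1 - h n) ^ 3"
        using 1[of n] h[of n] by (simp add: pos_le_divide_eq power2_eq_square mult_ac)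
    qed
    have "(\<lambda>n. B * h n / (1 - h n) ^ 3) \<longlonglongrightarrow> B * 0 / (1 - 0) ^ 3"
      by (intro tendsto_intros h0) auto
    then show "(\<lambda>n. B * h n / (1 - h n) ^ 3) \<longlonglongrightarrow> 0" by simp
  qed
  ultimately have "integral K (\<lambda>x. D x (tv i j)) = 0" by (rule LIMSEQ_unique)
  then show ?thesis by (simp add: D_def f_def[abs_def])
qed

end

section \<open>Monomials and coefficients\<close>

definition expo :: "nat \<Rightarrow> (3 \<Rightarrow> nat) set" where "expo k = {\<alpha>. sum \<alpha> UNIV \<le> k}"

definition xmonom :: "(3 \<Rightarrow> nat) \<Rightarrow> real^3 \<Rightarrow> real" where "xmonom \<alpha> x = (\<Prod>i\<in>UNIV. (x $ i) ^ \<alpha> i)"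

lemma expo_mono: "j \<le> k \<Longrightarrow> expo j \<subseteq> expo k"
  by (auto simp: expo_def)

lemma finite_expo [simp]: "finite (expo k)"
proof -
  have "expo k \<subseteq> {\<alpha>. \<forall>i. \<alpha> i \<in> {..k}}"
    by (auto simp: expo_def intro: order_trans[OF member_le_sum[of _ UNIV]])
  moreover have "finite {\<alpha>::3\<Rightarrow>nat. \<forall>i. \<alpha> i \<in> {..k}}"
    using finite_PiE[of "UNIV::3 set" "\<lambda>_. {..k}"] by (simp add: PiE_UNIV_domain Pi_def)
  ultimately show ?thesis by (rule finite_subset)
qed

lemma card_expo: "card (expo k) = (\<Sum>a\<le>k. \<Sum>b\<le>k - a. Suc (k - a - b))"
proof -
  let ?S = "SIGMA a:{..k}. SIGMA b:{..k - a}. {..k - a - b}"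
  have "bij_betw (\<lambda>\<alpha>. (\<alpha> 1, \<alpha> 2, \<alpha> 3)) (expo k) ?S"
  proof (rule bij_betw_byWitness[where f' = "\<lambda>(a, b, c) i. if i = 1 then a else if i = 2 then b else c"])
    show "\<forall>\<alpha>\<in>expo k. (case (\<alpha> 1, \<alpha> 2, \<alpha> 3) of (a, b, c) \<Rightarrow> \<lambda>i. if i = 1 then a else if i = 2 then b else c) = \<alpha>"
      by (auto simp: fun_eq_iff) (metis exhaust_3)
  qed (auto simp: expo_def sum_3)
  then have "card (expo k) = card ?S" by (rule bij_betw_same_card)
  then show ?thesis by (simp add: card_SigmaI)
qed

lemma card_expo_numeral: "card (expo 1) = 4" "card (expo 2) = 10" "card (expo 3) = 20" "card (expo 4) = 35"
  by (simp_all add: card_expo eval_nat_numeral)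

lemma polf_power: "polf j f \<Longrightarrow> polf (n * j) (\<lambda>x. f x ^ n)"
  by (induction n) (auto intro: polf.const polf_mult)

lemma polf_xmonom: "\<alpha> \<in> expo k \<Longrightarrow> polf k (xmonom \<alpha>)"
proof -
  have comp: "polf 1 (\<lambda>x::real^3. x $ i)" for i by (rule polf_linear) (simp add: linear_iff)
  have "polf (sum \<alpha> A) (\<lambda>x. \<Prod>i\<in>A. (x $ i) ^ \<alpha> i)" if "finite A" for A
    using that
  proof induction
    case empty
    show ?case by (simp add: polf.const)
  next
    case (insert i A)
    have "polf (\<alpha> i * 1 + sum \<alpha> A) (\<lambda>x. (x $ i) ^ \<alpha> i * (\<Prod>i\<in>A. (x $ i) ^ \<alpha> i))"
      by (intro polf_mult polf_power comp insert.IH)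
    then show ?case using insert by simp
  qed
  then have "polf (sum \<alpha> UNIV) (xmonom \<alpha>)" by (simp add: xmonom_def[abs_def])
  then show "\<alpha> \<in> expo k \<Longrightarrow> polf k (xmonom \<alpha>)" by (auto simp: expo_def intro: polf_mono)
qed

lemma xmonom_Suc: "xmonom (\<alpha>(i := Suc (\<alpha> i))) x = x $ i * xmonom \<alpha> x"
proof -
  have "(\<Prod>j\<in>UNIV - {i}. (x $ j) ^ (\<alpha>(i := Suc (\<alpha> i))) j) = (\<Prod>j\<in>UNIV - {i}. (x $ j) ^ \<alpha> j)"
    by (rule prod.cong) auto
  then show ?thesis by (simp add: xmonom_def prod.remove[of UNIV i])
qed

text \<open>Multiplication by a coordinate raises one exponent; exponents with
  \<open>\<alpha> i = 0\<close> are not reached and get coefficient 0.\<close>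

lemma xmonom_shift:
  "(\<Sum>\<alpha>\<in>expo k. x $ i * (xmonom \<alpha> x * c \<alpha>)) =
    (\<Sum>\<alpha>\<in>expo (Suc k). xmonom \<alpha> x * (if \<alpha> i = 0 then 0 else c (\<alpha>(i := \<alpha> i - 1))))"
proof -
  let ?s = "\<lambda>\<alpha>::3\<Rightarrow>nat. \<alpha>(i := Suc (\<alpha> i))"
  have sum_s: "sum (?s \<alpha>) UNIV = Suc (sum \<alpha> UNIV)" for \<alpha>
  proof -
    have "sum (?s \<alpha>) (UNIV - {i}) = sum \<alpha> (UNIV - {i})" by (rule sum.cong) auto
    then show ?thesis by (simp add: sum.remove[of UNIV i])
  qed
  have inv: "?s (\<alpha>(i := \<alpha> i - 1)) = \<alpha>" if "\<alpha> i \<noteq> 0" for \<alpha>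
    using that by (auto simp: fun_eq_iff)
  have "(\<Sum>\<alpha>\<in>expo k. x $ i * (xmonom \<alpha> x * c \<alpha>)) =
      (\<Sum>\<alpha>\<in>{\<alpha> \<in> expo (Suc k). \<alpha> i \<noteq> 0}. xmonom \<alpha> x * c (\<alpha>(i := \<alpha> i - 1)))"
  proof (rule sum.reindex_bij_witness[where j = ?s and i = "\<lambda>\<alpha>. \<alpha>(i := \<alpha> i - 1)"])
    fix \<alpha> assume "\<alpha> \<in> {\<alpha> \<in> expo (Suc k). \<alpha> i \<noteq> 0}"
    then show "?s (\<alpha>(i := \<alpha> i - 1)) = \<alpha>" "\<alpha>(i := \<alpha> i - 1) \<in> expo k"
      using inv[of \<alpha>] sum_s[of "\<alpha>(i := \<alpha> i - 1)"] by (auto simp: expo_def)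
  qed (auto simp: expo_def sum_s xmonom_Suc simp del: fun_upd_apply, auto)
  also have "\<dots> = (\<Sum>\<alpha>\<in>expo (Suc k). xmonom \<alpha> x * (if \<alpha> i = 0 then 0 else c (\<alpha>(i := \<alpha> i - 1))))"
    by (rule sum.mono_neutral_cong_left) auto
  finally show ?thesis .
qed

text \<open>Together with \<open>polf_xmonom_sum\<close> this identifies the inductive notion with
  the monomial form used in \<open>polys\<close>. For a product with a linear form, the form is
  expanded in coordinates and the shifted coefficients are collected.\<close>

lemma polf_imp_xmonom_sum:
  fixes f :: "real^3 \<Rightarrow> real"
  shows "polf k f \<Longrightarrow> \<exists>c. \<forall>x. f x = (\<Sum>\<alpha>\<in>expo k. xmonom \<alpha> x * c \<alpha>)"
proof (induction rule: polf.induct)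
  case (const k d)
  have "(\<Sum>\<alpha>\<in>expo k. xmonom \<alpha> x * (if \<alpha> = (\<lambda>_. 0) then d else 0)) = d" for x
  proof -
    have "(\<lambda>_. 0) \<in> expo k" by (simp add: expo_def)
    then show ?thesis
      by (simp add: if_distrib if_distribR xmonom_def cong: if_cong)
  qed
  then show ?case by (intro exI[of _ "\<lambda>\<alpha>. if \<alpha> = (\<lambda>_. 0) then d else 0"]) simp
next
  case (add k f g)
  then obtain c d where "\<forall>x. f x = (\<Sum>\<alpha>\<in>expo k. xmonom \<alpha> x * c \<alpha>)" "\<forall>x. g x = (\<Sum>\<alpha>\<in>expo k. xmonom \<alpha> x * d \<alpha>)"
    by blast
  then show ?case
    by (intro exI[of _ "\<lambda>\<alpha>. c \<alpha> + d \<alpha>"]) (simp add: distrib_left sum.distrib)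
next
  case (linear_mult l k f)
  then obtain c where c: "\<forall>x. f x = (\<Sum>\<alpha>\<in>expo k. xmonom \<alpha> x * c \<alpha>)" by blast
  let ?d = "\<lambda>i \<alpha>. if \<alpha> i = 0 then 0 else c (\<alpha>(i := \<alpha> i - 1))"
  have l: "l x = (\<Sum>i\<in>UNIV. x $ i * l (axis i 1))" for x
  proof -
    have "l x = l (\<Sum>i\<in>UNIV. x $ i *\<^sub>R axis i 1)" by (simp add: basis_expansion scalar_mult_eq_scaleR[symmetric])
    then show ?thesis using linear_mult.hyps(1) by (simp add: linear_sum linear_scale)
  qed
  show ?case
  proof (intro exI[of _ "\<lambda>\<alpha>. \<Sum>i\<in>UNIV. l (axis i 1) * ?d i \<alpha>"] allI)
    fix x
    have "l x * f x = (\<Sum>i\<in>UNIV. l (axis i 1) * (\<Sum>\<alpha>\<in>expo k. x $ i * (xmonom \<alpha> x * c \<alpha>)))"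
      by (subst l) (simp add: c sum_distrib_left sum_distrib_right mult_ac)
    also have "\<dots> = (\<Sum>i\<in>UNIV. l (axis i 1) * (\<Sum>\<alpha>\<in>expo (Suc k). xmonom \<alpha> x * ?d i \<alpha>))"
      by (simp only: xmonom_shift)
    also have "\<dots> = (\<Sum>\<alpha>\<in>expo (Suc k). xmonom \<alpha> x * (\<Sum>i\<in>UNIV. l (axis i 1) * ?d i \<alpha>))"
      unfolding sum_distrib_left by (subst sum.swap) (simp only: mult.left_commute)
    finally show "l x * f x = (\<Sum>\<alpha>\<in>expo (Suc k). xmonom \<alpha> x * (\<Sum>i\<in>UNIV. l (axis i 1) * ?d i \<alpha>))" .
  qed
qed

lemma polf_xmonom_sum: "polf k (\<lambda>x. \<Sum>\<alpha>\<in>expo k. xmonom \<alpha> x * c \<alpha>)"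
  by (intro polf_sum polf_mult_const polf_xmonom)

text \<open>Induction on the variables: with the others frozen, the sum is a univariate polynomial
  in the new variable, so each of its coefficients is zero, and each is again a sum over a slice of
  \<open>A\<close>. Slices need not have the form \<open>expo k\<close>, hence an arbitrary finite
  \<open>A\<close>.\<close>

lemma monomials_independent_aux:
  fixes c :: "('i \<Rightarrow> nat) \<Rightarrow> real"
  assumes "finite S" "finite A" "\<And>\<alpha> i. \<alpha> \<in> A \<Longrightarrow> i \<notin> S \<Longrightarrow> \<alpha> i = 0"
    and "\<And>x. (\<Sum>\<alpha>\<in>A. c \<alpha> * (\<Prod>i\<in>S. x i ^ \<alpha> i)) = 0" and "\<alpha> \<in> A"
  shows "c \<alpha> = 0"
  using assms
proof (induction S arbitrary: A c \<alpha> rule: finite_induct)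
  case empty
  have "\<beta> = (\<lambda>_. 0)" if "\<beta> \<in> A" for \<beta>
    using empty.prems(2)[OF that] by auto
  then have "A = {\<alpha>}" using empty.prems(4) by auto
  then show ?case using empty.prems(3) by simp
next
  case (insert j S)
  define m where "m = \<alpha> j"
  define A' where "A' n = {\<beta> \<in> A. \<beta> j = n}" for n
  obtain N where N: "\<And>\<beta>. \<beta> \<in> A \<Longrightarrow> \<beta> j \<le> N"
    using insert.prems(1) finite_nat_set_iff_bounded_le[of "(\<lambda>\<beta>. \<beta> j) ` A"] by auto
  have "(\<Sum>\<beta>\<in>A' m. c \<beta> * (\<Prod>i\<in>S. x i ^ \<beta> i)) = 0" for x
  proof -
    define d where "d n = (\<Sum>\<beta>\<in>A' n. c \<beta> * (\<Prod>i\<in>S. x i ^ \<beta> i))" for n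
    have "(\<Sum>n\<le>N. d n * t ^ n) = 0" for t
    proof -
      have "(\<Sum>n\<le>N. d n * t ^ n) = (\<Sum>n\<le>N. \<Sum>\<beta>\<in>{\<beta> \<in> A. \<beta> j = n}. c \<beta> * (\<Prod>i\<in>S. x i ^ \<beta> i) * t ^ \<beta> j)"
        by (simp add: d_def A'_def sum_distrib_right)
      also have "\<dots> = (\<Sum>\<beta>\<in>A. c \<beta> * (\<Prod>i\<in>S. x i ^ \<beta> i) * t ^ \<beta> j)"
        using insert.prems(1) N by (intro sum.group) auto
      also have "\<dots> = (\<Sum>\<beta>\<in>A. c \<beta> * (\<Prod>i\<in>insert j S. (x(j := t)) i ^ \<beta> i))"
      proof (rule sum.cong)
        fix \<beta>
        have "(\<Prod>i\<in>S. (x(j := t)) i ^ \<beta> i) = (\<Prod>i\<in>S. x i ^ \<beta> i)"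
          using insert.hyps(2) by (intro prod.cong) auto
        then show "c \<beta> * (\<Prod>i\<in>S. x i ^ \<beta> i) * t ^ \<beta> j = c \<beta> * (\<Prod>i\<in>insert j S. (x(j := t)) i ^ \<beta> i)"
          using insert.hyps by simp
      qed simp
      finally show ?thesis using insert.prems(3)[of "x(j := t)"] by simp
    qed
    then have "\<forall>n\<le>N. d n = 0" by (simp flip: polyfun_eq_0)
    then show ?thesis using N[OF insert.prems(4)] by (simp add: d_def m_def)
  qed note sum0 = this
  \<comment> \<open>Within a slice the exponent of \<open>j\<close> is constant, so resetting it to
    0 is injective and restores the support condition for \<open>S\<close>.\<close>
  let ?r = "\<lambda>\<beta>::'i\<Rightarrow>nat. \<beta>(j := 0)"
  have inj: "inj_on ?r (A' m)"
  proof (rule inj_onI)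
    fix \<beta> \<gamma> assume *: "\<beta> \<in> A' m" "\<gamma> \<in> A' m" "?r \<beta> = ?r \<gamma>"
    have "(?r \<delta>)(j := m) = \<delta>" if "\<delta> \<in> A' m" for \<delta> using that by (auto simp: A'_def)
    from this[OF *(1)] this[OF *(2)] *(3) show "\<beta> = \<gamma>" by metis
  qed
  have "(\<lambda>\<beta>. c (\<beta>(j := m))) (?r \<alpha>) = 0"
  proof (rule insert.IH[of "?r ` A' m" "\<lambda>\<beta>. c (\<beta>(j := m))" "?r \<alpha>"])
    show "finite (?r ` A' m)" using insert.prems(1) by (simp add: A'_def)
    show "\<beta> i = 0" if "\<beta> \<in> ?r ` A' m" "i \<notin> S" for \<beta> i
      using that insert.prems(2)[of _ i] by (auto simp: A'_def)
    show "?r \<alpha> \<in> ?r ` A' m" using insert.prems(4) by (auto simp: A'_def m_def)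
    fix x :: "'i \<Rightarrow> real"
    have "(\<Sum>\<beta>\<in>?r ` A' m. c (\<beta>(j := m)) * (\<Prod>i\<in>S. x i ^ \<beta> i)) = (\<Sum>\<beta>\<in>A' m. c \<beta> * (\<Prod>i\<in>S. x i ^ \<beta> i))"
    proof (subst sum.reindex[OF inj], rule sum.cong)
      fix \<beta> assume "\<beta> \<in> A' m"
      then have "\<beta>(j := m) = \<beta>" by (auto simp: A'_def)
      moreover have "(\<Prod>i\<in>S. x i ^ (?r \<beta>) i) = (\<Prod>i\<in>S. x i ^ \<beta> i)"
        using insert.hyps(2) by (intro prod.cong) auto
      ultimately show "((\<lambda>\<beta>. c (\<beta>(j := m)) * (\<Prod>i\<in>S. x i ^ \<beta> i)) \<circ> ?r) \<beta> = c \<beta> * (\<Prod>i\<in>S. x i ^ \<beta> i)"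
        by simp
    qed simp
    then show "(\<Sum>\<beta>\<in>?r ` A' m. c (\<beta>(j := m)) * (\<Prod>i\<in>S. x i ^ \<beta> i)) = 0" using sum0 by simp
  qed
  then show ?case by (simp add: m_def)
qed

lemma monomials_independent:
  assumes "\<And>x. (\<Sum>\<alpha>\<in>expo k. xmonom \<alpha> x * c \<alpha>) = 0" "\<alpha> \<in> expo k"
  shows "c \<alpha> = 0"
proof (rule monomials_independent_aux[of UNIV "expo k"])
  fix x :: "3 \<Rightarrow> real"
  show "(\<Sum>\<alpha>\<in>expo k. c \<alpha> * (\<Prod>i\<in>UNIV. x i ^ \<alpha> i)) = 0"
    using assms(1)[of "\<chi> i. x i"] by (simp add: xmonom_def mult.commute)
qed (use assms(2) in auto)

section \<open>Coefficients as linear functionals\<close>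

text \<open>Demanding zeros outside \<open>expo k\<close> makes the coefficient function independent
  of the degree bound, and \<open>mcoef\<close> relies on this.\<close>

definition represents :: "nat \<Rightarrow> ((3 \<Rightarrow> nat) \<Rightarrow> real) \<Rightarrow> (real^3 \<Rightarrow> real) \<Rightarrow> bool" where
  "represents k c f \<longleftrightarrow> (\<forall>x. f x = (\<Sum>\<alpha>\<in>expo k. xmonom \<alpha> x * c \<alpha>)) \<and> (\<forall>\<alpha>. \<alpha> \<notin> expo k \<longrightarrow> c \<alpha> = 0)"

definition mcoef :: "(real^3 \<Rightarrow> real) \<Rightarrow> (3 \<Rightarrow> nat) \<Rightarrow> real" where
  "mcoef f = (SOME c. \<exists>k. represents k c f)"

lemma represents_mono:
  assumes "represents j c f" "j \<le> k" shows "represents k c f"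
  using assms expo_mono[OF assms(2)] unfolding represents_def
  by (auto intro!: sum.mono_neutral_left)

lemma represents_unique:
  assumes "represents j c f" "represents k d f" shows "c = d"
proof
  fix \<alpha>
  define m where "m = max j k"
  have *: "represents m c f" "represents m d f" using assms by (auto simp: m_def intro: represents_mono)
  show "c \<alpha> = d \<alpha>"
  proof (cases "\<alpha> \<in> expo m")
    case True
    have "(\<Sum>\<alpha>\<in>expo m. xmonom \<alpha> x * (c \<alpha> - d \<alpha>)) = 0" for x
      using * by (simp add: represents_def right_diff_distrib sum_subtractf)
    from monomials_independent[OF this True] show ?thesis by simp
  next
    case False
    then show ?thesis using * by (simp add: represents_def)
  qed
qed

lemma mcoef_eq: "represents k c f \<Longrightarrow> mcoef f = c"
  unfolding mcoef_def by (rule some_equality) (auto intro: represents_unique)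

lemma represents_mcoef:
  assumes "polf k f" shows "represents k (mcoef f) f"
proof -
  obtain c where "\<forall>x. f x = (\<Sum>\<alpha>\<in>expo k. xmonom \<alpha> x * c \<alpha>)" using polf_imp_xmonom_sum[OF assms] by blast
  then have "represents k (\<lambda>\<alpha>. if \<alpha> \<in> expo k then c \<alpha> else 0) f" (is "represents k ?c f")
    by (simp add: represents_def)
  moreover from this have "mcoef f = ?c" by (rule mcoef_eq)
  ultimately show ?thesis by simp
qed

lemma polf_mcoef: "polf k f \<Longrightarrow> f x = (\<Sum>\<alpha>\<in>expo k. xmonom \<alpha> x * mcoef f \<alpha>)"
  using represents_mcoef by (simp add: represents_def)

lemma mcoef_add:
  assumes "polf k f" "polf k g" shows "mcoef (\<lambda>x. f x + g x) \<alpha> = mcoef f \<alpha> + mcoef g \<alpha>"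
proof -
  have "represents k (\<lambda>\<alpha>. mcoef f \<alpha> + mcoef g \<alpha>) (\<lambda>x. f x + g x)"
    using represents_mcoef[OF assms(1)] represents_mcoef[OF assms(2)]
    by (simp add: represents_def distrib_left sum.distrib)
  from mcoef_eq[OF this] show ?thesis by simp
qed

lemma mcoef_cmult:
  assumes "polf k f" shows "mcoef (\<lambda>x. r * f x) \<alpha> = r * mcoef f \<alpha>"
proof -
  have "represents k (\<lambda>\<alpha>. r * mcoef f \<alpha>) (\<lambda>x. r * f x)"
    using represents_mcoef[OF assms(1)]
    by (simp add: represents_def sum_distrib_left mult.left_commute)
  from mcoef_eq[OF this] show ?thesis by simp
qed

text \<open>This turns the requirement that a cubic polynomial, such as a component of
  \<open>div T\<close>, be affine into finitely many linear equations.\<close>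

lemma polf_lower_degree:
  assumes "polf k f" "\<And>\<alpha>. \<alpha> \<in> expo k - expo j \<Longrightarrow> mcoef f \<alpha> = 0"
  shows "polf j f"
proof -
  have "f x = (\<Sum>\<alpha>\<in>expo j. xmonom \<alpha> x * mcoef f \<alpha>)" for x
  proof -
    have "f x = (\<Sum>\<alpha>\<in>expo k. xmonom \<alpha> x * mcoef f \<alpha>)"
      by (rule polf_mcoef[OF assms(1)])
    also have "\<dots> = (\<Sum>\<alpha>\<in>expo k \<inter> expo j. xmonom \<alpha> x * mcoef f \<alpha>)"
      by (rule sum.mono_neutral_right) (auto simp: assms(2))
    also have "\<dots> = (\<Sum>\<alpha>\<in>expo j. xmonom \<alpha> x * mcoef f \<alpha>)"
      using represents_mcoef[OF assms(1)] by (intro sum.mono_neutral_left) (auto simp: represents_def)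
    finally show ?thesis .
  qed
  then have "f = (\<lambda>x. \<Sum>\<alpha>\<in>expo j. xmonom \<alpha> x * mcoef f \<alpha>)" by auto
  then show ?thesis using polf_xmonom_sum[of j "mcoef f"] by simp
qed

section \<open>Vector- and matrix-valued polynomials by components\<close>

lemma polys_iff_polf:
  fixes f :: "real^3 \<Rightarrow> 'b::euclidean_space"
  shows "f \<in> polys k X \<longleftrightarrow> (\<forall>b\<in>Basis. polf k (\<lambda>x. f x \<bullet> b)) \<and> (\<forall>x. f x \<in> X)"
proof -
  have "(\<exists>c. \<forall>x. f x = (\<Sum>\<alpha>\<in>expo k. xmonom \<alpha> x *\<^sub>R c \<alpha>)) \<longleftrightarrow> (\<forall>b\<in>Basis. polf k (\<lambda>x. f x \<bullet> b))"
  proof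
    assume "\<exists>c. \<forall>x. f x = (\<Sum>\<alpha>\<in>expo k. xmonom \<alpha> x *\<^sub>R c \<alpha>)"
    then obtain c where "\<And>x. f x = (\<Sum>\<alpha>\<in>expo k. xmonom \<alpha> x *\<^sub>R c \<alpha>)" by blast
    then show "\<forall>b\<in>Basis. polf k (\<lambda>x. f x \<bullet> b)"
      using polf_xmonom_sum by (simp add: inner_sum_left)
  next
    assume p: "\<forall>b\<in>Basis. polf k (\<lambda>x. f x \<bullet> b)"
    have "f x = (\<Sum>\<alpha>\<in>expo k. xmonom \<alpha> x *\<^sub>R (\<Sum>b\<in>Basis. mcoef (\<lambda>x. f x \<bullet> b) \<alpha> *\<^sub>R b))" for x
    proof -
      have "f x = (\<Sum>b\<in>Basis. (\<Sum>\<alpha>\<in>expo k. xmonom \<alpha> x * mcoef (\<lambda>x. f x \<bullet> b) \<alpha>) *\<^sub>R b)"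
        by (subst euclidean_representation[symmetric]) (use p polf_mcoef in \<open>auto intro!: sum.cong\<close>)
      then show ?thesis
        unfolding scaleR_sum_left scaleR_sum_right by (subst (asm) sum.swap) simp
    qed
    then show "\<exists>c. \<forall>x. f x = (\<Sum>\<alpha>\<in>expo k. xmonom \<alpha> x *\<^sub>R c \<alpha>)"
      by (intro exI[of _ "\<lambda>\<alpha>. \<Sum>b\<in>Basis. mcoef (\<lambda>x. f x \<bullet> b) \<alpha> *\<^sub>R b"] allI)
  qed
  then show ?thesis by (simp add: polys_def xmonom_def expo_def)
qed

lemma polys_vec_iff:
  fixes f :: "real^3 \<Rightarrow> real^'n"
  shows "f \<in> polys k X \<longleftrightarrow> (\<forall>i. polf k (\<lambda>x. f x $ i)) \<and> (\<forall>x. f x \<in> X)"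
  unfolding polys_iff_polf by (auto simp: Basis_vec_def inner_axis)

lemma polys_mat_iff:
  fixes f :: "real^3 \<Rightarrow> real^'m^'n"
  shows "f \<in> polys k X \<longleftrightarrow> (\<forall>i j. polf k (\<lambda>x. f x $ i $ j)) \<and> (\<forall>x. f x \<in> X)"
  unfolding polys_iff_polf by (auto simp: Basis_vec_def inner_axis)

section \<open>Fields with vanishing normal components\<close>

definition outer :: "real^3 \<Rightarrow> real^3^3" where "outer t = (\<chi> a b. t $ a * t $ b)"

lemma outer_mult_vec: "outer t *v w = (t \<bullet> w) *\<^sub>R t"
  by (simp add: outer_def vec_eq_iff matrix_vector_mult_def inner_vec_def sum_distrib_left mult_ac)

lemma outer_inner: "outer t \<bullet> A = t \<bullet> (A *v t)"
  by (simp add: outer_def inner_vec_def matrix_vector_mult_def sum_distrib_left mult_ac)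

lemma sym_matrices_inner: "S \<in> sym_matrices \<Longrightarrow> x \<bullet> (S *v y) = (S *v x) \<bullet> y"
  by (metis (mono_tags, lifting) sym_matrices_def mem_Collect_eq dot_lmul_matrix transpose_matrix_vector)

lemma sym_matrices_nth: "S \<in> sym_matrices \<Longrightarrow> S $ a $ b = S $ b $ a"
proof -
  assume "S \<in> sym_matrices"
  then have "S $ a $ b = transpose S $ a $ b" by (simp add: sym_matrices_def)
  then show ?thesis by (simp add: transpose_def)
qed

lemma sym_matricesI: "(\<And>a b. S $ a $ b = S $ b $ a) \<Longrightarrow> S \<in> sym_matrices"
  by (simp add: sym_matrices_def transpose_def vec_eq_iff)

definition pairs :: "(4 \<times> 4) set" where "pairs = {(i, j). i < j}"

lemma sum_over_pairs:
  fixes F :: "4 \<Rightarrow> 4 \<Rightarrow> real"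
  assumes "\<And>i j. F i j = F j i" "\<And>i. F i i = 0"
  shows "(\<Sum>i\<in>UNIV. \<Sum>j\<in>UNIV. F i j) = 2 * (\<Sum>(i, j)\<in>pairs. F i j)"
proof -
  have un: "(UNIV :: (4 \<times> 4) set) = pairs \<union> (prod.swap ` pairs \<union> range (\<lambda>i. (i, i)))"
    by (force simp: pairs_def image_def)
  have d: "pairs \<inter> (prod.swap ` pairs \<union> range (\<lambda>i. (i, i))) = {}" "prod.swap ` pairs \<inter> range (\<lambda>i. (i, i)) = {}"
    by (auto simp: pairs_def)
  have "(\<Sum>i\<in>UNIV. \<Sum>j\<in>UNIV. F i j) = (\<Sum>(i, j)\<in>UNIV. F i j)"
    by (simp add: sum.cartesian_product)
  also have "\<dots> = (\<Sum>(i, j)\<in>pairs. F i j) + ((\<Sum>(i, j)\<in>prod.swap ` pairs. F i j) + (\<Sum>(i, j)\<in>range (\<lambda>i. (i, i)). F i j))"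
    unfolding un by (subst sum.union_disjoint[OF _ _ d(1)], simp, simp, subst sum.union_disjoint[OF _ _ d(2)]) simp_all
  also have "(\<Sum>(i, j)\<in>prod.swap ` pairs. F i j) = (\<Sum>(i, j)\<in>pairs. F i j)"
    by (subst sum.reindex) (auto simp: assms(1) intro!: sum.cong)
  also have "(\<Sum>(i, j)\<in>range (\<lambda>i. (i, i)). F i j) = 0"
    by (rule sum.neutral) (auto simp: assms(2))
  finally show ?thesis by simp
qed

lemma polf_inner_vec:
  assumes "\<And>i. polf k (\<lambda>x. w x $ i)"
  shows "polf k (\<lambda>x. t \<bullet> (w x :: real^3))"
  unfolding inner_vec_def by (auto intro!: polf_sum polf_cmult assms)

lemma polf_mat_vec:
  assumes "\<And>i j. polf k (\<lambda>x. T x $ i $ j)"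
  shows "polf k (\<lambda>x. (T x *v (u :: real^3) :: real^3) $ i)"
  unfolding matrix_vector_mult_def by (auto intro!: polf_sum polf_mult_const assms)

context tetrahedron
begin

text \<open>Writing the identity as the sum of the \<open>v i (g i)'\<close> on both sides of
  \<open>S\<close> gives \<open>S\<close> as the sum of \<open>P i j\<close> times
  \<open>v i (v j)'\<close>. The gradients add up to zero, hence so do the rows and columns of
  \<open>P\<close>, and polarization replaces \<open>v i (v j)'\<close> by \<open>- 1/2\<close>
  times \<open>outer (tv i j)\<close>. Each unordered pair occurs twice.\<close>

lemma sym_matrix_decomposition:
  assumes "S \<in> sym_matrices"
  shows "S = (\<Sum>(i, j)\<in>pairs. (- (g i \<bullet> (S *v g j))) *\<^sub>R outer (tv i j))"
proof -
  define P where "P i j = g i \<bullet> (S *v g j)" for i j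
  have Psym: "P i j = P j i" for i j
    using sym_matrices_inner[OF assms] by (simp add: P_def inner_commute)
  have lin: "linear ((*v) S)" by simp
  have P0: "(\<Sum>i\<in>UNIV. P i j) = 0" for j
    by (simp add: P_def sum_g flip: inner_sum_left)
  have P0': "(\<Sum>j\<in>UNIV. P i j) = 0" for i
    using P0[of i] by (simp add: Psym)
  have "S $ a $ b = (\<Sum>(i, j)\<in>pairs. (- P i j) * (tv i j $ a * tv i j $ b))" for a b
  proof -
    have ax: "(\<Sum>i\<in>UNIV. (v i $ a) *\<^sub>R g i) = axis a 1" for a
      using sum_v_g[of "axis a 1"] by (simp add: inner_axis)
    have "S $ a $ b = axis a 1 \<bullet> (S *v axis b 1)"
      by (simp add: inner_axis' matrix_vector_mult_basis column_def)
    also have "\<dots> = (\<Sum>i\<in>UNIV. \<Sum>j\<in>UNIV. v i $ a * v j $ b * P i j)"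
      by (simp add: linear_sum[OF lin] linear_scale[OF lin] inner_sum_left inner_sum_right P_def mult.assoc
        sum_distrib_left flip: ax) (subst sum.swap, simp add: mult_ac)
    finally have 1: "(\<Sum>i\<in>UNIV. \<Sum>j\<in>UNIV. v i $ a * v j $ b * P i j) = S $ a $ b" by simp
    have 2: "(\<Sum>i\<in>UNIV. \<Sum>j\<in>UNIV. v j $ a * v i $ b * P i j) = S $ a $ b"
      using 1 by (subst sum.swap) (simp add: Psym)
    have 3: "(\<Sum>i\<in>UNIV. \<Sum>j\<in>UNIV. v i $ a * v i $ b * P i j) = 0"
      by (simp add: P0' flip: sum_distrib_left)
    have 4: "(\<Sum>i\<in>UNIV. \<Sum>j\<in>UNIV. v j $ a * v j $ b * P i j) = 0"
      by (subst sum.swap) (simp add: P0 flip: sum_distrib_left)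
    have "(\<Sum>i\<in>UNIV. \<Sum>j\<in>UNIV. (- P i j) * (tv i j $ a * tv i j $ b)) = 2 * S $ a $ b"
    proof -
      have "(- P i j) * (tv i j $ a * tv i j $ b) = v i $ a * v j $ b * P i j + v j $ a * v i $ b * P i j
          - v i $ a * v i $ b * P i j - v j $ a * v j $ b * P i j" for i j
        by (simp add: tv_def algebra_simps)
      then show ?thesis by (simp only: sum.distrib sum_subtractf 1 2 3 4)
    qed
    moreover have "(\<Sum>i\<in>UNIV. \<Sum>j\<in>UNIV. (- P i j) * (tv i j $ a * tv i j $ b)) =
        2 * (\<Sum>(i, j)\<in>pairs. (- P i j) * (tv i j $ a * tv i j $ b))"
      by (rule sum_over_pairs) (simp_all add: Psym tv_def algebra_simps)
    ultimately show ?thesis by simp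
  qed
  then show ?thesis
    by (simp add: vec_eq_iff sum_component case_prod_unfold outer_def P_def)
qed

text \<open>The matrix \<open>outer x\<close> is a combination of the six
  \<open>outer (tv i j)\<close>, and pairing with \<open>A\<close> evaluates the quadratic form.
  This is the step from edge strains to the full symmetric gradient.\<close>

lemma tv_outer_eq_0:
  assumes "\<And>i j. i < j \<Longrightarrow> tv i j \<bullet> (A *v tv i j) = 0"
  shows "x \<bullet> (A *v x) = 0"
proof -
  have "outer x \<in> sym_matrices" by (rule sym_matricesI) (simp add: outer_def mult.commute)
  from arg_cong[OF sym_matrix_decomposition[OF this], of "\<lambda>S. S \<bullet> A"]
  show ?thesis
    using assms by (simp add: outer_inner inner_sum_left case_prod_unfold pairs_def)
qed

section \<open>Bubble fields and their divergence\<close>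

definition bubble :: "(4 \<times> 4 \<Rightarrow> real^3 \<Rightarrow> real) \<Rightarrow> real^3 \<Rightarrow> real^3^3" where
  "bubble q x = (\<Sum>(i, j)\<in>pairs. (lam i x * lam j x * q (i, j) x) *\<^sub>R outer (tv i j))"

lemma polf_bubble_coefficient: "polf k r \<Longrightarrow> polf (Suc (Suc k)) (\<lambda>x. lam i x * lam j x * r x)"
  using polf_mult[OF polf_mult[OF polf_lam polf_lam], of k r i j] by simp

lemma bubble_polys:
  assumes "\<And>e. polf 2 (q e)"
  shows "bubble q \<in> polys 4 sym_matrices"
  unfolding polys_mat_iff
proof (intro conjI allI)
  fix a b
  have "polf 4 (\<lambda>x. \<Sum>(i, j)\<in>pairs. (lam i x * lam j x * q (i, j) x) * (outer (tv i j) $ a $ b))"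
    using polf_bubble_coefficient[OF assms]
    by (auto intro!: polf_sum polf_mult_const simp: case_prod_unfold numeral_eq_Suc)
  then show "polf 4 (\<lambda>x. bubble q x $ a $ b)"
    by (simp add: bubble_def sum_component case_prod_unfold)
next
  fix x show "bubble q x \<in> sym_matrices"
    by (rule sym_matricesI) (simp add: bubble_def sum_component case_prod_unfold outer_def mult.commute)
qed

lemma bubble_mult_vec:
  "bubble q x *v u = (\<Sum>(i, j)\<in>pairs. (lam i x * lam j x * q (i, j) x * (tv i j \<bullet> u)) *\<^sub>R tv i j)"
proof -
  have lin: "linear (\<lambda>A::real^3^3. A *v u)"
    by (simp add: linear_iff matrix_vector_mult_add_rdistrib scaleR_matrix_vector_assoc)
  show ?thesis
    by (simp add: bubble_def case_prod_unfold outer_mult_vec linear_sum[OF lin] linear_scale[OF lin])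
qed

text \<open>On the plane \<open>lam l = 0\<close> a term survives only if its edge avoids
  \<open>v l\<close>, and then the edge is orthogonal to \<open>g l\<close>.\<close>

lemma bubble_normal_eq_0: "lam l x = 0 \<Longrightarrow> bubble q x *v g l = 0"
  unfolding bubble_mult_vec
  by (rule sum.neutral) (auto simp: inner_commute[of _ "g l"] g_tv pairs_def)

lemma bubble_inner:
  "bubble q x \<bullet> A = (\<Sum>(i, j)\<in>pairs. lam i x * lam j x * q (i, j) x * (tv i j \<bullet> (A *v tv i j)))"
  by (simp add: bubble_def inner_sum_left case_prod_unfold outer_inner)

text \<open>Each summand is a scalar times a constant \<open>t t'\<close>, and the divergence of
  such a field is the derivative of the scalar along \<open>t\<close>, times
  \<open>t\<close>.\<close>

lemma row_div_bubble:
  assumes "\<And>e. polf k (q e)"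
  shows "row_div (bubble q) x = (\<Sum>(i, j)\<in>pairs.
    frechet_derivative (\<lambda>x. lam i x * lam j x * q (i, j) x) (at x) (tv i j) *\<^sub>R tv i j)"
proof -
  define p where "p e = (\<lambda>x. lam (fst e) x * lam (snd e) x * q e x)" for e
  define D where "D e = frechet_derivative (p e) (at x)" for e
  have D: "(p e has_derivative D e) (at x)" for e
    unfolding D_def p_def by (rule polf_has_derivative[OF polf_bubble_coefficient[OF assms]])
  let ?t = "\<lambda>e. tv (fst e) (snd e)"
  have De: "(\<Sum>b\<in>UNIV. ?t e $ b * D e (axis b 1)) = D e (?t e)" for e
  proof -
    have l: "linear (D e)" using D has_derivative_linear by blast
    have "D e (?t e) = D e (\<Sum>b\<in>UNIV. ?t e $ b *\<^sub>R axis b 1)"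
      by (simp add: basis_expansion scalar_mult_eq_scaleR[symmetric])
    then show ?thesis by (simp add: linear_sum[OF l] linear_scale[OF l])
  qed
  have "row_div (bubble q) x $ a = (\<Sum>e\<in>pairs. D e (?t e) * ?t e $ a)" for a
  proof -
    have "frechet_derivative (\<lambda>y. bubble q y $ a $ b) (at x) (axis b 1) =
        (\<Sum>e\<in>pairs. D e (axis b 1) * (?t e $ a * ?t e $ b))" for b
    proof -
      have "((\<lambda>y. \<Sum>e\<in>pairs. p e y * (?t e $ a * ?t e $ b)) has_derivative
          (\<lambda>h. \<Sum>e\<in>pairs. D e h * (?t e $ a * ?t e $ b))) (at x)"
        by (intro has_derivative_sum has_derivative_mult_left D)
      then have "((\<lambda>y. bubble q y $ a $ b) has_derivative
          (\<lambda>h. \<Sum>e\<in>pairs. D e h * (?t e $ a * ?t e $ b))) (at x)"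
        by (simp add: bubble_def sum_component case_prod_unfold outer_def p_def)
      from frechet_derivative_at[OF this, symmetric] show ?thesis by simp
    qed
    then have "row_div (bubble q) x $ a = (\<Sum>b\<in>UNIV. \<Sum>e\<in>pairs. D e (axis b 1) * (?t e $ a * ?t e $ b))"
      by (simp add: row_div_def)
    also have "\<dots> = (\<Sum>e\<in>pairs. (\<Sum>b\<in>UNIV. ?t e $ b * D e (axis b 1)) * ?t e $ a)"
      by (subst sum.swap) (simp add: sum_distrib_right sum_distrib_left mult_ac)
    also have "\<dots> = (\<Sum>e\<in>pairs. D e (?t e) * ?t e $ a)"
      by (simp only: De)
    finally show ?thesis .
  qed
  then show ?thesis
    by (simp add: vec_eq_iff sum_component case_prod_unfold D_def p_def)
qed

text \<open>The value at an edge \<open>t\<close> is \<open>t' (grad w) t\<close>, the symmetric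
  gradient tested with that edge; the six values determine it.\<close>

definition strain :: "(real^3 \<Rightarrow> real^3) \<Rightarrow> 4 \<times> 4 \<Rightarrow> real^3 \<Rightarrow> real" where
  "strain w = (\<lambda>(i, j) x. frechet_derivative (\<lambda>x. tv i j \<bullet> w x) (at x) (tv i j))"

text \<open>The product rule is applied edge by edge, \<open>u i j\<close> being the component of
  \<open>w\<close> along the edge. The total derivative has the form treated by
  \<open>integral_edge_derivative\<close> with \<open>r = q * u\<close>, so no boundary terms
  appear.\<close>

lemma integral_row_div_bubble:
  assumes q: "\<And>e. polf k (q e)" and w: "\<And>i. polf m (\<lambda>x. w x $ i)"
  shows "integral K (\<lambda>x. row_div (bubble q) x \<bullet> w x) =
    - integral K (\<lambda>x. \<Sum>(i, j)\<in>pairs. lam i x * lam j x * q (i, j) x * strain w (i, j) x)"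
proof -
  define p where "p i j = (\<lambda>x. lam i x * lam j x * q (i, j) x)" for i j
  define u where "u i j = (\<lambda>x. tv i j \<bullet> w x)" for i j
  have p: "polf (Suc (Suc k)) (p i j)" for i j
    unfolding p_def by (rule polf_bubble_coefficient[OF q])
  have u: "polf m (u i j)" for i j unfolding u_def by (rule polf_inner_vec[OF w])
  let ?A = "\<lambda>i j x. frechet_derivative (p i j) (at x) (tv i j) * u i j x"
  let ?B = "\<lambda>i j x. p i j x * frechet_derivative (u i j) (at x) (tv i j)"
  have int: "?A i j integrable_on K" "?B i j integrable_on K" for i j
    by (rule polf_integrable_on[OF _ compact_K], (rule polf_mult polf_frechet_derivative p u)+)+
  have zero: "integral K (?A i j) + integral K (?B i j) = 0" if "(i, j) \<in> pairs" for i j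
  proof -
    have "frechet_derivative (\<lambda>x. lam i x * lam j x * (q (i, j) x * u i j x)) (at x) (tv i j) = ?A i j x + ?B i j x" for x
    proof -
      have "((\<lambda>x. p i j x * u i j x) has_derivative
          (\<lambda>h. p i j x * frechet_derivative (u i j) (at x) h + frechet_derivative (p i j) (at x) h * u i j x)) (at x)"
        by (rule has_derivative_mult[OF polf_has_derivative[OF p] polf_has_derivative[OF u]])
      from frechet_derivative_at[OF this, symmetric] show ?thesis
        by (simp add: p_def mult.assoc add.commute)
    qed
    then have "integral K (\<lambda>x. ?A i j x + ?B i j x) = 0"
      using integral_edge_derivative[OF polf_mult[OF q u], of i j "(i, j)" i j] that by (auto simp: pairs_def)
    then show ?thesis by (simp add: integral_add int)
  qed
  have "integral K (\<lambda>x. row_div (bubble q) x \<bullet> w x) = integral K (\<lambda>x. \<Sum>(i, j)\<in>pairs. ?A i j x)"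
    by (simp add: row_div_bubble[OF q] p_def u_def inner_sum_left case_prod_unfold)
  also have "\<dots> = (\<Sum>(i, j)\<in>pairs. integral K (?A i j))"
    by (simp add: integral_sum case_prod_unfold int)
  also have "\<dots> = (\<Sum>(i, j)\<in>pairs. - integral K (?B i j))"
    using zero by (intro sum.cong) (auto simp: eq_neg_iff_add_eq_0)
  also have "\<dots> = - integral K (\<lambda>x. \<Sum>(i, j)\<in>pairs. ?B i j x)"
    by (simp add: integral_sum case_prod_unfold int sum_negf)
  finally show ?thesis by (simp add: p_def u_def strain_def case_prod_unfold)
qed

section \<open>Divisibility by barycentric coordinates\<close>

text \<open>A line in the plane through the barycentre \<open>b\<close> of the face runs inside the
  open face near \<open>b\<close>, so it carries infinitely many zeros of \<open>f\<close>.\<close>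

lemma polf_eq_0_on_plane:
  assumes f: "polf k f" and z: "\<And>x. lam l x = 0 \<Longrightarrow> (\<And>i. i \<noteq> l \<Longrightarrow> 0 < lam i x) \<Longrightarrow> f x = 0"
    and x: "lam l x = 0"
  shows "f x = 0"
proof -
  define b where "b = (\<Sum>i\<in>UNIV - {l}. (1/3::real) *\<^sub>R v i)"
  have lamb: "lam i b = (if i = l then 0 else 1/3)" for i
  proof -
    have card: "card (UNIV - {l}) = 3" by simp
    have "lam i b = c i + (\<Sum>j\<in>UNIV - {l}. (g i \<bullet> v j) / 3)"
      by (simp add: lam_def b_def inner_sum_right)
    also have "\<dots> = (\<Sum>j\<in>UNIV - {l}. c i / 3) + (\<Sum>j\<in>UNIV - {l}. (g i \<bullet> v j) / 3)"
      using card by simp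
    also have "\<dots> = (\<Sum>j\<in>UNIV - {l}. lam i (v j) / 3)"
      by (simp add: lam_def add_divide_distrib sum.distrib)
    also have "\<dots> = (\<Sum>j\<in>UNIV - {l}. (if i = j then 1 else 0) / 3)" by (simp add: lam_v)
    also have "\<dots> = (if i = l then 0 else 1/3)"
      by (simp flip: sum_divide_distrib) 
    finally show ?thesis .
  qed
  have lam_line: "lam i (b + s *\<^sub>R (x - b)) = (1 - s) * lam i b + s * lam i x" for i s
    by (simp add: lam_def inner_add_right inner_diff_right algebra_simps)
  \<comment> \<open>\<open>M - 1\<close> bounds every \<open>lam i x\<close> in absolute value; for
    \<open>s * M < 1/6\<close> the number \<open>(1 - s) / 3 + s * lam i x\<close> stays
    positive.\<close>
  define M where "M = 1 + (\<Sum>i\<in>UNIV. \<bar>lam i x\<bar>)"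
  have M: "\<bar>lam i x\<bar> \<le> M - 1" for i
    unfolding M_def using member_le_sum[of i UNIV "\<lambda>i. \<bar>lam i x\<bar>"] by simp
  have M1: "1 \<le> M" using M[of l] by simp
  have "{0<..<1 / (6 * M)} \<subseteq> {s. f (b + s *\<^sub>R (x - b)) = 0}"
  proof
    fix s assume s: "s \<in> {0<..<1 / (6 * M)}"
    then have sM: "s * M < 1 / 6" using M1 by (auto simp: field_simps)
    have "0 < lam i (b + s *\<^sub>R (x - b))" if "i \<noteq> l" for i
    proof -
      have "s * \<bar>lam i x\<bar> \<le> s * (M - 1)" using s M[of i] by (intro mult_left_mono) auto
      moreover have "- (s * lam i x) \<le> s * \<bar>lam i x\<bar>"
        using s mult_left_mono[of "- lam i x" "\<bar>lam i x\<bar>" s] by auto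
      ultimately have "- (s * lam i x) \<le> s * M - s" by (simp add: right_diff_distrib)
      moreover have "(1 - s) * lam i b = 1 / 3 - s / 3" "0 < s" using that s by (simp_all add: lamb)
      ultimately have "0 < (1 - s) * lam i b + s * lam i x" using sM by linarith
      then show ?thesis by (simp only: lam_line)
    qed
    moreover have "lam l (b + s *\<^sub>R (x - b)) = 0" using x by (simp add: lam_line lamb)
    ultimately show "s \<in> {s. f (b + s *\<^sub>R (x - b)) = 0}" using z by blast
  qed
  moreover have "infinite {0<..<1 / (6 * M)}" using M1 by (intro infinite_Ioo) simp
  ultimately have "infinite {s. f (b + s *\<^sub>R (x - b)) = 0}" using infinite_super by blast
  from polf_line_infinite_zeros[OF f this, of 1] show ?thesis by simp
qed

text \<open>Zeros are asked for on the open face only, so that the division can be repeated: after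
  dividing by one \<open>lam i\<close>, the quotient is known to vanish just where
  \<open>lam i\<close> is nonzero and can be cancelled.\<close>

lemma polf_divide_lam:
  assumes "polf (Suc k) f" "\<And>x. lam l x = 0 \<Longrightarrow> (\<And>i. i \<noteq> l \<Longrightarrow> 0 < lam i x) \<Longrightarrow> f x = 0"
  shows "\<exists>h. polf k h \<and> (\<forall>x. f x = lam l x * h x)"
proof -
  obtain d where d: "g l \<bullet> d = 1"
  proof -
    obtain k where "k \<noteq> l" using card_UNIV_unit by (metis (full_types) zero_neq_one)
    then show ?thesis using g_tv[of l k l] that by simp
  qed
  show ?thesis
    unfolding lam_def
  proof (rule polf_divide_affine[where m = "(\<bullet>) (g l)" and d = d, OF assms(1)])
    show "g l \<bullet> d = 1" by (rule d)
    show "linear ((\<bullet>) (g l))" by (simp add: linear_iff inner_add_right)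
    fix x assume "c l + g l \<bullet> x = 0"
    then show "f x = 0" using polf_eq_0_on_plane[OF assms] by (simp add: lam_def)
  qed
qed

text \<open>
  Each coefficient of \<open>T\<close> in the basis \<open>tv i j (tv i j)'\<close> of symmetric matrices is
  \<open>- g i' T g j\<close>, which vanishes on the two faces with normals \<open>g i\<close> and \<open>g j\<close>.
\<close>
lemma bubble_representation:
  assumes T: "T \<in> polys 4 sym_matrices" and z: "\<And>l x. x \<in> K \<Longrightarrow> lam l x = 0 \<Longrightarrow> T x *v g l = 0"
  shows "\<exists>q. (\<forall>e. polf 2 (q e)) \<and> T = bubble q"
proof -
  have sym: "T x \<in> sym_matrices" and comp: "polf 4 (\<lambda>x. T x $ i $ j)" for x i j
    using T by (auto simp: polys_mat_iff)
  have "\<exists>h. polf 2 h \<and> (fst e \<noteq> snd e \<longrightarrow> (\<forall>x. - (g (fst e) \<bullet> (T x *v g (snd e))) = lam (fst e) x * lam (snd e) x * h x))" for e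
  proof (cases "fst e = snd e")
    case True
    then show ?thesis by (intro exI[of _ "\<lambda>_. 0"]) (simp add: polf.const)
  next
    case False
    define p where "p x = - (g (fst e) \<bullet> (T x *v g (snd e)))" for x
    have inK: "x \<in> K" if "lam l x = 0" "\<And>i. i \<noteq> l \<Longrightarrow> 0 < lam i x" for l x
      using that by (auto simp: K_eq) (metis less_eq_real_def)
    have "polf (Suc 3) p"
      unfolding p_def by (intro polf_minus polf_inner_vec polf_mat_vec) (use comp in simp)
    then obtain h1 where h1: "polf 3 h1" "\<And>x. p x = lam (fst e) x * h1 x"
    proof -
      \<comment> \<open>Symmetry moves \<open>T x\<close> to the other gradient, the normal of the
        face in question.\<close>
      have "p x = 0" if "lam (fst e) x = 0" "\<And>i. i \<noteq> fst e \<Longrightarrow> 0 < lam i x" for x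
        using z[OF inK[OF that] that(1)] by (simp add: p_def sym_matrices_inner[OF sym])
      then show ?thesis using polf_divide_lam[OF \<open>polf (Suc 3) p\<close>, of "fst e"] that by blast
    qed
    obtain h2 where h2: "polf 2 h2" "\<And>x. h1 x = lam (snd e) x * h2 x"
    proof -
      have "h1 x = 0" if l: "lam (snd e) x = 0" "\<And>i. i \<noteq> snd e \<Longrightarrow> 0 < lam i x" for x
      proof -
        have "p x = 0" using z[OF inK[OF l] l(1)] by (simp add: p_def)
        then show ?thesis using h1(2)[of x] l(2)[OF False] by simp
      qed
      moreover have "polf (Suc 2) h1" using h1(1) by (simp add: eval_nat_numeral)
      ultimately show ?thesis using polf_divide_lam[of 2 h1 "snd e"] that by blast
    qed
    show ?thesis using h1 h2 by (intro exI[of _ h2]) (simp add: p_def)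
  qed
  then obtain q where q: "\<And>e. polf 2 (q e)"
    "\<And>e x. fst e \<noteq> snd e \<Longrightarrow> - (g (fst e) \<bullet> (T x *v g (snd e))) = lam (fst e) x * lam (snd e) x * q e x"
    by metis
  have "T x = bubble q x" for x
    by (subst sym_matrix_decomposition[OF sym])
      (auto simp: bubble_def pairs_def intro!: sum.cong simp flip: q(2)[of "(_, _)", simplified])
  then show ?thesis using q(1) by blast
qed

end

section \<open>Unisolvence\<close>

text \<open>A nonnegative continuous function with zero integral vanishes on a box inside
  \<open>S\<close>, and a polynomial that vanishes on a box is zero.\<close>

lemma polf_integral_eq_0:
  assumes f: "polf k f" and S: "compact S" "interior S \<noteq> {}" and nonneg: "\<And>x. x \<in> S \<Longrightarrow> 0 \<le> f x"
    and int: "integral S f = 0"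
  shows "f x = 0"
proof -
  obtain z where "z \<in> interior S" using S(2) by blast
  then obtain a b where ab: "z \<in> box a b" "cbox a b \<subseteq> interior S"
    using open_contains_cbox[OF open_interior] by metis
  then have sub: "cbox a b \<subseteq> S" using interior_subset by blast
  have "integral (cbox a b) f \<le> integral S f"
    using sub nonneg by (intro integral_subset_le polf_integrable_on[OF f] S(1) compact_cbox) auto
  moreover have "0 \<le> integral (cbox a b) f"
    using sub nonneg by (intro integral_nonneg polf_integrable_on[OF f] compact_cbox) auto
  ultimately have "integral (cbox a b) f = 0" using int by simp
  then have "\<forall>x\<in>cbox a b. f x = 0"
    using integral_cbox_eq_0_iff[OF polf_continuous_on[OF f], of a b] ab sub nonneg by auto
  moreover have "interior (cbox a b) \<noteq> {}" using ab(1) by (auto simp: interior_cbox)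
  ultimately show ?thesis using polf_eq_0_if_interior[OF f, of "cbox a b"] by blast
qed

lemma polf_row_div:
  assumes "T \<in> polys (Suc k) X" shows "polf k (\<lambda>x. row_div T x $ i)"
  unfolding row_div_def
  using assms polf_frechet_derivative[of "Suc k"] by (auto simp: polys_mat_iff intro!: polf_sum)

lemma polys_continuous_on: "T \<in> polys k X \<Longrightarrow> continuous_on S (T :: real^3 \<Rightarrow> real^3^3)"
  by (subst continuous_on_componentwise) (auto simp: polys_iff_polf intro: polf_continuous_on)

lemma polf_field_inner:
  assumes "T \<in> polys j X" "U \<in> polys k Y"
  shows "polf (j + k) (\<lambda>x. T x \<bullet> (U x :: real^3^3))"
  using assms unfolding polys_mat_iff by (auto simp: inner_vec_def intro!: polf_sum polf_mult)

lemma has_derivative_vec_polf: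
  fixes w :: "real^3 \<Rightarrow> real^3"
  assumes "\<And>i. polf k (\<lambda>x. w x $ i)"
  shows "\<exists>A. (w has_derivative (\<lambda>h. A *v h)) (at x)"
proof -
  let ?D = "\<lambda>h. \<Sum>i\<in>UNIV. frechet_derivative (\<lambda>x. w x $ i) (at x) h *\<^sub>R axis i (1::real)"
  have "((\<lambda>x. \<Sum>i\<in>UNIV. w x $ i *\<^sub>R axis i (1::real)) has_derivative ?D) (at x)"
    by (intro has_derivative_sum has_derivative_scaleR_left polf_has_derivative[OF assms])
  moreover have "(\<Sum>i\<in>UNIV. y $ i *\<^sub>R axis i (1::real)) = y" for y :: "real^3"
    by (simp add: basis_expansion scalar_mult_eq_scaleR[symmetric])
  ultimately have D: "(w has_derivative ?D) (at x)" by (simp only:)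
  then have "(\<lambda>h. matrix ?D *v h) = ?D"
    by (intro matrix_vector_mul(2) has_derivative_linear)
  then show ?thesis using D by (intro exI[of _ "matrix ?D"]) (simp only:)
qed

text \<open>Testing 0 and the axis vectors against each other shows that the matrix of values at the
  axis vectors is skew, so three entries kill it. Testing \<open>x\<close> against 0 and against an
  axis vector then isolates one component of \<open>w x\<close>. The six normalizations match the
  dimension of the rigid motions.\<close>

lemma rigid_motion_eq_0:
  fixes w :: "real^3 \<Rightarrow> real^3"
  assumes rigid: "\<And>x y. (w x - w y) \<bullet> (x - y) = 0" and "w 0 = 0"
    and "w (axis 1 1) $ 2 = 0" "w (axis 1 1) $ 3 = 0" "w (axis 2 1) $ 3 = 0"
  shows "w x = 0"
proof -
  have diag: "w (axis i 1) $ i = 0" for i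
    using rigid[of "axis i 1" 0] assms(2) by (simp add: inner_axis)
  have off: "w (axis i 1) $ j = - w (axis j 1) $ i" for i j
    using rigid[of "axis i 1" "axis j 1"] diag[of i] diag[of j]
    by (simp add: inner_axis inner_diff_right inner_diff_left)
  have "w (axis i 1) $ j = 0" for i j
    using exhaust_3[of i] exhaust_3[of j] assms(3-5) diag[of i] off[of i j] by auto
  then have z: "w (axis i 1) = 0" for i by (simp add: vec_eq_iff)
  have "w x $ i = 0" for i
    using rigid[of x 0] rigid[of x "axis i 1"] z[of i] assms(2) by (simp add: inner_axis inner_diff_right)
  then show ?thesis by (simp add: vec_eq_iff)
qed

text \<open>For addressing \<open>real^60\<close> and \<open>real^210\<close> by index sets of the
  right size: \<open>h\<close> encodes an index and \<open>r\<close> decodes it.\<close>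

lemma finite_bij_to_type:
  assumes "finite I" "card I = CARD('n::finite)"
  shows "\<exists>(h :: 'i \<Rightarrow> 'n::finite) r. (\<forall>p\<in>I. r (h p) = p) \<and> (\<forall>n. r n \<in> I) \<and> (\<forall>n. h (r n) = n)"
proof -
  obtain h :: "'i \<Rightarrow> 'n" where h: "bij_betw h I UNIV"
    using finite_same_card_bij[OF assms(1) finite assms(2)] by blast
  have "\<forall>p\<in>I. the_inv_into I h (h p) = p"
    using h by (auto simp: bij_betw_def the_inv_into_f_f)
  moreover have "the_inv_into I h n \<in> I" "h (the_inv_into I h n) = n" for n
    using h the_inv_into_into[of h I n I] f_the_inv_into_f[of h I n] by (auto simp: bij_betw_def)
  ultimately show ?thesis by blast
qed

lemma card_less_pairs: "2 * card {(i :: 'a::{finite,linorder}, j). i < j} + CARD('a) = CARD('a)\<^sup>2"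
proof -
  let ?P = "{(i :: 'a, j). i < j}" and ?D = "range (\<lambda>i::'a. (i, i))"
  have un: "(UNIV :: ('a \<times> 'a) set) = ?P \<union> (prod.swap ` ?P \<union> ?D)"
    by (force simp: image_def)
  have "card (prod.swap ` ?P) = card ?P" by (intro card_image) simp
  moreover have "card ?D = CARD('a)" by (intro card_image) (auto simp: inj_on_def)
  moreover have "card (prod.swap ` ?P \<union> ?D) = card (prod.swap ` ?P) + card ?D"
    by (rule card_Un_disjoint) auto
  moreover have "card (?P \<union> (prod.swap ` ?P \<union> ?D)) = card ?P + card (prod.swap ` ?P \<union> ?D)"
    by (rule card_Un_disjoint) auto
  moreover have "CARD('a \<times> 'a) = CARD('a)\<^sup>2" by (simp add: power2_eq_square)
  ultimately show ?thesis unfolding un by simp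
qed

lemma card_pairs: "card pairs = 6"
  using card_less_pairs[where 'a = 4] by (simp add: pairs_def)

text \<open>A basis occupies part of the index type and the remaining indices are filled with 0, so
  an upper bound on the dimension already gives a spanning family over a fixed type.\<close>

lemma subspace_spanned_by_family:
  fixes S :: "'a::euclidean_space set"
  assumes "subspace S" "dim S \<le> CARD('n::finite)"
  obtains f :: "'n::finite \<Rightarrow> 'a" where "range f \<subseteq> S" "\<And>x. x \<in> S \<Longrightarrow> \<exists>a. x = (\<Sum>z\<in>UNIV. a z *\<^sub>R f z)"
proof -
  obtain B where B: "B \<subseteq> S" "independent B" "S \<subseteq> span B" "card B = dim S"
    using basis_exists by blast
  have fin: "finite B" using B(2) independent_imp_finite by blast
  then obtain h :: "'a \<Rightarrow> 'n" where h: "inj_on h B"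
    using card_le_inj[OF fin, of "UNIV :: 'n set"] assms(2) B(4) by auto
  define f where "f z = (if z \<in> h ` B then the_inv_into B h z else 0)" for z
  have fh: "f (h b) = b" if "b \<in> B" for b using that h by (simp add: f_def the_inv_into_f_f)
  let ?R = "{x. \<exists>a. x = (\<Sum>z\<in>UNIV. a z *\<^sub>R f z)}"
  show ?thesis
  proof
    show "range f \<subseteq> S"
      using h B(1) subspace_0[OF assms(1)] by (auto simp: f_def the_inv_into_f_f)
    have "subspace ?R"
      unfolding subspace_def
    proof (intro conjI ballI allI)
      show "0 \<in> ?R" by (auto intro!: exI[of _ "\<lambda>_. 0"])
    next
      fix x y assume "x \<in> ?R" "y \<in> ?R"
      then obtain a b where "x = (\<Sum>z\<in>UNIV. a z *\<^sub>R f z)" "y = (\<Sum>z\<in>UNIV. b z *\<^sub>R f z)" by blast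
      then show "x + y \<in> ?R" by (auto intro!: exI[of _ "\<lambda>z. a z + b z"] simp: scaleR_add_left sum.distrib)
    next
      fix r x assume "x \<in> ?R"
      then obtain a where "x = (\<Sum>z\<in>UNIV. a z *\<^sub>R f z)" by blast
      then show "r *\<^sub>R x \<in> ?R" by (auto intro!: exI[of _ "\<lambda>z. r * a z"] simp: scaleR_sum_right)
    qed
    moreover have "B \<subseteq> ?R"
    proof
      fix b assume b: "b \<in> B"
      have "b = (\<Sum>z\<in>UNIV. (if z = h b then 1 else 0) *\<^sub>R f z)"
        using fh[OF b] by (simp add: if_distrib if_distribR cong: if_cong)
      then show "b \<in> ?R" by (intro CollectI exI[of _ "\<lambda>z. if z = h b then 1 else 0"])
    qed
    ultimately have "span B \<subseteq> ?R" by (rule span_minimal[rotated])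
    then show "\<exists>a. x = (\<Sum>z\<in>UNIV. a z *\<^sub>R f z)" if "x \<in> S" for x using that B(3) by auto
  qed
qed

context tetrahedron
begin

section \<open>Faces, their normals, and a normal form of M(K)\<close>

lemma face_eq: "convex hull (v ` (UNIV - {l})) = {x \<in> K. lam l x = 0}"
proof (intro equalityI subsetI)
  fix x assume x: "x \<in> convex hull (v ` (UNIV - {l}))"
  have "convex {x \<in> K. lam l x = 0}"
    using convex_K by (auto simp: convex_def lam_affine)
  moreover have "v ` (UNIV - {l}) \<subseteq> {x \<in> K. lam l x = 0}"
    by (auto simp: lam_v K_eq)
  ultimately show "x \<in> {x \<in> K. lam l x = 0}" using x hull_minimal[of _ _ convex] by blast
next
  fix x assume x: "x \<in> {x \<in> K. lam l x = 0}"
  have s: "(\<Sum>i\<in>UNIV - {l}. lam i x) = 1"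
    using x sum_lam[of x] by (simp add: sum.remove[of UNIV l])
  have "(\<Sum>i\<in>UNIV - {l}. lam i x *\<^sub>R v i) \<in> convex hull (v ` (UNIV - {l}))"
    using x s by (intro convex_sum) (auto simp: K_eq intro: hull_inc)
  also have "(\<Sum>i\<in>UNIV - {l}. lam i x *\<^sub>R v i) = x"
    using x sum_lam_v[of x] by (simp add: sum.remove[of UNIV l])
  finally show "x \<in> convex hull (v ` (UNIV - {l}))" .
qed

lemma facet_of_K_iff: "f facet_of K \<longleftrightarrow> (\<exists>l. f = {x \<in> K. lam l x = 0})"
proof -
  have hull: "convex hull (range v - {v l}) = {x \<in> K. lam l x = 0}" for l
  proof -
    have "range v - {v l} = v ` (UNIV - {l})" using inj_v by (auto simp: inj_def)
    then show ?thesis by (simp add: face_eq)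
  qed
  have "{x \<in> K. lam l x = 0} \<noteq> {}" for l
  proof -
    obtain i where "i \<noteq> l" by (metis add_cancel_right_right zero_neq_one)
    then have "v i \<in> {x \<in> K. lam l x = 0}" by (auto simp: K_eq lam_v)
    then show ?thesis by blast
  qed
  moreover have "f facet_of K \<longleftrightarrow> f \<noteq> {} \<and> (\<exists>l. f = convex hull (range v - {v l}))"
    unfolding K_hull facet_of_convex_hull_affine_independent[OF indep] by blast
  ultimately show ?thesis by (auto simp only: hull)
qed

text \<open>In the expansion of \<open>n\<close> by \<open>sum_v_g\<close> the three coefficients
  other than that of \<open>g l\<close> agree, and those three gradients sum to
  \<open>- g l\<close>.\<close>

lemma orthogonal_to_face:
  assumes "\<And>i j. i \<noteq> l \<Longrightarrow> j \<noteq> l \<Longrightarrow> n \<bullet> v i = n \<bullet> v j"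
  shows "\<exists>r. n = r *\<^sub>R g l"
proof -
  obtain k where k: "k \<noteq> l" by (metis add_cancel_right_right zero_neq_one)
  define \<kappa> where "\<kappa> = n \<bullet> v k"
  have "n = (\<Sum>i\<in>UNIV. (v i \<bullet> n) *\<^sub>R g i)" by (simp add: sum_v_g)
  also have "\<dots> = (v l \<bullet> n) *\<^sub>R g l + (\<Sum>i\<in>UNIV - {l}. (v i \<bullet> n) *\<^sub>R g i)"
    by (simp add: sum.remove[of UNIV l])
  also have "(\<Sum>i\<in>UNIV - {l}. (v i \<bullet> n) *\<^sub>R g i) = (\<Sum>i\<in>UNIV - {l}. \<kappa> *\<^sub>R g i)"
  proof (rule sum.cong)
    fix i assume "i \<in> UNIV - {l}"
    then show "(v i \<bullet> n) *\<^sub>R g i = \<kappa> *\<^sub>R g i"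
      using assms[of i k] k by (simp add: \<kappa>_def inner_commute)
  qed simp
  also have "(\<Sum>i\<in>UNIV - {l}. \<kappa> *\<^sub>R g i) = \<kappa> *\<^sub>R (- g l)"
  proof -
    have "(\<Sum>i\<in>UNIV - {l}. g i) = - g l"
      using sum_g by (simp add: sum.remove[of UNIV l] eq_neg_iff_add_eq_0 add.commute)
    then show ?thesis by (metis scaleR_sum_right)
  qed
  finally have "n = (v l \<bullet> n - \<kappa>) *\<^sub>R g l" by (simp add: scaleR_diff_left)
  then show ?thesis by blast
qed

lemma g_nonzero: "g l \<noteq> 0"
proof -
  obtain k where "k \<noteq> l" by (metis add_cancel_right_right zero_neq_one)
  then show ?thesis using g_tv[of l k l] by auto
qed

text \<open>Zero divergence spreads from \<open>K\<close> to the whole space by the identity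
  theorem, facets are named by the coordinate that vanishes on them, and unit normals are multiples
  of the gradients.\<close>

lemma M_space_iff: "T \<in> M_space K \<longleftrightarrow> T \<in> polys 4 sym_matrices \<and> (\<forall>x. row_div T x = 0) \<and>
    (\<forall>l. \<forall>x\<in>K. lam l x = 0 \<longrightarrow> T x *v g l = 0)"
proof (cases "T \<in> polys 4 sym_matrices")
  case True
  have "(\<forall>x\<in>K. row_div T x = 0) \<longleftrightarrow> (\<forall>x. row_div T x = 0)"
  proof
    assume z: "\<forall>x\<in>K. row_div T x = 0"
    have "polf 3 (\<lambda>x. row_div T x $ i)" for i
      using True by (intro polf_row_div[where X = sym_matrices]) (simp add: eval_nat_numeral)
    from polf_eq_0_if_interior[OF this _ interior_K] z
    have "row_div T x $ i = 0" for x i by auto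
    then show "\<forall>x. row_div T x = 0" by (simp add: vec_eq_iff)
  qed auto
  moreover have "(\<forall>f n. f facet_of K \<longrightarrow> outward_unit_normal K f n \<longrightarrow> (\<forall>x\<in>f. T x *v n = 0)) \<longleftrightarrow>
    (\<forall>l. \<forall>x\<in>K. lam l x = 0 \<longrightarrow> T x *v g l = 0)" (is "?L \<longleftrightarrow> ?R")
  proof
    assume L: ?L
    show ?R
    proof (intro allI ballI impI)
      fix l x assume x: "x \<in> K" "lam l x = 0"
      \<comment> \<open>\<open>g l\<close> points into \<open>K\<close>, so the outward normal is a
        negative multiple of it.\<close>
      define r where "r = - 1 / norm (g l)"
      have r: "r < 0" "\<bar>r\<bar> * norm (g l) = 1" using g_nonzero[of l] by (simp_all add: r_def)
      let ?f = "{x \<in> K. lam l x = 0}" and ?n = "r *\<^sub>R g l"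
      have "outward_unit_normal K ?f ?n"
        unfolding outward_unit_normal_def
      proof (intro conjI ballI)
        show "norm ?n = 1" using r(2) by simp
        fix x y assume "x \<in> ?f" "y \<in> K"
        then have "0 \<le> lam l y" "lam l x = 0" by (auto simp: K_eq)
        then have "0 \<le> g l \<bullet> (y - x)" using lam_diff[of l y x] by simp
        then show "?n \<bullet> (y - x) \<le> 0" using r(1) by (simp add: mult_nonpos_nonneg)
      qed
      then have "T x *v ?n = 0" using L x facet_of_K_iff by blast
      then show "T x *v g l = 0" using r(1) by (simp add: matrix_vector_mult_scaleR)
    qed
  next
    assume R: ?R
    show ?L
    proof (intro allI impI ballI)
      fix f n x assume f: "f facet_of K" and n: "outward_unit_normal K f n" and x: "x \<in> f"
      obtain l where l: "f = {x \<in> K. lam l x = 0}" using f facet_of_K_iff by blast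
      \<comment> \<open>For two vertices of the facet the inequality holds in both orders, which
        makes \<open>n\<close> orthogonal to the facet.\<close>
      have le: "n \<bullet> (v j - v i) \<le> 0" if "i \<noteq> l" "j \<noteq> l" for i j
        using n that unfolding outward_unit_normal_def l by (auto simp: lam_v K_eq)
      have "n \<bullet> v i = n \<bullet> v j" if "i \<noteq> l" "j \<noteq> l" for i j
        using le[OF that] le[OF that(2,1)] by (simp add: inner_diff_right)
      then obtain r where "n = r *\<^sub>R g l" using orthogonal_to_face by blast
      then show "T x *v n = 0" using R x l by (simp add: matrix_vector_mult_scaleR)
    qed
  qed
  ultimately show ?thesis by (simp add: M_space_def)
qed (simp add: M_space_def)

lemma Sigma_unisolvence:
  assumes T: "T \<in> Sigma_space" and face: "\<And>l x. x \<in> K \<Longrightarrow> lam l x = 0 \<Longrightarrow> T x *v g l = 0"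
    and avg: "integral K T = 0" and mom: "\<And>U. U \<in> M_space K \<Longrightarrow> integral K (\<lambda>x. T x \<bullet> U x) = 0"
  shows "T x = 0"
proof -
  have T4: "T \<in> polys 4 sym_matrices" and w1: "\<And>i. polf 1 (\<lambda>x. row_div T x $ i)"
    using T by (auto simp: Sigma_space_def polys_vec_iff)
  obtain q where q: "\<And>e. polf 2 (q e)" "T = bubble q" using bubble_representation[OF T4 face] by blast
  define w where "w = row_div T"
  have "\<exists>c l. linear l \<and> (\<lambda>x. w x $ i) = (\<lambda>x. c + l x)" for i
    using polf_1_affine[OF w1] by (simp add: w_def)
  then obtain c0 l where l: "\<And>i. linear (l i)" "\<And>i. (\<lambda>x. w x $ i) = (\<lambda>x. c0 i + l i x)" by metis
  define b :: "real^3" where "b = (\<chi> i. c0 i)"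
  have lin: "linear (\<lambda>x. (\<chi> i. l i x) :: real^3)"
    using l(1) by (simp add: linear_iff vec_eq_iff)
  \<comment> \<open>The matrix of the linear part of the affine field \<open>div T\<close>. Its edge
    strains \<open>t' A t\<close> do not depend on \<open>x\<close>, and weighted with the
    coefficients of the bubble they add up to \<open>T : A\<close>.\<close>
  define A where "A = matrix (\<lambda>x. (\<chi> i. l i x) :: real^3)"
  have wA: "w x = b + A *v x" for x
    using l(2) unfolding A_def fun_cong[OF matrix_vector_mul(2)[OF lin]] by (simp add: vec_eq_iff b_def fun_eq_iff)
  have strain: "strain w (i, j) x = tv i j \<bullet> (A *v tv i j)" for i j x
  proof -
    have "((\<lambda>x. tv i j \<bullet> w x) has_derivative (\<lambda>h. tv i j \<bullet> (A *v h))) (at x)"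
      unfolding wA by (auto intro!: derivative_eq_intros bounded_linear_imp_has_derivative
        simp: linear_conv_bounded_linear[symmetric])
    from frechet_derivative_at[OF this, symmetric] show ?thesis by (simp add: strain_def)
  qed
  have cT: "T integrable_on K"
    by (intro continuous_on_compact_integrable_on compact_K polys_continuous_on[OF T4])
  have "integral K (\<lambda>x. w x \<bullet> w x) = - integral K (\<lambda>x. T x \<bullet> A)"
  proof -
    have "integral K (\<lambda>x. row_div (bubble q) x \<bullet> w x) =
        - integral K (\<lambda>x. \<Sum>(i, j)\<in>pairs. lam i x * lam j x * q (i, j) x * strain w (i, j) x)"
      using w1 by (intro integral_row_div_bubble[of 2 q 1] q(1)) (simp add: w_def)
    then have "integral K (\<lambda>x. row_div (bubble q) x \<bullet> w x) = - integral K (\<lambda>x. bubble q x \<bullet> A)"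
      by (simp only: strain bubble_inner)
    then show ?thesis unfolding q(2)[symmetric] w_def[symmetric] .
  qed
  also have "integral K (\<lambda>x. T x \<bullet> A) = integral K T \<bullet> A"
    using integral_linear[OF cT bounded_linear_inner_left] by (simp add: o_def)
  finally have 0: "integral K (\<lambda>x. w x \<bullet> w x) = 0" by (simp add: avg)
  have "polf (1 + 1) (\<lambda>x. w x \<bullet> w x)"
    unfolding inner_vec_def w_def inner_real_def by (intro polf_sum polf_mult w1)
  from polf_integral_eq_0[OF this compact_K interior_K _ 0]
  have "row_div T x = 0" for x by (simp add: w_def)
  then have "T \<in> M_space K" using T4 face by (simp add: M_space_iff)
  then have "integral K (\<lambda>x. T x \<bullet> T x) = 0" by (rule mom)
  from polf_integral_eq_0[OF polf_field_inner[OF T4 T4] compact_K interior_K _ this]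
  show ?thesis by simp
qed

end

section \<open>The dimension bound\<close>

lemma row_div_add:
  assumes "S \<in> polys k X" "T \<in> polys k Y"
  shows "row_div (\<lambda>x. S x + T x) x = row_div S x + row_div T x"
proof -
  have "frechet_derivative (\<lambda>y. S y $ i $ j + T y $ i $ j) (at x) =
      (\<lambda>h. frechet_derivative (\<lambda>y. S y $ i $ j) (at x) h + frechet_derivative (\<lambda>y. T y $ i $ j) (at x) h)" for i j
    using assms by (intro frechet_derivative_at[symmetric] has_derivative_add polf_has_derivative)
      (auto simp: polys_mat_iff)
  then show ?thesis by (simp add: row_div_def vec_eq_iff sum.distrib)
qed

lemma row_div_scale:
  assumes "T \<in> polys k X"
  shows "row_div (\<lambda>x. r *\<^sub>R T x) x = r *\<^sub>R row_div T x"
proof -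
  have "frechet_derivative (\<lambda>y. r * T y $ i $ j) (at x) =
      (\<lambda>h. r * frechet_derivative (\<lambda>y. T y $ i $ j) (at x) h)" for i j
    using assms by (intro frechet_derivative_at[symmetric] has_derivative_mult_right polf_has_derivative)
      (auto simp: polys_mat_iff)
  then show ?thesis by (simp add: row_div_def vec_eq_iff sum_distrib_left)
qed

context tetrahedron
begin

lemma strain_add:
  assumes "\<And>i. polf k (\<lambda>x. u x $ i)" "\<And>i. polf k (\<lambda>x. w x $ i)"
  shows "strain (\<lambda>x. u x + w x) e x = strain u e x + strain w e x"
proof -
  have "frechet_derivative (\<lambda>x. t \<bullet> u x + t \<bullet> w x) (at x) =
      (\<lambda>h. frechet_derivative (\<lambda>x. t \<bullet> u x) (at x) h + frechet_derivative (\<lambda>x. t \<bullet> w x) (at x) h)" for t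
    by (intro frechet_derivative_at[symmetric] has_derivative_add polf_has_derivative[OF polf_inner_vec[OF assms(1)]]
      polf_has_derivative[OF polf_inner_vec[OF assms(2)]])
  then show ?thesis by (simp add: strain_def case_prod_unfold inner_add_right)
qed

lemma strain_scale:
  assumes "\<And>i. polf k (\<lambda>x. w x $ i)"
  shows "strain (\<lambda>x. r *\<^sub>R w x) e x = r * strain w e x"
proof -
  have "frechet_derivative (\<lambda>x. r * (t \<bullet> w x)) (at x) =
      (\<lambda>h. r * frechet_derivative (\<lambda>x. t \<bullet> w x) (at x) h)" for t
    by (intro frechet_derivative_at[symmetric] has_derivative_mult_right polf_has_derivative[OF polf_inner_vec[OF assms]])
  then show ?thesis by (simp add: strain_def case_prod_unfold)
qed

lemma polf_strain: "(\<And>i. polf k (\<lambda>x. w x $ i)) \<Longrightarrow> polf (k - 1) (strain w e)"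
  unfolding strain_def case_prod_unfold by (intro polf_frechet_derivative polf_inner_vec)

text \<open>Vanishing edge strains make the gradient of \<open>w\<close> skew at every point, so the
  component of \<open>w\<close> along \<open>x - y\<close> is constant on the segment from
  \<open>y\<close> to \<open>x\<close>.\<close>

lemma strain_eq_0_imp_rigid:
  assumes w: "\<And>i. polf k (\<lambda>x. w x $ i)" and s: "\<And>e x. e \<in> pairs \<Longrightarrow> strain w e x = 0"
  shows "(w x - w y) \<bullet> (x - y) = 0"
proof -
  have "\<exists>A. (w has_derivative (\<lambda>h. A *v h)) (at z) \<and> (\<forall>u. u \<bullet> (A *v u) = 0)" for z
  proof -
    obtain A where A: "(w has_derivative (\<lambda>h. A *v h)) (at z)"
      using has_derivative_vec_polf[OF w] by blast
    have "tv i j \<bullet> (A *v tv i j) = 0" if "i < j" for i j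
    proof -
      have "((\<lambda>x. tv i j \<bullet> w x) has_derivative (\<lambda>h. tv i j \<bullet> (A *v h))) (at z)"
        using A by (intro has_derivative_inner_right)
      from frechet_derivative_at[OF this, symmetric] show ?thesis
        using s[of "(i, j)" z] that by (simp add: strain_def pairs_def)
    qed
    then show ?thesis using A tv_outer_eq_0 by blast
  qed
  then obtain A where A: "\<And>z. (w has_derivative (\<lambda>h. A z *v h)) (at z)" "\<And>z u. u \<bullet> (A z *v u) = 0" by metis
  define \<phi> where "\<phi> s = (x - y) \<bullet> w (y + s *\<^sub>R (x - y))" for s
  have "(\<phi> has_real_derivative 0) (at s)" for s
  proof -
    have "((\<lambda>s. w (y + s *\<^sub>R (x - y))) has_derivative (\<lambda>h. A (y + s *\<^sub>R (x - y)) *v (h *\<^sub>R (x - y)))) (at s)"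
      by (rule has_derivative_compose[where g = w and f = "\<lambda>s. y + s *\<^sub>R (x - y)"])
        (auto intro!: derivative_eq_intros A)
    then have "(\<phi> has_derivative (\<lambda>h. (x - y) \<bullet> (A (y + s *\<^sub>R (x - y)) *v (h *\<^sub>R (x - y))))) (at s)"
      unfolding \<phi>_def by (rule has_derivative_inner_right)
    moreover have "(*) 0 = (\<lambda>h::real. 0 :: real)" by (simp add: fun_eq_iff)
    ultimately show ?thesis
      by (simp add: matrix_vector_mult_scaleR A(2) has_field_derivative_def)
  qed
  then have "\<phi> 1 = \<phi> 0" using DERIV_isconst_all by blast
  then show ?thesis by (simp add: \<phi>_def inner_diff_left inner_diff_right inner_commute)
qed

lemma interior_lam_pos:
  assumes "x \<in> interior K" shows "0 < lam i x"
proof (rule ccontr)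
  assume "\<not> 0 < lam i x"
  moreover have "0 \<le> lam i x" using assms interior_subset K_eq by blast
  ultimately have 0: "lam i x = 0" by simp
  obtain e where e: "e > 0" "ball x e \<subseteq> K" using assms by (meson mem_interior)
  \<comment> \<open>The step has length \<open>e / 2\<close>, so it stays in the ball, yet going
    against the gradient it would make \<open>lam i\<close> negative.\<close>
  define s where "s = e / (2 * norm (g i))"
  have "norm (s *\<^sub>R g i) < e" using e(1) g_nonzero[of i] by (simp add: s_def)
  then have "x - s *\<^sub>R g i \<in> K" using e(2) by (auto simp: dist_norm)
  then have "0 \<le> lam i (x - s *\<^sub>R g i)" by (simp add: K_eq)
  also have "lam i (x - s *\<^sub>R g i) = - s * (g i \<bullet> g i)" using 0 by (simp add: lam_def inner_diff_right)
  also have "\<dots> < 0" using e(1) g_nonzero[of i] by (simp add: s_def)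
  finally show False by simp
qed

text \<open>
  The map \<open>(b, w) \<mapsto> (b + strain w, rigid part of w)\<close> is injective on divergence-free bubbles
  times cubic vector fields: if \<open>strain w\<close> is the coefficient family of a divergence-free bubble,
  integration by parts against \<open>w\<close> shows that it vanishes. So \<open>dim + 60 \<le> 60 + 6\<close>.
\<close>
lemma M_space_spanned_by_6:
  "\<exists>U :: 6 \<Rightarrow> real^3 \<Rightarrow> real^3^3. (\<forall>z. U z \<in> M_space K) \<and>
    (\<forall>T\<in>M_space K. \<exists>a. T = (\<lambda>x. \<Sum>z\<in>UNIV. a z *\<^sub>R U z x))"
proof -
  have fin: "finite (expo 2 \<times> pairs)" "finite (expo 3 \<times> (UNIV :: 3 set))" by simp_all
  have card2: "card (expo 2 \<times> pairs) = CARD(60)"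
    by (simp only: card_cartesian_product card_expo_numeral card_pairs) simp
  obtain h :: "(3 \<Rightarrow> nat) \<times> (4 \<times> 4) \<Rightarrow> 60" and r where
    h: "\<forall>p\<in>expo 2 \<times> pairs. r (h p) = p" and r: "\<forall>n. r n \<in> expo 2 \<times> pairs" "\<forall>n. h (r n) = n"
    using finite_bij_to_type[OF fin(1) card2] by blast
  have card3: "card (expo 3 \<times> (UNIV :: 3 set)) = CARD(60)"
    by (simp only: card_cartesian_product card_expo_numeral) simp
  obtain h' :: "(3 \<Rightarrow> nat) \<times> 3 \<Rightarrow> 60" and r' where
    h': "\<forall>p\<in>expo 3 \<times> UNIV. r' (h' p) = p" and r': "\<forall>n. r' n \<in> expo 3 \<times> UNIV" "\<forall>n. h' (r' n) = n"
    using finite_bij_to_type[OF fin(2) card3] by blast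
  \<comment> \<open>\<open>Q\<close> reads a vector as quadratic coefficients of a bubble,
    \<open>W\<close> reads one as the coefficients of a cubic vector field.\<close>
  define Q :: "real^60 \<Rightarrow> 4 \<times> 4 \<Rightarrow> real^3 \<Rightarrow> real"
    where "Q b e x = (\<Sum>\<alpha>\<in>expo 2. xmonom \<alpha> x * b $ h (\<alpha>, e))" for b e x
  define W :: "real^60 \<Rightarrow> real^3 \<Rightarrow> real^3"
    where "W w x = (\<chi> i. \<Sum>\<alpha>\<in>expo 3. xmonom \<alpha> x * w $ h' (\<alpha>, i))" for w x
  \<comment> \<open>The strain of a cubic field is quadratic, so its six components are the
    coefficients of a bubble; \<open>A\<close> is this map in coordinates.\<close>
  define A :: "real^60 \<Rightarrow> real^60" where "A w = (\<chi> n. mcoef (strain (W w) (snd (r n))) (fst (r n)))" for w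
  have Q: "polf 2 (Q b e)" for b e unfolding Q_def[abs_def] by (rule polf_xmonom_sum)
  have W: "polf 3 (\<lambda>x. W w x $ i)" for w i unfolding W_def by (simp add: polf_xmonom_sum)
  have Q_add: "Q (b + b') e x = Q b e x + Q b' e x" and Q_scale: "Q (s *\<^sub>R b) e x = s * Q b e x" for b b' e x s
    by (simp_all add: Q_def distrib_left sum.distrib sum_distrib_left mult_ac)
  have W_add: "W (b + b') = (\<lambda>x. W b x + W b' x)" and W_scale: "W (s *\<^sub>R b) = (\<lambda>x. s *\<^sub>R W b x)" for b b' s
    by (simp_all add: W_def vec_eq_iff fun_eq_iff distrib_left sum.distrib sum_distrib_left mult_ac)
  have pS: "polf 2 (strain (W w) e)" for w e using polf_strain[OF W] by simp
  have bub_add: "bubble (Q (b + b')) x = bubble (Q b) x + bubble (Q b') x"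
    and bub_scale: "bubble (Q (s *\<^sub>R b)) x = s *\<^sub>R bubble (Q b) x" for b b' s x
    by (simp_all add: bubble_def Q_add Q_scale case_prod_unfold distrib_left scaleR_add_left sum.distrib
      scaleR_sum_right mult_ac)
  have bub: "bubble (Q b) \<in> polys 4 sym_matrices" for b by (rule bubble_polys[OF Q])
  have QA: "Q (A w) e = strain (W w) e" if "e \<in> pairs" for w e
  proof
    fix x
    have "Q (A w) e x = (\<Sum>\<alpha>\<in>expo 2. xmonom \<alpha> x * mcoef (strain (W w) e) \<alpha>)"
      unfolding Q_def A_def using h that by (intro sum.cong) auto
    also have "\<dots> = strain (W w) e x" by (rule polf_mcoef[OF pS, symmetric])
    finally show "Q (A w) e x = strain (W w) e x" .
  qed
  have A_lin: "linear A"
  proof (rule linearI)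
    fix w w' s
    have "strain (W (w + w')) e = (\<lambda>x. strain (W w) e x + strain (W w') e x)" for e
      unfolding W_add by (rule ext, rule strain_add[OF W W])
    then show "A (w + w') = A w + A w'"
      by (simp add: A_def vec_eq_iff mcoef_add[OF pS pS])
    have "strain (W (s *\<^sub>R w)) e = (\<lambda>x. s * strain (W w) e x)" for e
      unfolding W_scale by (rule ext, rule strain_scale[OF W])
    then show "A (s *\<^sub>R w) = s *\<^sub>R A w"
      by (simp add: A_def vec_eq_iff mcoef_cmult[OF pS])
  qed
  define M where "M = {b. \<forall>x. row_div (bubble (Q b)) x = 0}"
  have "subspace M"
    unfolding subspace_def
  proof (intro conjI ballI allI)
    show "0 \<in> M"
      unfolding M_def mem_Collect_eq
    proof
      fix x
      have "row_div (bubble (Q 0)) x = row_div (\<lambda>x. 0 *\<^sub>R bubble (Q 0) x) x"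
        using bub_scale[of 0 0] by (simp add: fun_eq_iff) (metis bub_scale scaleR_zero_left)
      then show "row_div (bubble (Q 0)) x = 0" by (subst (asm) row_div_scale[OF bub]) simp
    qed
  next
    fix b b' assume "b \<in> M" "b' \<in> M"
    moreover have "bubble (Q (b + b')) = (\<lambda>x. bubble (Q b) x + bubble (Q b') x)" by (rule ext, rule bub_add)
    ultimately show "b + b' \<in> M" by (simp add: M_def row_div_add[OF bub bub])
  next
    fix s b assume "b \<in> M"
    moreover have "bubble (Q (s *\<^sub>R b)) = (\<lambda>x. s *\<^sub>R bubble (Q b) x)" by (rule ext, rule bub_scale)
    ultimately show "s *\<^sub>R b \<in> M" by (simp add: M_def row_div_scale[OF bub])
  qed
  \<comment> \<open>The six numbers that \<open>rigid_motion_eq_0\<close> requires to be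
    zero.\<close>
  define \<rho> where "\<rho> w = (W w 0, (\<chi> i::3. if i = 1 then W w (axis 1 1) $ 2 else if i = 2 then W w (axis 1 1) $ 3
    else W w (axis 2 1) $ 3) :: real^3)" for w
  have A_M: "w = 0" if "A w \<in> M" "\<rho> w = 0" for w
  proof -
    \<comment> \<open>The bubble with coefficients \<open>strain (W w)\<close> is paired with
      \<open>W w\<close> itself; by parts this becomes an integral of squares with weights that are
      nonnegative on \<open>K\<close>.\<close>
    have "integral K (\<lambda>x. row_div (bubble (Q (A w))) x \<bullet> W w x) = 0"
      using that(1) by (simp add: M_def)
    then have "integral K (\<lambda>x. \<Sum>(i, j)\<in>pairs. lam i x * lam j x * Q (A w) (i, j) x * strain (W w) (i, j) x) = 0"
      using integral_row_div_bubble[of 2 "Q (A w)" 3 "W w", OF Q W] by simp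
    also have "(\<lambda>x. \<Sum>(i, j)\<in>pairs. lam i x * lam j x * Q (A w) (i, j) x * strain (W w) (i, j) x) =
        (\<lambda>x. \<Sum>e\<in>pairs. lam (fst e) x * lam (snd e) x * (strain (W w) e x * strain (W w) e x))"
      by (intro ext sum.cong) (auto simp: QA)
    finally have 0: "integral K (\<lambda>x. \<Sum>e\<in>pairs. lam (fst e) x * lam (snd e) x * (strain (W w) e x * strain (W w) e x)) = 0" .
    have "polf (Suc (Suc (2 + 2))) (\<lambda>x. \<Sum>e\<in>pairs. lam (fst e) x * lam (snd e) x * (strain (W w) e x * strain (W w) e x))"
      by (intro polf_sum polf_bubble_coefficient polf_mult pS)
    from polf_integral_eq_0[OF this compact_K interior_K _ 0]
    have z: "(\<Sum>e\<in>pairs. lam (fst e) x * lam (snd e) x * (strain (W w) e x * strain (W w) e x)) = 0" for x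
      by (simp add: K_eq sum_nonneg)
    have S0: "strain (W w) e x = 0" if "e \<in> pairs" for e x
    proof -
      \<comment> \<open>In the interior all weights are positive, so each square vanishes there; the
        identity theorem extends this to all points.\<close>
      have "strain (W w) e y = 0" if y: "y \<in> interior K" for y
      proof -
        have pos: "0 \<le> lam i y" for i using y interior_subset K_eq by blast
        have "\<forall>e\<in>pairs. lam (fst e) y * lam (snd e) y * (strain (W w) e y * strain (W w) e y) = 0"
          by (subst sum_nonneg_eq_0_iff[symmetric]) (auto simp: pos z)
        then have "lam (fst e) y * lam (snd e) y * (strain (W w) e y * strain (W w) e y) = 0"
          using \<open>e \<in> pairs\<close> by (rule bspec)
        moreover have "lam i y \<noteq> 0" for i using interior_lam_pos[OF y, of i] by simp
        ultimately show ?thesis by simp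
      qed
      from polf_eq_0_if_interior[OF pS this] show ?thesis using interior_K by simp
    qed
    have z4: "W w 0 = 0" "W w (axis 1 1) $ 2 = 0" "W w (axis 1 1) $ 3 = 0" "W w (axis 2 1) $ 3 = 0"
      using that(2) by (auto simp: \<rho>_def zero_prod_def vec_eq_iff forall_3)
    have rig: "(W w x - W w y) \<bullet> (x - y) = 0" for x y
      using S0 by (intro strain_eq_0_imp_rigid[of 3 "W w"] W)
    have "W w x = 0" for x
      by (rule rigid_motion_eq_0[of "W w", OF rig z4])
    then have W0: "(\<Sum>\<alpha>\<in>expo 3. xmonom \<alpha> x * w $ h' (\<alpha>, i)) = 0" for x i
      by (simp add: W_def vec_eq_iff)
    have "w $ n = 0" for n
    proof -
      have "w $ h' (fst (r' n), snd (r' n)) = 0"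
        using r'(1)[rule_format, of n] by (intro monomials_independent[OF W0]) auto
      then show ?thesis by (simp add: r'(2))
    qed
    then show "w = 0" by (simp add: vec_eq_iff)
  qed
  define \<Theta> where "\<Theta> = (\<lambda>(b, w). (b + A w, \<rho> w))"
  have \<rho>_lin: "linear \<rho>"
    by (rule linearI) (simp_all add: \<rho>_def W_add W_scale vec_eq_iff)
  have \<Theta>_lin: "linear \<Theta>"
    by (rule linearI) (auto simp: \<Theta>_def linear_add[OF A_lin] linear_scale[OF A_lin] linear_add[OF \<rho>_lin]
      linear_scale[OF \<rho>_lin] scaleR_add_right)
  have sub: "subspace (M \<times> (UNIV :: (real^60) set))"
    using \<open>subspace M\<close> by (intro subspace_Times) auto
  have "inj_on \<Theta> (M \<times> UNIV)"
    unfolding linear_injective_on_subspace_0[OF \<Theta>_lin sub]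
  proof (intro ballI impI)
    fix p assume p: "p \<in> M \<times> (UNIV :: (real^60) set)" "\<Theta> p = 0"
    obtain b w where bw: "p = (b, w)" "b \<in> M" using p(1) by auto
    have e: "b + A w = 0" "\<rho> w = 0" using p(2) by (auto simp: \<Theta>_def bw zero_prod_def)
    then have "A w = (-1) *\<^sub>R b" by (simp add: eq_neg_iff_add_eq_0 add.commute)
    then have "A w \<in> M" using subspace_scale[OF \<open>subspace M\<close> bw(2)] by metis
    from A_M[OF this e(2)] show "p = 0" using e(1) linear_0[OF A_lin] by (simp add: bw zero_prod_def)
  qed
  then have "dim (M \<times> (UNIV :: (real^60) set)) = dim (\<Theta> ` (M \<times> UNIV))"
    using dim_image_eq[OF \<Theta>_lin, of "M \<times> UNIV"] sub by (simp add: span_eq_iff[THEN iffD2])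
  also have "\<dots> \<le> DIM((real^60) \<times> (real^3) \<times> (real^3))" by (rule dim_subset_UNIV)
  finally have "dim M \<le> CARD(6)"
    using dim_Times[OF \<open>subspace M\<close> subspace_UNIV, where 'b = "real^60"] by simp
  then obtain f :: "6 \<Rightarrow> real^60" where f: "range f \<subseteq> M" "\<And>b. b \<in> M \<Longrightarrow> \<exists>a. b = (\<Sum>z\<in>UNIV. a z *\<^sub>R f z)"
    using subspace_spanned_by_family[OF \<open>subspace M\<close>, where 'n = 6] by blast
  have bub_sum: "bubble (Q (\<Sum>z\<in>S. a z *\<^sub>R f z)) x = (\<Sum>z\<in>S. a z *\<^sub>R bubble (Q (f z)) x)" for a x and S :: "6 set"
  proof (induction S rule: infinite_finite_induct)
    case empty
    show ?case using bub_scale[of 0 0 x] by simp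
  qed (simp_all add: bub_add bub_scale)
  show ?thesis
  proof (intro exI[of _ "\<lambda>z. bubble (Q (f z))"] conjI allI ballI)
    show "bubble (Q (f z)) \<in> M_space K" for z
      using f(1) bub bubble_normal_eq_0 by (auto simp: M_space_iff M_def)
    fix T assume T: "T \<in> M_space K"
    then have T': "T \<in> polys 4 sym_matrices" "\<And>x. row_div T x = 0" "\<And>l x. x \<in> K \<Longrightarrow> lam l x = 0 \<Longrightarrow> T x *v g l = 0"
      by (auto simp: M_space_iff)
    obtain q where q: "\<And>e. polf 2 (q e)" "T = bubble q" using bubble_representation[OF T'(1,3)] by blast
    define b :: "real^60" where "b = (\<chi> n. mcoef (q (snd (r n))) (fst (r n)))"
    have "Q b e x = q e x" if "e \<in> pairs" for e x
    proof -
      have "Q b e x = (\<Sum>\<alpha>\<in>expo 2. xmonom \<alpha> x * mcoef (q e) \<alpha>)"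
        unfolding Q_def b_def using h that by (intro sum.cong) auto
      then show ?thesis using polf_mcoef[OF q(1)] by simp
    qed
    then have Tb: "T = bubble (Q b)" unfolding q(2) bubble_def by (intro ext sum.cong) auto
    then have "b \<in> M" using T'(2) by (simp add: M_def)
    then obtain a where "b = (\<Sum>z\<in>UNIV. a z *\<^sub>R f z)" using f(2) by blast
    then show "\<exists>a. T = (\<lambda>x. \<Sum>z\<in>UNIV. a z *\<^sub>R bubble (Q (f z)) x)"
      unfolding Tb using bub_sum by (intro exI[of _ a]) auto
  qed
qed

end

section \<open>Fields with vanishing edge and face moments\<close>

text \<open>The end values give \<open>f t = t * (t - 1) * f2 t\<close> with quadratic
  \<open>f2\<close>. The moments allow \<open>f\<close> to be tested with \<open>f2\<close>, and
  \<open>- (f2 t * f t)\<close> is a square with the nonnegative weight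
  \<open>t * (1 - t)\<close>.\<close>

lemma polf_1d_eq_0:
  fixes f :: "real \<Rightarrow> real"
  assumes f: "polf 4 f" and "f 0 = 0" "f 1 = 0"
    and mom: "\<And>k. k \<le> 2 \<Longrightarrow> integral {0..1} (\<lambda>t. t ^ k * f t) = 0"
  shows "f t = 0"
proof -
  obtain f1 where f1: "polf 3 f1" "\<And>t. f t = t * f1 t"
    using polf_divide_affine[of 3 f "\<lambda>t. t" 1 0] f assms(2) by (auto simp: linear_iff)
  obtain f2 where f2: "polf 2 f2" "\<And>t. f1 t = (t - 1) * f2 t"
    using polf_divide_affine[of 2 f1 "\<lambda>t. t" 1 "-1"] f1 assms(3) by (auto simp: linear_iff eval_nat_numeral)
  obtain a where a: "\<And>t. f2 (0 + t *\<^sub>R 1) = (\<Sum>i\<le>2. a i * t ^ i)"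
    using polf_line[OF f2(1)] by blast
  have lin: "linear (\<lambda>t::real. - t)" "linear (\<lambda>t::real. t)" by (simp_all add: linear_iff)
  have pw: "polf (2 * 1 + 0) (\<lambda>t::real. t ^ i)" if "i \<le> 2" for i :: nat
    using polf_mono[OF polf_power[OF polf_linear[OF lin(2)], of i], of "2"] that by simp
  have "t * (1 - t) * (f2 t * f2 t) = - (\<Sum>i\<le>2. a i * (t ^ i * f t))" for t
  proof -
    have "t * (1 - t) * (f2 t * f2 t) = - (f2 t * f t)" by (simp add: f1 f2 algebra_simps)
    also have "f2 t * f t = (\<Sum>i\<le>2. a i * t ^ i) * f t" using a[of t] by simp
    finally show ?thesis by (simp only: sum_distrib_right mult.assoc)
  qed
  then have "integral {0..1} (\<lambda>t. t * (1 - t) * (f2 t * f2 t)) = integral {0..1} (\<lambda>t. - (\<Sum>i\<le>2. a i * (t ^ i * f t)))"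
    by simp
  also have "\<dots> = - (\<Sum>i\<le>2. a i * integral {0..1} (\<lambda>t. t ^ i * f t))"
  proof -
    have "(\<lambda>t. t ^ i * f t) integrable_on {0..1}" if "i \<le> 2" for i :: nat
      using polf_integrable_on[OF polf_mult[OF pw[OF that] f]] by simp
    then have "integral {0..1} (\<lambda>t. \<Sum>i\<le>2. a i * (t ^ i * f t)) = (\<Sum>i\<le>2. integral {0..1} (\<lambda>t. a i * (t ^ i * f t)))"
      by (intro integral_sum integrable_on_mult_right) auto
    then show ?thesis by simp
  qed
  also have "\<dots> = 0" by (simp add: mom)
  finally have 0: "integral {0..1} (\<lambda>t. t * (1 - t) * (f2 t * f2 t)) = 0" .
  have "polf (1 + 1 + (2 + 2)) (\<lambda>t. t * (1 + - t) * (f2 t * f2 t))"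
    by (intro polf_mult polf_affine polf_linear lin f2)
  then have "polf 6 (\<lambda>t. t * (1 - t) * (f2 t * f2 t))" by simp
  then have "t * (1 - t) * (f2 t * f2 t) = 0"
    by (rule polf_integral_eq_0[OF _ compact_Icc _ _ 0]) (auto simp: interior_atLeastAtMost_real)
  then show ?thesis by (auto simp: f1 f2)
qed

section \<open>Quartics on the reference triangle\<close>

definition std_triangle :: "(real \<times> real) set" where
  "std_triangle = {(u, w). 0 \<le> u \<and> 0 \<le> w \<and> u + w \<le> 1}"

lemma compact_std_triangle: "compact std_triangle"
proof -
  have eq: "std_triangle = ({z. 0 \<le> fst z} \<inter> {z. 0 \<le> snd z} \<inter> {z. fst z + snd z \<le> 1}) \<inter> cbox (0, 0) (1, 1)"
    by (auto simp: std_triangle_def mem_box Basis_prod_def)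
  have "closed ({z::real\<times>real. 0 \<le> fst z} \<inter> {z. 0 \<le> snd z} \<inter> {z. fst z + snd z \<le> 1})"
    by (intro closed_Int closed_Collect_le continuous_intros)
  then show ?thesis unfolding eq by (rule closed_Int_compact[OF _ compact_cbox])
qed

lemma interior_std_triangle: "interior std_triangle \<noteq> {}"
proof -
  have "open ({z::real\<times>real. 0 < fst z} \<inter> {z. 0 < snd z} \<inter> {z. fst z + snd z < 1})"
    by (intro open_Int open_Collect_less continuous_intros)
  then have "{z::real\<times>real. 0 < fst z} \<inter> {z. 0 < snd z} \<inter> {z. fst z + snd z < 1} \<subseteq> interior std_triangle"
    by (intro interior_maximal) (auto simp: std_triangle_def)
  moreover have "(1/4, 1/4) \<in> {z::real\<times>real. 0 < fst z} \<inter> {z. 0 < snd z} \<inter> {z. fst z + snd z < 1}" by simp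
  ultimately show ?thesis by blast
qed

lemma polf_line_interval_zeros:
  assumes "polf k f" "\<And>t. 0 < t \<Longrightarrow> t < 1 \<Longrightarrow> f (a + t *\<^sub>R b) = 0"
  shows "f (a + t *\<^sub>R b) = 0"
proof (rule polf_line_infinite_zeros[OF assms(1)])
  have "{0<..<1} \<subseteq> {t. f (a + t *\<^sub>R b) = 0}" using assms(2) by auto
  then show "infinite {t. f (a + t *\<^sub>R b) = 0}" by (meson infinite_Ioo infinite_super zero_less_one)
qed

text \<open>Dividing out the three edge lines leaves an affine factor \<open>f3\<close>; the moments
  allow \<open>f\<close> to be tested with it, which gives a square with a nonnegative weight. Zeros
  are used on the open edges, where the factors already removed are nonzero.\<close>

lemma polf_triangle_eq_0:
  fixes f :: "real \<times> real \<Rightarrow> real"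
  assumes f: "polf 4 f"
    and edges: "\<And>t. 0 < t \<Longrightarrow> t < 1 \<Longrightarrow> f (t, 0) = 0" "\<And>t. 0 < t \<Longrightarrow> t < 1 \<Longrightarrow> f (0, t) = 0"
      "\<And>t. 0 < t \<Longrightarrow> t < 1 \<Longrightarrow> f (1 - t, t) = 0"
    and mom: "\<And>p q. p + q \<le> 1 \<Longrightarrow> integral std_triangle (\<lambda>(u, w). u ^ p * w ^ q * f (u, w)) = 0"
  shows "f z = 0"
proof -
  have lin: "linear (fst :: real \<times> real \<Rightarrow> real)" "linear (snd :: real \<times> real \<Rightarrow> real)"
    "linear (\<lambda>z::real \<times> real. fst z + snd z)" "linear (\<lambda>z::real \<times> real. - (fst z + snd z))"
    by (simp_all add: linear_iff algebra_simps)
  obtain f1 where f1: "polf 3 f1" "\<And>z. f z = fst z * f1 z"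
  proof -
    have "f z = 0" if "0 + fst z = 0" for z
      using polf_line_interval_zeros[OF f, of "(0, 0)" "(0, 1)" "snd z"] edges(2) that by (cases z) simp
    moreover have "polf (Suc 3) f" using f by simp
    ultimately show ?thesis using polf_divide_affine[OF _ lin(1), of 3 f "(1, 0)" 0] that by auto
  qed
  obtain f2 where f2: "polf 2 f2" "\<And>z. f1 z = snd z * f2 z"
  proof -
    have "f1 z = 0" if "0 + snd z = 0" for z
    proof -
      have "f1 (t, 0) = 0" if "0 < t" "t < 1" for t using edges(1)[OF that] f1(2)[of "(t, 0)"] that by simp
      then show ?thesis
        using polf_line_interval_zeros[OF f1(1), of "(0, 0)" "(1, 0)" "fst z"] that by (cases z) simp
    qed
    moreover have "polf (Suc 2) f1" using f1(1) by (simp add: eval_nat_numeral)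
    ultimately show ?thesis using polf_divide_affine[OF _ lin(2), of 2 f1 "(0, 1)" 0] that by auto
  qed
  obtain f3 where f3: "polf 1 f3" "\<And>z. f2 z = (- 1 + (fst z + snd z)) * f3 z"
  proof -
    have "f2 z = 0" if "- 1 + (fst z + snd z) = 0" for z
    proof -
      have "f2 (1 - t, t) = 0" if "0 < t" "t < 1" for t
        using edges(3)[OF that] f1(2)[of "(1 - t, t)"] f2(2)[of "(1 - t, t)"] that by simp
      moreover have "z = (1, 0) + snd z *\<^sub>R (-1, 1)" using that by (cases z) simp
      ultimately show ?thesis
        using polf_line_interval_zeros[OF f2(1), of "(1, 0)" "(-1, 1)" "snd z"] by simp
    qed
    moreover have "polf (Suc 1) f2" using f2(1) by (simp add: eval_nat_numeral)
    ultimately show ?thesis using polf_divide_affine[OF _ lin(3), of 1 f2 "(1, 0)" "- 1"] that by auto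
  qed
  obtain b l where l: "linear l" "f3 = (\<lambda>z. b + l z)" using polf_1_affine[OF f3(1)] by auto
  have f3': "f3 z = b + fst z * l (1, 0) + snd z * l (0, 1)" for z
  proof -
    have "z = fst z *\<^sub>R (1, 0) + snd z *\<^sub>R (0, 1)" by (cases z) simp
    from arg_cong[OF this, of l] have "l z = l (fst z *\<^sub>R (1, 0) + snd z *\<^sub>R (0, 1))" .
    also have "\<dots> = fst z * l (1, 0) + snd z * l (0, 1)"
      by (simp only: linear_add[OF l(1)] linear_scale[OF l(1)] real_scaleR_def)
    finally show ?thesis by (simp add: l(2))
  qed
  have m: "integral std_triangle f = 0" "integral std_triangle (\<lambda>z. fst z * f z) = 0"
     "integral std_triangle (\<lambda>z. snd z * f z) = 0"
    using mom[of 0 0] mom[of 1 0] mom[of 0 1] by (simp_all add: case_prod_unfold)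
  have int: "f integrable_on std_triangle" "(\<lambda>z. fst z * f z) integrable_on std_triangle"
     "(\<lambda>z. snd z * f z) integrable_on std_triangle"
    using polf_integrable_on[OF f compact_std_triangle]
      polf_integrable_on[OF polf_mult[OF polf_linear[OF lin(1)] f] compact_std_triangle]
      polf_integrable_on[OF polf_mult[OF polf_linear[OF lin(2)] f] compact_std_triangle] by auto
  have eq: "fst z * snd z * (1 + - (fst z + snd z)) * (f3 z * f3 z) =
      (- b) * f z + ((- l (1, 0)) * (fst z * f z) + (- l (0, 1)) * (snd z * f z))" for z
  proof -
    have "fst z * snd z * (1 + - (fst z + snd z)) * (f3 z * f3 z) = - (f z * f3 z)"
      by (simp add: f1 f2 f3(2) algebra_simps)
    then show ?thesis by (simp add: f3'[of z] algebra_simps)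
  qed
  have 0: "integral std_triangle (\<lambda>z. fst z * snd z * (1 + - (fst z + snd z)) * (f3 z * f3 z)) = 0"
    unfolding eq integral_add[OF integrable_on_mult_right[OF int(1)]
        integrable_add[OF integrable_on_mult_right[OF int(2)] integrable_on_mult_right[OF int(3)]]]
      integral_add[OF integrable_on_mult_right[OF int(2)] integrable_on_mult_right[OF int(3)]]
      integral_mult_right m by simp
  have "polf (1 + 1 + 1 + (1 + 1)) (\<lambda>z. fst z * snd z * (1 + - (fst z + snd z)) * (f3 z * f3 z))"
    by (intro polf_mult polf_affine polf_linear lin f3)
  then have "fst z * snd z * (1 + - (fst z + snd z)) * (f3 z * f3 z) = 0"
    by (rule polf_integral_eq_0[OF _ compact_std_triangle interior_std_triangle _ 0])
      (auto simp: std_triangle_def)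
  then show ?thesis by (auto simp: f1 f2 f3(2))
qed

section \<open>Normal components on edges and faces\<close>

lemma edge_frame_orthogonal_span:
  assumes "edge_frame a b s nm np" "w \<bullet> (b - a) = 0"
  shows "w \<in> span {nm, np}"
proof -
  let ?P = "{x. (b - a) \<bullet> x = 0}"
  have ba: "b - a \<noteq> 0" using assms(1) unfolding edge_frame_def by force
  have sub: "{nm, np} \<subseteq> ?P" using assms(1) by (auto simp: edge_frame_def inner_commute)
  have "?P \<subseteq> span {nm, np}"
  proof (rule card_ge_dim_independent[OF sub])
    show "independent {nm, np}" "dim ?P \<le> card {nm, np}"
      using assms(1) by (auto simp: edge_frame_def dim_hyperplane[OF ba])
  qed
  then show ?thesis using assms(2) by (auto simp: inner_commute)
qed

text \<open>Up to symmetry, the five quantities are all entries of \<open>Q\<close> in the frame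
  except \<open>s' Q s\<close>. Hence \<open>Q nm\<close> and \<open>Q np\<close> are orthogonal to
  all three frame vectors, and a normal \<open>w\<close> is a combination of \<open>nm\<close> and
  \<open>np\<close>.\<close>

lemma edge_frame_sym_eq_0:
  assumes fr: "edge_frame a b s nm np" and Q: "Q \<in> sym_matrices"
    and z: "s \<bullet> (Q *v nm) = 0" "s \<bullet> (Q *v np) = 0" "nm \<bullet> (Q *v nm) = 0" "np \<bullet> (Q *v np) = 0" "nm \<bullet> (Q *v np) = 0"
    and w: "w \<bullet> (b - a) = 0"
  shows "Q *v w = 0"
proof -
  have z': "np \<bullet> (Q *v nm) = 0"
    using z(5) sym_matrices_inner[OF Q, of np nm] by (simp add: inner_commute)
  obtain r where r: "s = r *\<^sub>R (b - a)" "r \<noteq> 0" using fr unfolding edge_frame_def by force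
  have ker: "y = 0" if "s \<bullet> y = 0" "nm \<bullet> y = 0" "np \<bullet> y = 0" for y
  proof -
    have "y \<in> span {nm, np}"
      by (rule edge_frame_orthogonal_span[OF fr]) (use that(1) r in \<open>simp add: inner_commute\<close>)
    moreover have "span {nm, np} \<subseteq> {x. y \<bullet> x = 0}"
      using that by (intro span_minimal subspace_hyperplane) (auto simp: inner_commute)
    ultimately have "y \<bullet> y = 0" by blast
    then show ?thesis by simp
  qed
  have "Q *v nm = 0" "Q *v np = 0" using ker z z' by auto
  moreover have "subspace {x. Q *v x = 0}"
    by (auto simp: subspace_def matrix_vector_right_distrib matrix_vector_mult_scaleR)
  ultimately have "span {nm, np} \<subseteq> {x. Q *v x = 0}" by (intro span_minimal) auto
  then show ?thesis using edge_frame_orthogonal_span[OF fr w] by blast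
qed

text \<open>Pulling the test vectors out of the integral leaves one moment matrix per order, so that
  conditions on a frame transfer to every vector normal to the edge.\<close>

lemma integral_edge_matrix:
  fixes G :: "real \<Rightarrow> real^3^3"
  assumes "continuous_on {0..1} G"
  shows "integral {0..1} (\<lambda>t. t ^ k * (x \<bullet> (G t *v y))) = x \<bullet> (integral {0..1} (\<lambda>t. t ^ k *\<^sub>R G t) *v y)"
proof -
  have "linear (\<lambda>A::real^3^3. x \<bullet> (A *v y))"
    by (simp add: linear_iff matrix_vector_mult_add_rdistrib inner_add_right flip: scaleR_matrix_vector_assoc)
  moreover have "(\<lambda>t. t ^ k *\<^sub>R G t) integrable_on {0..1}"
    using assms by (intro continuous_on_compact_integrable_on compact_Icc continuous_intros)
  ultimately have "integral {0..1} ((\<lambda>A. x \<bullet> (A *v y)) \<circ> (\<lambda>t. t ^ k *\<^sub>R G t)) =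
      x \<bullet> (integral {0..1} (\<lambda>t. t ^ k *\<^sub>R G t) *v y)"
    by (intro integral_linear) (simp_all add: linear_conv_bounded_linear)
  then show ?thesis by (simp add: o_def flip: scaleR_matrix_vector_assoc)
qed

text \<open>The moment matrices annihilate \<open>w\<close> by \<open>edge_frame_sym_eq_0\<close>,
  so each component of \<open>T w\<close> is a quartic on the edge with zero end values and zero
  moments up to order 2.\<close>

lemma edge_vanishing:
  assumes T: "T \<in> polys 4 sym_matrices" and fr: "edge_frame a b s nm np" and ends: "T a = 0" "T b = 0"
    and mom: "\<And>k x y. k \<le> 2 \<Longrightarrow> (x, y) \<in> {(s, nm), (s, np), (nm, nm), (np, np), (nm, np)} \<Longrightarrow>
      edge_moment a b k (\<lambda>z. x \<bullet> (T z *v y)) = 0"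
    and w: "w \<bullet> (b - a) = 0"
  shows "T (a + t *\<^sub>R (b - a)) *v w = 0"
proof -
  have ba: "norm (b - a) \<noteq> 0" using fr unfolding edge_frame_def by force
  let ?G = "\<lambda>t. T (a + t *\<^sub>R (b - a))"
  have cG: "continuous_on {0..1} ?G"
    by (rule continuous_on_compose2[OF polys_continuous_on[OF T, of UNIV]]) (auto intro!: continuous_intros)
  have Tsym: "T x \<in> sym_matrices" for x using T by (simp add: polys_mat_iff)
  define Q where "Q k = integral {0..1} (\<lambda>t. t ^ k *\<^sub>R ?G t)" for k :: nat
  have Q: "x \<bullet> (Q k *v y) = integral {0..1} (\<lambda>t. t ^ k * (x \<bullet> (?G t *v y)))" for x y k
    unfolding Q_def by (rule integral_edge_matrix[OF cG, symmetric])
  have Qsym: "Q k \<in> sym_matrices" for k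
  proof (rule sym_matricesI)
    fix i j
    have "axis i 1 \<bullet> (Q k *v axis j 1) = axis j 1 \<bullet> (Q k *v axis i 1)"
      unfolding Q using sym_matrices_inner[OF Tsym] by (simp add: inner_commute)
    then show "Q k $ i $ j = Q k $ j $ i"
      by (simp add: inner_axis' matrix_vector_mult_basis column_def)
  qed
  have "Q k *v w = 0" if "k \<le> 2" for k
  proof -
    have "x \<bullet> (Q k *v y) = 0" if "(x, y) \<in> {(s, nm), (s, np), (nm, nm), (np, np), (nm, np)}" for x y
      using mom[OF \<open>k \<le> 2\<close> that] ba by (simp add: edge_moment_def Q)
    then show ?thesis by (intro edge_frame_sym_eq_0[OF fr Qsym _ _ _ _ _ w]) auto
  qed
  then have Qw: "integral {0..1} (\<lambda>t. t ^ k * (axis i 1 \<bullet> (?G t *v w))) = 0" if "k \<le> 2" for k i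
    using Q[of "axis i 1" k w] that by simp
  have "(?G t *v w) $ i = 0" for i
  proof -
    have "polf 4 (\<lambda>x. (T x *v w) $ i)" using T by (intro polf_mat_vec) (simp add: polys_mat_iff)
    from polf_compose_affine[OF this, of "\<lambda>t. t *\<^sub>R (b - a)" a]
    have "polf 4 (\<lambda>t. (?G t *v w) $ i)" by (simp add: linear_iff scaleR_add_left)
    then show ?thesis
      by (rule polf_1d_eq_0) (use ends Qw in \<open>simp_all add: inner_axis'\<close>)
  qed
  then show ?thesis by (simp add: vec_eq_iff)
qed

context tetrahedron
begin

text \<open>This is the area factor of \<open>face_moment\<close>, which has to be cancelled;
  proportional edge vectors would contradict the values of the gradients on them.\<close>

lemma cross3_tv_nonzero:
  assumes "i \<noteq> j" "i \<noteq> k" "j \<noteq> k" shows "cross3 (tv i j) (tv i k) \<noteq> 0"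
proof
  assume "cross3 (tv i j) (tv i k) = 0"
  then have "collinear {0, tv i j, tv i k}" by (simp add: cross_eq_0)
  then consider "tv i j = 0" | "tv i k = 0" | r where "tv i k = r *\<^sub>R tv i j"
    unfolding collinear_lemma by blast
  then show False
  proof cases
    case 1 then show ?thesis using g_tv[of j i j] assms by simp
  next
    case 2 then show ?thesis using g_tv[of k i k] assms by simp
  next
    case 3 then show ?thesis using g_tv[of k i k] g_tv[of k i j] assms by simp
  qed
qed

text \<open>The normal \<open>g l\<close> is orthogonal to the three edges of the face, so
  \<open>T g l\<close> vanishes on them; in triangle coordinates each of its components is a quartic
  as in \<open>polf_triangle_eq_0\<close>.\<close>

lemma face_vanishing:
  assumes T: "T \<in> polys 4 sym_matrices" and ijk: "i \<noteq> j" "i \<noteq> k" "j \<noteq> k" "l \<notin> {i, j, k}"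
    and n: "face_unit_normal (v i) (v j) (v k) n"
    and edge: "\<And>p q t w. (p, q) \<in> {(i, j), (i, k), (j, k)} \<Longrightarrow> w \<bullet> tv p q = 0 \<Longrightarrow>
      T (v p + t *\<^sub>R tv p q) *v w = 0"
    and mom: "\<And>p q. p + q \<le> 1 \<Longrightarrow> face_moment (v i) (v j) (v k) p q (\<lambda>x. T x *v n) = 0"
    and x: "lam l x = 0"
  shows "T x *v g l = 0"
proof -
  have "card {i, j, k, l} = CARD(4)" using ijk by auto
  then have un: "{i, j, k, l} = UNIV" by (intro card_subset_eq) auto
  have all4: "m = i \<or> m = j \<or> m = k \<or> m = l" for m using un by blast
  have "n \<bullet> v p = n \<bullet> v i" if "p \<noteq> l" for p
    using all4[of p] that n by (auto simp: face_unit_normal_def inner_diff_right)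
  then have "n \<bullet> v p = n \<bullet> v q" if "p \<noteq> l" "q \<noteq> l" for p q using that by simp
  then obtain r where r: "n = r *\<^sub>R g l" using orthogonal_to_face by blast
  have r0: "r \<noteq> 0" using n r by (auto simp: face_unit_normal_def)
  define X where "X z = v i + fst z *\<^sub>R tv i j + snd z *\<^sub>R tv i k" for z :: "real \<times> real"
  have perp: "g l \<bullet> tv p q = 0" if "(p, q) \<in> {(i, j), (i, k), (j, k)}" for p q
    using that ijk by (auto simp: g_tv)
  have "(T (X z) *v g l) $ m = 0" for z m
  proof -
    define f where "f z = (T (X z) *v g l) $ m" for z
    have "polf 4 (\<lambda>x. (T x *v g l) $ m)" using T by (intro polf_mat_vec) (simp add: polys_mat_iff)
    from polf_compose_affine[OF this, of "\<lambda>z::real\<times>real. fst z *\<^sub>R tv i j + snd z *\<^sub>R tv i k" "v i"]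
    have pf: "polf 4 f" by (simp add: f_def[abs_def] X_def linear_iff algebra_simps)
    have "f z = 0"
    proof (rule polf_triangle_eq_0[OF pf])
      fix t :: real
      show "f (t, 0) = 0" "f (0, t) = 0"
        using edge[of i j "g l" t] edge[of i k "g l" t] perp by (simp_all add: f_def X_def)
      have "X (1 - t, t) = v j + t *\<^sub>R tv j k" by (simp add: X_def tv_def algebra_simps)
      then show "f (1 - t, t) = 0" using edge[of j k "g l" t] perp by (simp add: f_def)
    next
      fix p q :: nat assume pq: "p + q \<le> 1"
      let ?H = "\<lambda>z. (fst z ^ p * snd z ^ q) *\<^sub>R (T (X z) *v n)"
      have cT: "continuous_on UNIV T" by (rule polys_continuous_on[OF T])
      have "continuous_on std_triangle (\<lambda>z. T (X z))"
        unfolding X_def by (rule continuous_on_compose2[OF cT]) (auto intro!: continuous_intros)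
      moreover have "bounded_linear (\<lambda>A::real^3^3. A *v n)"
        unfolding linear_conv_bounded_linear[symmetric]
        by (simp add: linear_iff matrix_vector_mult_add_rdistrib flip: scaleR_matrix_vector_assoc)
      ultimately have "continuous_on std_triangle (\<lambda>z. T (X z) *v n)"
        using bounded_linear.continuous_on by blast
      then have int: "?H integrable_on std_triangle"
        by (intro continuous_on_compact_integrable_on compact_std_triangle continuous_intros)
      have "integral std_triangle ?H = 0"
        using mom[OF pq] cross3_tv_nonzero[OF ijk(1-3)]
        by (simp add: face_moment_def std_triangle_def case_prod_unfold X_def tv_def)
      moreover have "integral std_triangle (\<lambda>z. ?H z $ m) = integral std_triangle ?H $ m"
        using integral_linear[OF int bounded_linear_vec_nth[of m]] by (simp add: o_def)
      ultimately have "integral std_triangle (\<lambda>z. r * (fst z ^ p * snd z ^ q * f z)) = 0"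
        by (simp add: r matrix_vector_mult_scaleR f_def mult_ac)
      then show "integral std_triangle (\<lambda>(u, w). u ^ p * w ^ q * f (u, w)) = 0"
        using r0 by (simp add: case_prod_unfold)
    qed
    then show ?thesis by (simp add: f_def)
  qed
  \<comment> \<open>On the plane \<open>lam l = 0\<close> two coordinates determine the point,
    because the third is fixed by the sum.\<close>
  moreover have "x = X (lam j x, lam k x)"
  proof -
    have U: "(UNIV :: 4 set) = {i, j, k, l}" using un by simp
    have s: "lam i x = 1 - lam j x - lam k x"
      using sum_lam[of x] x ijk unfolding U by auto
    have "x = lam i x *\<^sub>R v i + lam j x *\<^sub>R v j + lam k x *\<^sub>R v k"
      using sum_lam_v[of x] x ijk unfolding U by (auto simp: add.assoc)
    then show ?thesis unfolding s by (simp add: X_def tv_def algebra_simps)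
  qed
  ultimately have "(T x *v g l) $ m = 0" for m by metis
  then show ?thesis by (simp add: vec_eq_iff)
qed

end

section \<open>Counting degrees of freedom\<close>

text \<open>Attaching the functionals to distinct basis vectors of the same space produces a linear
  self-map \<open>G\<close>; the trivial common kernel makes it injective, hence surjective.\<close>

lemma linear_functionals_surjective:
  fixes \<phi> :: "'j \<Rightarrow> 'a::euclidean_space \<Rightarrow> real"
  assumes J: "finite J" "card J \<le> DIM('a)" and lin: "\<And>j. j \<in> J \<Longrightarrow> linear (\<phi> j)"
    and ker: "\<And>x. (\<And>j. j \<in> J \<Longrightarrow> \<phi> j x = 0) \<Longrightarrow> x = 0"
  shows "\<exists>x. \<forall>j\<in>J. \<phi> j x = y j"
proof -
  obtain f :: "'j \<Rightarrow> 'a" where f: "f ` J \<subseteq> Basis" "inj_on f J"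
    using card_le_inj[OF J(1) finite_Basis J(2)] by blast
  define G where "G x = (\<Sum>j\<in>J. \<phi> j x *\<^sub>R f j)" for x
  have coef: "(\<Sum>j\<in>J. a j *\<^sub>R f j) \<bullet> f k = a k" if "k \<in> J" for a :: "'j \<Rightarrow> real" and k
  proof -
    have "(\<Sum>j\<in>J. a j *\<^sub>R f j) \<bullet> f k = (\<Sum>j\<in>J. if j = k then a j else 0)"
      unfolding inner_sum_left
    proof (rule sum.cong)
      fix j assume "j \<in> J"
      then have "f j \<in> Basis" "f k \<in> Basis" "f j = f k \<longleftrightarrow> j = k"
        using f that by (auto simp: inj_on_eq_iff)
      then have "f j \<bullet> f k = (if j = k then 1 else 0)" by (simp add: inner_Basis)
      then show "(a j *\<^sub>R f j) \<bullet> f k = (if j = k then a j else 0)" by simp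
    qed simp
    then show ?thesis using J(1) that by simp
  qed
  have "linear G"
    by (rule linearI) (simp_all add: G_def linear_add[OF lin] linear_scale[OF lin] scaleR_add_left
      sum.distrib scaleR_sum_right)
  moreover have "x = 0" if "G x = 0" for x
    by (rule ker) (use coef[of _ "\<lambda>j. \<phi> j x"] that in \<open>auto simp: G_def\<close>)
  ultimately have "surj G"
    by (intro linear_injective_imp_surjective) (auto simp: linear_injective_0)
  then obtain x where x: "G x = (\<Sum>j\<in>J. y j *\<^sub>R f j)" by (metis surjD)
  have "\<phi> j x = y j" if "j \<in> J" for j
    using coef[OF that, of "\<lambda>j. \<phi> j x"] coef[OF that, of y] x by (simp add: G_def)
  then show ?thesis by blast
qed

lemma sum_field_apply: "(\<Sum>z\<in>S. f z) x = (\<Sum>z\<in>S. (f z :: 'a \<Rightarrow> 'b::comm_monoid_add) x)"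
  by (induction S rule: infinite_finite_induct) auto

text \<open>An increasing triple is determined by its underlying set, and a set of four has
  \<open>4 choose 3\<close> subsets of size three.\<close>

lemma card_increasing_triples: "card {(i :: 4, j, k). i < j \<and> j < k} \<le> 4"
proof -
  let ?T = "{(i :: 4, j, k). i < j \<and> j < k}"
  let ?f = "\<lambda>(i, j, k). {i, j, k :: 4}"
  have "inj_on ?f ?T"
  proof (rule inj_onI)
    fix x y assume *: "x \<in> ?T" "y \<in> ?T" "?f x = ?f y"
    obtain i j k i' j' k' where xy: "x = (i, j, k)" "y = (i', j', k')" by (metis prod_cases3)
    have "[i, j, k] = [i', j', k']"
      using * by (intro sorted_distinct_set_unique) (auto simp: xy intro: less_imp_le less_trans)
    then show "x = y" by (simp add: xy)
  qed
  then have "card ?T = card (?f ` ?T)" by (simp add: card_image)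
  also have "\<dots> \<le> card {S. S \<subseteq> (UNIV :: 4 set) \<and> card S = 3}"
    by (rule card_mono) (auto simp: card_insert_if)
  also have "\<dots> = CARD(4) choose 3" by (rule n_subsets) simp
  also have "\<dots> = 4" by (simp add: numeral_eq_Suc)
  finally show ?thesis .
qed

text \<open>Normals and moments of faces are indexed by increasing triples; this puts the vertices
  of the face opposite \<open>v l\<close> in that order.\<close>

lemma increasing_triple_avoiding:
  fixes l :: 4
  shows "\<exists>i j k. i < j \<and> j < k \<and> l \<notin> {i, j, k}"
proof -
  have "card (UNIV - {l}) = 3" by simp
  then obtain a b c where abc: "UNIV - {l} = {a, b, c}" "a \<noteq> b" "b \<noteq> c" "a \<noteq> c"
    unfolding card_3_iff by blast
  then have l: "l \<notin> {a, b, c}" by auto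
  have *: ?thesis if "x < y" "y < z" "x \<in> {a, b, c}" "y \<in> {a, b, c}" "z \<in> {a, b, c}" for x y z
    using that l by (intro exI[of _ x] exI[of _ y] exI[of _ z]) auto
  consider "a < b" "b < c" | "a < c" "c < b" | "b < a" "a < c" | "b < c" "c < a" | "c < a" "a < b" | "c < b" "b < a"
    using abc(2-4) by (meson linorder_neqE)
  then show ?thesis by cases (erule (1) *; simp)+
qed

lemma card_le_pairs_3: "card {(a :: 3, b). a \<le> b} = 6"
proof -
  have "{(a :: 3, b). a \<le> b} = {(a, b). a < b} \<union> range (\<lambda>a. (a, a))" by auto
  moreover have "card (range (\<lambda>a::3. (a, a))) = 3" by (subst card_image) (auto simp: inj_on_def)
  moreover have "card {(a :: 3, b). a < b} = 3" using card_less_pairs[where 'a = 3] by simp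
  moreover have "card ({(a :: 3, b). a < b} \<union> range (\<lambda>a. (a, a))) = card {(a :: 3, b). a < b} + card (range (\<lambda>a::3. (a, a)))"
    by (rule card_Un_disjoint) auto
  ultimately show ?thesis by simp
qed

lemma sym_matrices_eqI:
  assumes "A \<in> sym_matrices" "B \<in> sym_matrices" "\<And>a b. a \<le> b \<Longrightarrow> A $ a $ b = B $ a $ b"
  shows "A = B"
proof -
  have "A $ a $ b = B $ a $ b" for a b
    using assms(3)[of a b] assms(3)[of b a] sym_matrices_nth[OF assms(1), of a b]
      sym_matrices_nth[OF assms(2), of a b] by (cases "a \<le> b") auto
  then show ?thesis by (simp add: vec_eq_iff)
qed

section \<open>Coordinates on quartic fields and the list of functionals\<close>

abbreviation P4 :: "(real^3 \<Rightarrow> real^3^3) set" where "P4 \<equiv> polys 4 sym_matrices"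

lemma sym_matrices_combination: "A \<in> sym_matrices \<Longrightarrow> B \<in> sym_matrices \<Longrightarrow> A + r *\<^sub>R B \<in> sym_matrices"
  using sym_matrices_nth[of A] sym_matrices_nth[of B]
  by (intro sym_matricesI) (simp only: vector_add_component vector_scaleR_component)

lemma P4_combination: "S \<in> P4 \<Longrightarrow> T \<in> P4 \<Longrightarrow> (\<lambda>x. S x + r *\<^sub>R T x) \<in> P4"
  unfolding polys_mat_iff by (auto intro!: polf.add polf_cmult sym_matrices_combination)

text \<open>35 monomials times 6 upper entries make 210 coordinates, which carries the dimension
  count over to a Euclidean space.\<close>

lemma P4_parametrization:
  obtains \<Xi> :: "real^210 \<Rightarrow> real^3 \<Rightarrow> real^3^3"
  where "\<And>c. \<Xi> c \<in> P4" "\<And>c d r. \<Xi> (c + r *\<^sub>R d) = (\<lambda>x. \<Xi> c x + r *\<^sub>R \<Xi> d x)"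
    "\<And>c. \<Xi> c = (\<lambda>_. 0) \<Longrightarrow> c = 0"
proof -
  let ?I = "expo 4 \<times> {(a :: 3, b). a \<le> b}"
  have fin: "finite ?I" by simp
  have "card ?I = CARD(210)" by (simp only: card_cartesian_product card_expo_numeral card_le_pairs_3) simp
  from finite_bij_to_type[OF fin this] obtain h :: "(3 \<Rightarrow> nat) \<times> (3 \<times> 3) \<Rightarrow> 210" and r where
    h: "\<forall>p\<in>?I. r (h p) = p" and r: "\<forall>n. r n \<in> ?I" "\<forall>n. h (r n) = n" by blast
  \<comment> \<open>\<open>min\<close> and \<open>max\<close> send both positions of an off-diagonal
    pair to one coordinate, which forces symmetry.\<close>
  define \<Xi> :: "real^210 \<Rightarrow> real^3 \<Rightarrow> real^3^3" where
    "\<Xi> c x = (\<chi> a b. \<Sum>\<alpha>\<in>expo 4. xmonom \<alpha> x * c $ h (\<alpha>, (min a b, max a b)))" for c x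
  show ?thesis
  proof (rule that[of \<Xi>])
    show "\<Xi> c \<in> P4" for c
      unfolding polys_mat_iff
      by (auto simp: \<Xi>_def polf_xmonom_sum min.commute max.commute intro!: sym_matricesI)
    show "\<Xi> (c + s *\<^sub>R d) = (\<lambda>x. \<Xi> c x + s *\<^sub>R \<Xi> d x)" for c d s
      by (simp add: \<Xi>_def fun_eq_iff vec_eq_iff distrib_left sum.distrib sum_distrib_left mult_ac)
    fix c assume 0: "\<Xi> c = (\<lambda>_. 0)"
    have "c $ m = 0" for m
    proof -
      obtain \<alpha> a b where m: "r m = (\<alpha>, (a, b))" "\<alpha> \<in> expo 4" "a \<le> b" using r(1)[rule_format, of m] by auto
      have "(\<Sum>\<alpha>\<in>expo 4. xmonom \<alpha> x * c $ h (\<alpha>, (a, b))) = 0" for x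
      proof -
        have "(\<Sum>\<alpha>\<in>expo 4. xmonom \<alpha> x * c $ h (\<alpha>, (a, b))) = \<Xi> c x $ a $ b"
          using m(3) by (simp add: \<Xi>_def min_absorb1 max_absorb2)
        then show ?thesis by (simp add: 0)
      qed
      from monomials_independent[OF this m(2)] have "c $ h (\<alpha>, (a, b)) = 0" .
      then show ?thesis using r(2)[rule_format, of m] m(1) by simp
    qed
    then show "c = 0" by (simp add: vec_eq_iff)
  qed
qed

lemma edge_moment_combination:
  assumes "continuous_on UNIV f" "continuous_on UNIV h"
  shows "edge_moment a b k (\<lambda>x. f x + r * h x) = edge_moment a b k f + r * edge_moment a b k h"
proof -
  have int: "(\<lambda>t. t ^ k * f (a + t *\<^sub>R (b - a))) integrable_on {0..1}" if "continuous_on UNIV f" for f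
    by (intro continuous_on_compact_integrable_on compact_Icc continuous_intros
      continuous_on_compose2[OF that]) auto
  have "integral {0..1} (\<lambda>t. t ^ k * f (a + t *\<^sub>R (b - a)) + r * (t ^ k * h (a + t *\<^sub>R (b - a)))) =
      integral {0..1} (\<lambda>t. t ^ k * f (a + t *\<^sub>R (b - a))) + r * integral {0..1} (\<lambda>t. t ^ k * h (a + t *\<^sub>R (b - a)))"
    using integral_add[OF int[OF assms(1)] integrable_on_mult_right[OF int[OF assms(2)], of r]] by simp
  moreover have "(\<lambda>t. t ^ k * (f (a + t *\<^sub>R (b - a)) + r * h (a + t *\<^sub>R (b - a)))) =
     (\<lambda>t. t ^ k * f (a + t *\<^sub>R (b - a)) + r * (t ^ k * h (a + t *\<^sub>R (b - a))))"
    by (simp add: fun_eq_iff algebra_simps)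
  ultimately show ?thesis by (simp add: edge_moment_def algebra_simps)
qed

lemma face_moment_combination:
  assumes "continuous_on UNIV f" "continuous_on UNIV h"
  shows "face_moment a b c p q (\<lambda>x. f x + r *\<^sub>R h x) = face_moment a b c p q f + r *\<^sub>R face_moment a b c p q h"
proof -
  let ?F = "\<lambda>f z. (fst z ^ p * snd z ^ q) *\<^sub>R (f (a + fst z *\<^sub>R (b - a) + snd z *\<^sub>R (c - a)) :: real^3)"
  have fm: "face_moment a b c p q f = norm (cross3 (b - a) (c - a)) *\<^sub>R integral std_triangle (?F f)" for f
    by (simp add: face_moment_def std_triangle_def case_prod_unfold)
  have int: "?F f integrable_on std_triangle" if "continuous_on UNIV f" for f
    by (intro continuous_on_compact_integrable_on compact_std_triangle continuous_intros
      continuous_on_compose2[OF that]) auto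
  have "integral std_triangle (\<lambda>z. ?F f z + r *\<^sub>R ?F h z) =
      integral std_triangle (?F f) + r *\<^sub>R integral std_triangle (?F h)"
    using integral_add[OF int[OF assms(1)] integrable_cmul[OF int[OF assms(2)], of r]] by (simp only: integral_cmul)
  moreover have "?F (\<lambda>x. f x + r *\<^sub>R h x) = (\<lambda>z. ?F f z + r *\<^sub>R ?F h z)"
    by (simp add: fun_eq_iff scaleR_add_right mult_ac)
  ultimately show ?thesis unfolding fm by (simp add: scaleR_add_right mult.commute)
qed

text \<open>
  The \<open>48\<close> functionals \<open>Div\<close>, the quadratic and cubic coefficients of \<open>div T\<close>, cut
  \<open>Sigma_space\<close> out of \<open>P4\<close>.
\<close>
datatype dof = Vertex 4 3 3 | Edge nat 4 4 nat | Face 4 4 4 nat nat 3 | Avg 3 3 | Mom 6 | Div "3 \<Rightarrow> nat" 3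

definition vertex_dofs :: "dof set" where "vertex_dofs = (\<lambda>(i, (a, b)). Vertex i a b) ` (UNIV \<times> {(a, b). a \<le> b})"
definition edge_dofs :: "dof set" where
  "edge_dofs = (\<lambda>(z, (i, j), k). Edge z i j k) ` ({1..5} \<times> pairs \<times> {..2})"
definition face_dofs :: "dof set" where
  "face_dofs = (\<lambda>((i, j, k), (p, q), a). Face i j k p q a) ` ({(i, j, k). i < j \<and> j < k} \<times> {(0, 0), (1, 0), (0, 1)} \<times> UNIV)"
definition avg_dofs :: "dof set" where "avg_dofs = (\<lambda>(a, b). Avg a b) ` {(a, b). a \<le> b}"
definition mom_dofs :: "dof set" where "mom_dofs = range Mom"
definition div_dofs :: "dof set" where "div_dofs = (\<lambda>(\<alpha>, i). Div \<alpha> i) ` ((expo 3 - expo 1) \<times> UNIV)"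

definition dofs :: "dof set" where
  "dofs = vertex_dofs \<union> (edge_dofs \<union> (face_dofs \<union> (avg_dofs \<union> (mom_dofs \<union> div_dofs))))"

lemma finite_triples: "finite {(i :: 4, j, k). i < j \<and> j < k}"
  by (rule finite_subset[OF subset_UNIV]) simp

lemma finite_dofs: "finite dofs"
  unfolding dofs_def vertex_dofs_def edge_dofs_def face_dofs_def avg_dofs_def mom_dofs_def div_dofs_def
  using finite_triples by auto

text \<open>The bounds add up to the dimension of the quartic fields. An upper bound is what
  \<open>linear_functionals_surjective\<close> asks for, so images are estimated by their index
  sets.\<close>

lemma card_dofs: "card dofs \<le> 210"
proof -
  have "card vertex_dofs \<le> 24"
    unfolding vertex_dofs_def by (rule order_trans[OF card_image_le]) (simp_all add: card_cartesian_product card_le_pairs_3)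
  moreover have "card edge_dofs \<le> 90"
    unfolding edge_dofs_def by (rule order_trans[OF card_image_le]) (simp_all add: card_cartesian_product card_pairs)
  moreover have "card face_dofs \<le> 36"
    unfolding face_dofs_def
    by (rule order_trans[OF card_image_le]) (use card_increasing_triples finite_triples in \<open>simp_all add: card_cartesian_product\<close>)
  moreover have "card avg_dofs \<le> 6"
    unfolding avg_dofs_def by (rule order_trans[OF card_image_le]) (simp_all add: card_le_pairs_3)
  moreover have "card mom_dofs \<le> 6"
    unfolding mom_dofs_def by (rule order_trans[OF card_image_le]) simp_all
  moreover have "card div_dofs \<le> 48"
  proof -
    \<comment> \<open>20 monomials of degree at most 3, less the 4 of degree at most 1.\<close>
    have "card (expo 3 - expo 1) = 16"
      using card_Diff_subset[OF finite_expo expo_mono[of 1 3]] by (simp add: card_expo_numeral del: One_nat_def)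
    then show ?thesis
      unfolding div_dofs_def by (intro order_trans[OF card_image_le]) (simp_all add: card_cartesian_product)
  qed
  moreover have Un: "card (A \<union> B) \<le> a + b" if "card A \<le> a" "card B \<le> b" for A B :: "dof set" and a b
    using card_Un_le[of A B] that by linarith
  ultimately have "card dofs \<le> 24 + (90 + (36 + (6 + (6 + 48))))" 
    unfolding dofs_def by (intro Un)
  then show ?thesis by simp
qed

lemma dofs_memI:
  "a \<le> b \<Longrightarrow> Vertex i a b \<in> dofs"
  "m \<in> {1..5} \<Longrightarrow> i < j \<Longrightarrow> k \<le> 2 \<Longrightarrow> Edge m i j k \<in> dofs"
  "i < j \<Longrightarrow> j < l \<Longrightarrow> p + q \<le> 1 \<Longrightarrow> Face i j l p q a \<in> dofs"
  "a \<le> b \<Longrightarrow> Avg a b \<in> dofs" "Mom z \<in> dofs"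
proof -
  show "a \<le> b \<Longrightarrow> Vertex i a b \<in> dofs"
    unfolding dofs_def vertex_dofs_def by (intro UnI1 image_eqI[where x = "(i, (a, b))"]) auto
  show "m \<in> {1..5} \<Longrightarrow> i < j \<Longrightarrow> k \<le> 2 \<Longrightarrow> Edge m i j k \<in> dofs"
    unfolding dofs_def edge_dofs_def
    by (intro UnI2 UnI1 image_eqI[where x = "(m, (i, j), k)"]) (auto simp: pairs_def)
  show "Face i j l p q a \<in> dofs" if "i < j" "j < l" "p + q \<le> 1"
  proof -
    have "(p, q) \<in> {(0, 0), (1, 0), (0, 1)}" using that(3) by (cases p; cases q) auto
    then show ?thesis
      using that unfolding dofs_def face_dofs_def
      by (intro UnI2 UnI1 image_eqI[where x = "((i, j, l), (p, q), a)"]) auto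
  qed
  show "a \<le> b \<Longrightarrow> Avg a b \<in> dofs"
    unfolding dofs_def avg_dofs_def by (intro UnI2 UnI1 image_eqI[where x = "(a, b)"]) auto
  show "Mom z \<in> dofs" unfolding dofs_def mom_dofs_def by (intro UnI2 UnI1 rangeI)
qed

section \<open>The element and its functionals\<close>

text \<open>The moments in (5) are taken against a family \<open>U\<close> of six fields known to
  span; its independence is derived later from interpolation.\<close>

locale tetrahedral_element = tetrahedron v K c g
  for v :: "4 \<Rightarrow> real^3" and K c g +
  fixes s nm np :: "4 \<Rightarrow> 4 \<Rightarrow> real^3" and n :: "4 \<Rightarrow> 4 \<Rightarrow> 4 \<Rightarrow> real^3" and U :: "6 \<Rightarrow> real^3 \<Rightarrow> real^3^3"
  assumes frame: "i < j \<Longrightarrow> edge_frame (v i) (v j) (s i j) (nm i j) (np i j)"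
    and normal: "i < j \<Longrightarrow> j < k \<Longrightarrow> face_unit_normal (v i) (v j) (v k) (n i j k)"
    and U_M: "U z \<in> M_space K"
    and U_span: "T \<in> M_space K \<Longrightarrow> \<exists>a. T = (\<lambda>x. \<Sum>z\<in>UNIV. a z *\<^sub>R U z x)"
begin

text \<open>
  The degrees of freedom \<open>Edge z i j k\<close> with \<open>z = 1, \<dots>, 5\<close> are the moments of order \<open>k\<close> of
  \<open>s'T nm\<close>, \<open>s'T np\<close>, \<open>nm'T nm\<close>, \<open>np'T np\<close> and \<open>nm'T np\<close>, in this order.
\<close>
definition left_vec :: "nat \<Rightarrow> 4 \<Rightarrow> 4 \<Rightarrow> real^3" where
  "left_vec z i j = (if z = 1 \<or> z = 2 then s i j else if z = 4 then np i j else nm i j)"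

definition right_vec :: "nat \<Rightarrow> 4 \<Rightarrow> 4 \<Rightarrow> real^3" where
  "right_vec z i j = (if z = 1 \<or> z = 3 then nm i j else np i j)"

definition functional :: "dof \<Rightarrow> (real^3 \<Rightarrow> real^3^3) \<Rightarrow> real" where
  "functional d T = (case d of
      Vertex i a b \<Rightarrow> T (v i) $ a $ b
    | Edge z i j k \<Rightarrow> edge_moment (v i) (v j) k (\<lambda>x. left_vec z i j \<bullet> (T x *v right_vec z i j))
    | Face i j k p q a \<Rightarrow> face_moment (v i) (v j) (v k) p q (\<lambda>x. T x *v n i j k) $ a
    | Avg a b \<Rightarrow> average K T $ a $ b
    | Mom z \<Rightarrow> integral K (\<lambda>x. T x \<bullet> U z x)
    | Div \<alpha> i \<Rightarrow> mcoef (\<lambda>x. row_div T x $ i) \<alpha>)"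

lemma P4_integrable: "T \<in> P4 \<Longrightarrow> T integrable_on K"
  by (intro continuous_on_compact_integrable_on compact_K polys_continuous_on)

lemma U_P4: "U z \<in> P4" using U_M by (simp add: M_space_iff)

lemma P4_inner_integrable: "T \<in> P4 \<Longrightarrow> W \<in> P4 \<Longrightarrow> (\<lambda>x. T x \<bullet> W x) integrable_on K"
  by (intro polf_integrable_on[OF polf_field_inner] compact_K)

lemma measure_K_pos: "0 < measure lebesgue K"
proof -
  have "K \<in> lmeasurable" by (rule lmeasurable_compact[OF compact_K])
  moreover have "\<not> negligible K" using interior_K negligible_convex_interior[OF convex_K] by blast
  ultimately show ?thesis
    using negligible_iff_measure0 zero_less_measure_iff by (metis measure_nonneg order_le_less)
qed

text \<open>Linearity is claimed on \<open>P4\<close>, where integrability and differentiability are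
  available.\<close>

lemma functional_combination:
  assumes S: "S \<in> P4" and T: "T \<in> P4"
  shows "functional d (\<lambda>x. S x + r *\<^sub>R T x) = functional d S + r * functional d T"
proof -
  have mv: "(A + r *\<^sub>R B) *v w = A *v w + r *\<^sub>R (B *v w)" for A B :: "real^3^3" and w
    by (simp add: matrix_vector_mult_add_rdistrib flip: scaleR_matrix_vector_assoc)
  have bl: "bounded_linear (\<lambda>A::real^3^3. A *v w)" for w :: "real^3"
    unfolding linear_conv_bounded_linear[symmetric]
    by (simp add: linear_iff matrix_vector_mult_add_rdistrib flip: scaleR_matrix_vector_assoc)
  have cv: "continuous_on UNIV (\<lambda>x. T x *v w)" if "T \<in> P4" for T and w :: "real^3"
    by (rule bounded_linear.continuous_on[OF bl polys_continuous_on[OF that]])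
  have dv: "polf 3 (\<lambda>x. row_div T x $ i)" if "T \<in> P4" for T i
    using that by (intro polf_row_div[where X = sym_matrices]) (simp add: eval_nat_numeral)
  show ?thesis
  proof (cases d)
    case (Vertex i a b)
    then show ?thesis by (simp add: functional_def)
  next
    case (Edge z i j k)
    then show ?thesis
      using edge_moment_combination[of "\<lambda>x. left_vec z i j \<bullet> (S x *v right_vec z i j)"
          "\<lambda>x. left_vec z i j \<bullet> (T x *v right_vec z i j)" "v i" "v j" k r]
      by (simp add: functional_def mv inner_add_right continuous_on_inner continuous_on_const cv S T)
  next
    case (Face i j k p q a)
    then show ?thesis
      using face_moment_combination[OF cv[OF S] cv[OF T]] by (simp add: functional_def mv)
  next
    case (Avg a b)
    have "integral K (\<lambda>x. S x + r *\<^sub>R T x) = integral K S + r *\<^sub>R integral K T"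
      using integral_add[OF P4_integrable[OF S] integrable_cmul[OF P4_integrable[OF T], of r]] by simp
    then show ?thesis using Avg by (simp add: functional_def average_def algebra_simps)
  next
    case (Mom z)
    have "integral K (\<lambda>x. S x \<bullet> U z x + r * (T x \<bullet> U z x)) = integral K (\<lambda>x. S x \<bullet> U z x) + r * integral K (\<lambda>x. T x \<bullet> U z x)"
      using integral_add[OF P4_inner_integrable[OF S U_P4] integrable_on_mult_right[OF P4_inner_integrable[OF T U_P4], of r]] by simp
    then show ?thesis using Mom by (simp add: functional_def inner_add_left)
  next
    case (Div \<alpha> i)
    \<comment> \<open>\<open>r T\<close> is written as \<open>(T - T) + r T\<close> in order to use
      the one closure law.\<close>
    have "(\<lambda>x. r *\<^sub>R T x) \<in> P4" using P4_combination[OF P4_combination[OF T T, of "-1"] T, of r] by simp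
    then have "row_div (\<lambda>x. S x + r *\<^sub>R T x) x $ i = row_div S x $ i + r * row_div T x $ i" for x
      using row_div_add[OF S] row_div_scale[OF T] by simp
    then show ?thesis using Div mcoef_add[OF dv[OF S] polf_cmult[OF dv[OF T]]] mcoef_cmult[OF dv[OF T]]
      by (simp add: functional_def)
  qed
qed

lemma Sigma_iff: "T \<in> Sigma_space \<longleftrightarrow> T \<in> P4 \<and> (\<forall>d\<in>div_dofs. functional d T = 0)"
proof (cases "T \<in> P4")
  case True
  have dv: "polf 3 (\<lambda>x. row_div T x $ i)" for i
    using True by (intro polf_row_div[where X = sym_matrices]) (simp add: eval_nat_numeral)
  have "polf 1 (\<lambda>x. row_div T x $ i) \<longleftrightarrow> (\<forall>\<alpha>\<in>expo 3 - expo 1. mcoef (\<lambda>x. row_div T x $ i) \<alpha> = 0)" for i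
  proof
    assume "polf 1 (\<lambda>x. row_div T x $ i)"
    from represents_mcoef[OF this, unfolded represents_def, THEN conjunct2]
    show "\<forall>\<alpha>\<in>expo 3 - expo 1. mcoef (\<lambda>x. row_div T x $ i) \<alpha> = 0" by blast
  qed (use polf_lower_degree[OF dv] in blast)
  then show ?thesis
    using True by (auto simp: Sigma_space_def polys_vec_iff div_dofs_def functional_def)
qed (simp add: Sigma_space_def)

lemma average_sym:
  assumes T: "T \<in> P4" shows "average K T \<in> sym_matrices"
proof (rule sym_matricesI)
  have Tsym: "T x \<in> sym_matrices" for x using T by (simp add: polys_mat_iff)
  fix i j
  have "integral K (\<lambda>x. T x $ i $ j) = integral K T $ i $ j" for i j
    using integral_linear[OF P4_integrable[OF T] bounded_linear_compose[OF bounded_linear_vec_nth bounded_linear_vec_nth], of i j]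
    by (simp add: o_def)
  from this[of i j] this[of j i] have "integral K T $ i $ j = integral K T $ j $ i"
    using sym_matrices_nth[OF Tsym, of _ i j] by simp
  then show "average K T $ i $ j = average K T $ j $ i" by (simp add: average_def)
qed

lemma integral_inner_combination:
  assumes T: "T \<in> P4"
  shows "integral K (\<lambda>x. T x \<bullet> (\<Sum>z\<in>UNIV. a z *\<^sub>R U z x)) = (\<Sum>z\<in>UNIV. a z * functional (Mom z) T)"
proof -
  have "integral K (\<lambda>x. T x \<bullet> (\<Sum>z\<in>UNIV. a z *\<^sub>R U z x)) = (\<Sum>z\<in>UNIV. integral K (\<lambda>x. a z * (T x \<bullet> U z x)))"
    unfolding inner_sum_right inner_scaleR_right
    by (intro integral_sum integrable_on_mult_right P4_inner_integrable T U_P4) simp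
  then show ?thesis by (simp add: functional_def)
qed

lemma functional_kernel:
  assumes T: "T \<in> P4" and z: "\<And>d. d \<in> dofs \<Longrightarrow> functional d T = 0"
  shows "T = (\<lambda>_. 0)"
proof -
  have Tsym: "T x \<in> sym_matrices" for x using T by (simp add: polys_mat_iff)
  have zero_sym: "(0 :: real^3^3) \<in> sym_matrices" by (simp add: sym_matricesI)
  have vert: "T (v i) = 0" for i
  proof (rule sym_matrices_eqI[OF Tsym zero_sym])
    fix a b :: 3 assume "a \<le> b"
    then have "Vertex i a b \<in> dofs" by (rule dofs_memI)
    from z[OF this] show "T (v i) $ a $ b = 0 $ a $ b" by (simp add: functional_def)
  qed
  have edge: "T (v i + t *\<^sub>R tv i j) *v w = 0" if ij: "i < j" and "w \<bullet> tv i j = 0" for i j t w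
    unfolding tv_def
  proof (rule edge_vanishing[OF T frame[OF ij] vert vert])
    show "w \<bullet> (v j - v i) = 0" using that by (simp add: tv_def)
    fix k :: nat and x y
    assume k: "k \<le> 2" and xy: "(x, y) \<in> {(s i j, nm i j), (s i j, np i j), (nm i j, nm i j), (np i j, np i j), (nm i j, np i j)}"
    have "\<exists>z\<in>{1..5}. x = left_vec z i j \<and> y = right_vec z i j"
    proof -
      have "x = left_vec 1 i j \<and> y = right_vec 1 i j \<or> x = left_vec 2 i j \<and> y = right_vec 2 i j \<or>
        x = left_vec 3 i j \<and> y = right_vec 3 i j \<or> x = left_vec 4 i j \<and> y = right_vec 4 i j \<or>
        x = left_vec 5 i j \<and> y = right_vec 5 i j"
        using xy by (auto simp: left_vec_def right_vec_def)
      then show ?thesis by (auto intro: bexI[of _ 1] bexI[of _ 2] bexI[of _ 3] bexI[of _ 4] bexI[of _ 5])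
    qed
    then obtain m where m: "m \<in> {1..5}" "x = left_vec m i j" "y = right_vec m i j" by blast
    have "Edge m i j k \<in> dofs" using m(1) ij k by (rule dofs_memI)
    from z[OF this] show "edge_moment (v i) (v j) k (\<lambda>z. x \<bullet> (T z *v y)) = 0"
      by (simp add: functional_def m)
  qed
  have face: "T x *v g l = 0" if "lam l x = 0" for l x
  proof -
    obtain i j k where ijk: "i < j" "j < k" "l \<notin> {i, j, k}" using increasing_triple_avoiding by blast
    show ?thesis
    proof (rule face_vanishing[OF T _ _ _ ijk(3) normal[OF ijk(1,2)] _ _ that])
      show "i \<noteq> j" "i \<noteq> k" "j \<noteq> k" using ijk by auto
      show "T (v p + t *\<^sub>R tv p q) *v w = 0" if "(p, q) \<in> {(i, j), (i, k), (j, k)}" "w \<bullet> tv p q = 0" for p q t w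
        using that ijk by (intro edge) auto
      fix p q :: nat assume pq: "p + q \<le> 1"
      have "Face i j k p q a \<in> dofs" for a using ijk(1,2) pq by (rule dofs_memI)
      from z[OF this] show "face_moment (v i) (v j) (v k) p q (\<lambda>x. T x *v n i j k) = 0"
        by (simp add: functional_def vec_eq_iff)
    qed
  qed
  have "integral K T = 0"
  proof -
    have "average K T = 0"
    proof (rule sym_matrices_eqI[OF average_sym[OF T] zero_sym])
      fix a b :: 3 assume "a \<le> b"
      then have "Avg a b \<in> dofs" by (rule dofs_memI)
      from z[OF this] show "average K T $ a $ b = 0 $ a $ b" by (simp add: functional_def)
    qed
    then show ?thesis using measure_K_pos by (simp add: average_def)
  qed
  moreover have "integral K (\<lambda>x. T x \<bullet> W x) = 0" if W: "W \<in> M_space K" for W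
  proof -
    obtain a where a: "W = (\<lambda>x. \<Sum>z\<in>UNIV. a z *\<^sub>R U z x)" using U_span[OF W] by blast
    have "integral K (\<lambda>x. T x \<bullet> W x) = (\<Sum>z\<in>UNIV. a z * functional (Mom z) T)"
      unfolding a by (rule integral_inner_combination[OF T])
    also have "\<dots> = 0"
    proof (rule sum.neutral, rule ballI)
      fix i
      have "Mom i \<in> dofs" by (rule dofs_memI)
      from z[OF this] show "a i * functional (Mom i) T = 0" by simp
    qed
    finally show ?thesis .
  qed
  \<comment> \<open>The \<open>Div\<close> functionals are among those assumed to vanish.\<close>
  moreover have "T \<in> Sigma_space" using T z by (auto simp: Sigma_iff dofs_def)
  ultimately show ?thesis using Sigma_unisolvence[of T] face by blast
qed

text \<open>The values under \<open>Div\<close> are prescribed along with the others; the value 0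
  there selects the fields of \<open>Sigma_space\<close>.\<close>

lemma functional_interpolation: "\<exists>T\<in>P4. \<forall>d\<in>dofs. functional d T = y d"
proof -
  obtain \<Xi> :: "real^210 \<Rightarrow> real^3 \<Rightarrow> real^3^3" where \<Xi>: "\<And>c. \<Xi> c \<in> P4"
    "\<And>c d r. \<Xi> (c + r *\<^sub>R d) = (\<lambda>x. \<Xi> c x + r *\<^sub>R \<Xi> d x)" "\<And>c. \<Xi> c = (\<lambda>_. 0) \<Longrightarrow> c = 0"
    using P4_parametrization by blast
  have comb: "functional d (\<Xi> (a + r *\<^sub>R b)) = functional d (\<Xi> a) + r * functional d (\<Xi> b)" for d a b r
    by (simp only: \<Xi>(2) functional_combination[OF \<Xi>(1) \<Xi>(1)])
  have "\<exists>x. \<forall>d\<in>dofs. functional d (\<Xi> x) = y d"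
  proof (rule linear_functionals_surjective[OF finite_dofs])
    show "card dofs \<le> DIM(real^210)" using card_dofs by simp
    show "linear (\<lambda>x. functional d (\<Xi> x))" for d
    proof (rule linearI)
      fix a b and r :: real
      show "functional d (\<Xi> (a + b)) = functional d (\<Xi> a) + functional d (\<Xi> b)" using comb[of d a 1 b] by simp
      have "functional d (\<Xi> 0) = 0" using comb[of d 0 1 0] by simp
      then show "functional d (\<Xi> (r *\<^sub>R a)) = r *\<^sub>R functional d (\<Xi> a)" using comb[of d 0 r a] by simp
    qed
    show "x = 0" if "\<And>d. d \<in> dofs \<Longrightarrow> functional d (\<Xi> x) = 0" for x
      using functional_kernel[OF \<Xi>(1) that] \<Xi>(3) by blast
  qed
  then show ?thesis using \<Xi>(1) by blast
qed

lemma functional_unique_interpolation: "\<exists>!T. T \<in> P4 \<and> (\<forall>d\<in>dofs. functional d T = y d)"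
proof -
  obtain T where T: "T \<in> P4" "\<forall>d\<in>dofs. functional d T = y d" using functional_interpolation by blast
  have "S = T" if S: "S \<in> P4" "\<forall>d\<in>dofs. functional d S = y d" for S
  proof -
    have "(\<lambda>x. S x + (-1) *\<^sub>R T x) = (\<lambda>_. 0)"
      by (rule functional_kernel[OF P4_combination[OF S(1) T(1)]])
        (simp only: functional_combination[OF S(1) T(1)], use S(2) T(2) in simp)
    then show "S = T" by (simp add: fun_eq_iff)
  qed
  then show ?thesis using T by blast
qed

section \<open>Independence of the moments and the dimension of M(K)\<close>

text \<open>Interpolation provides a field whose moment against \<open>U z\<close> is
  \<open>a z\<close>; integrating it against the vanishing combination gives the sum of the squares
  of the \<open>a z\<close>.\<close>

lemma U_independent:
  assumes "\<And>x. (\<Sum>z\<in>UNIV. a z *\<^sub>R U z x) = 0" shows "a z = 0"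
proof -
  obtain T where T: "T \<in> P4" "\<forall>d\<in>dofs. functional d T = (case d of Mom z \<Rightarrow> a z | _ \<Rightarrow> 0)"
    using functional_interpolation by blast
  have "functional (Mom z) T = a z" for z using T(2) dofs_memI(5)[of z] by simp
  then have "(\<Sum>z\<in>UNIV. a z * a z) = 0"
    using integral_inner_combination[OF T(1), of a] by (simp add: assms)
  then show ?thesis by (simp add: sum_nonneg_eq_0_iff)
qed

lemma dim_M_space: "field.dim (M_space K) = 6"
proof (rule field.dim_unique)
  have inj: "inj U"
  proof (rule injI, rule ccontr)
    fix z z' assume eq: "U z = U z'" and ne: "z \<noteq> z'"
    \<comment> \<open>Equal members at two indices would make the difference of two unit coefficient
      vectors a nontrivial vanishing combination.\<close>
    let ?a = "\<lambda>y. (if y = z then 1 else 0) - (if y = z' then 1 else 0 :: real)"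
    have "(\<Sum>y\<in>UNIV. ?a y *\<^sub>R U y x) = 0" for x
      by (simp add: scaleR_diff_left sum_subtractf if_distribR eq if_distrib[of "\<lambda>r. r *\<^sub>R _"] cong: if_cong)
    from U_independent[OF this, of z] ne show False by simp
  qed
  then show "card (range U) = 6" by (simp add: card_image)
  show "range U \<subseteq> M_space K" using U_M by blast
  show "M_space K \<subseteq> field.span (range U)"
  proof
    fix T assume "T \<in> M_space K"
    then obtain a where "T = (\<lambda>x. \<Sum>z\<in>UNIV. a z *\<^sub>R U z x)" using U_span by blast
    then have "T = (\<Sum>z\<in>UNIV. (\<lambda>x. a z *\<^sub>R U z x))" by (simp add: fun_eq_iff sum_field_apply)
    then show "T \<in> field.span (range U)"
      by (simp only:) (intro field.span_sum field.span_scale field.span_base rangeI)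
  qed
  show "field.independent (range U)"
    unfolding field.dependent_finite[OF finite_imageI[OF finite]]
  proof (intro notI, elim exE conjE bexE)
    fix u W assume W: "W \<in> range U" "u W \<noteq> 0" and sum: "(\<Sum>W\<in>range U. (\<lambda>x. u W *\<^sub>R W x)) = 0"
    have "(\<Sum>z\<in>UNIV. u (U z) *\<^sub>R U z x) = 0" for x
    proof -
      have "(\<Sum>z\<in>UNIV. u (U z) *\<^sub>R U z x) = (\<Sum>W\<in>range U. u W *\<^sub>R W x)"
        by (simp add: sum.reindex[OF inj])
      then show ?thesis using fun_cong[OF sum, of x] by (simp add: sum_field_apply)
    qed
    from U_independent[OF this] show False using W by auto
  qed
qed

lemma M_space_combination: "(\<lambda>x. \<Sum>z\<in>S. a z *\<^sub>R U z x) \<in> M_space K"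
proof -
  have P: "(\<lambda>x. \<Sum>z\<in>S. a z *\<^sub>R U z x) \<in> P4 \<and> (\<forall>x. row_div (\<lambda>x. \<Sum>z\<in>S. a z *\<^sub>R U z x) x = 0)"
  proof (induction S rule: infinite_finite_induct)
    case (insert z S)
    have U': "(\<lambda>x. a z *\<^sub>R U z x) \<in> P4"
      using P4_combination[OF P4_combination[OF U_P4[of z] U_P4[of z], of "-1"] U_P4[of z], of "a z"] by simp
    define W where "W x = (\<Sum>z\<in>S. a z *\<^sub>R U z x)" for x
    have W: "W \<in> P4" "\<And>x. row_div W x = 0" using insert.IH by (simp_all add: W_def[abs_def])
    have eq: "(\<lambda>x. \<Sum>z\<in>insert z S. a z *\<^sub>R U z x) = (\<lambda>x. a z *\<^sub>R U z x + W x)"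
      using insert.hyps by (simp add: W_def)
    have "row_div (U z) x = 0" for x using U_M by (simp add: M_space_iff)
    then have "row_div (\<lambda>x. a z *\<^sub>R U z x + W x) x = 0" for x
      unfolding row_div_add[OF U' W(1)] row_div_scale[OF U_P4] by (simp add: W(2))
    moreover have "(\<lambda>x. a z *\<^sub>R U z x + W x) \<in> P4" using P4_combination[OF U' W(1), of 1] by simp
    ultimately show ?case unfolding eq by blast
  qed (auto simp: polys_mat_iff polf.const row_div_def zero_vec_def sym_matricesI)
  have "(\<Sum>z\<in>S. a z *\<^sub>R U z x) *v g l = (\<Sum>z\<in>S. a z *\<^sub>R (U z x *v g l))" for x l
  proof -
    have lin: "linear (\<lambda>A::real^3^3. A *v g l)"
      by (simp add: linear_iff matrix_vector_mult_add_rdistrib flip: scaleR_matrix_vector_assoc)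
    show ?thesis by (simp add: linear_sum[OF lin] linear_scale[OF lin])
  qed
  then show ?thesis using P U_M by (auto simp: M_space_iff)
qed

text \<open>As \<open>l\<close> is additive only within \<open>M_space K\<close>, every partial sum
  has to lie there, which \<open>M_space_combination\<close> provides.\<close>

lemma linear_functional_on_combination:
  assumes l: "linear_functional_on (M_space K) l"
  shows "l (\<lambda>x. \<Sum>z\<in>S. a z *\<^sub>R U z x) = (\<Sum>z\<in>S. a z * l (U z))"
proof (induction S rule: infinite_finite_induct)
  case (insert z S)
  have add: "\<And>f h. f \<in> M_space K \<Longrightarrow> h \<in> M_space K \<Longrightarrow> l (\<lambda>x. f x + h x) = l f + l h"
    using l unfolding linear_functional_on_def by blast
  have sc: "l (\<lambda>x. a z *\<^sub>R U z x) = a z * l (U z)" using l U_M by (simp add: linear_functional_on_def)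
  have "(\<lambda>x. a z *\<^sub>R U z x) \<in> M_space K" using M_space_combination[of a "{z}"] by simp
  then have "l (\<lambda>x. a z *\<^sub>R U z x + (\<Sum>z\<in>S. a z *\<^sub>R U z x)) = l (\<lambda>x. a z *\<^sub>R U z x) + l (\<lambda>x. \<Sum>z\<in>S. a z *\<^sub>R U z x)"
    using M_space_combination[of a S] by (rule add)
  then show ?case using insert sc by simp
next
  case empty
  \<comment> \<open>The zero field enters as a zero multiple of a member of
    \<open>M_space K\<close>.\<close>
  have "l (\<lambda>x. 0 *\<^sub>R U 0 x) = 0 * l (U 0)" using l U_M unfolding linear_functional_on_def by blast
  then show ?case by simp
qed simp

end

context tetrahedral_element
begin

section \<open>From encoded functionals to the stated conditions\<close>

lemma all_dofs_iff:
  "(\<forall>d\<in>dofs. P d) \<longleftrightarrow>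
    (\<forall>i a b. a \<le> b \<longrightarrow> P (Vertex i a b)) \<and>
    (\<forall>i j k. i < j \<longrightarrow> k \<le> 2 \<longrightarrow> P (Edge 1 i j k) \<and> P (Edge 2 i j k) \<and> P (Edge 3 i j k) \<and>
      P (Edge 4 i j k) \<and> P (Edge 5 i j k)) \<and>
    (\<forall>i j k p q. i < j \<longrightarrow> j < k \<longrightarrow> p + q \<le> 1 \<longrightarrow> (\<forall>a. P (Face i j k p q a))) \<and>
    (\<forall>a b. a \<le> b \<longrightarrow> P (Avg a b)) \<and> (\<forall>z. P (Mom z)) \<and> (\<forall>d\<in>div_dofs. P d)" (is "_ \<longleftrightarrow> ?R")
proof
  assume L: "\<forall>d\<in>dofs. P d"
  have "d \<in> div_dofs \<Longrightarrow> d \<in> dofs" for d by (simp add: dofs_def)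
  then show ?R using L by (auto intro!: dofs_memI)
next
  assume R: ?R
  have five: "m = 1 \<or> m = 2 \<or> m = 3 \<or> m = 4 \<or> m = 5" if "m \<in> {1..5}" for m :: nat
    using that by auto
  show "\<forall>d\<in>dofs. P d"
  proof
    fix d assume "d \<in> dofs"
    then consider "d \<in> vertex_dofs" | "d \<in> edge_dofs" | "d \<in> face_dofs" | "d \<in> avg_dofs" | "d \<in> mom_dofs" | "d \<in> div_dofs"
      unfolding dofs_def by blast
    then show "P d"
    proof cases
      case 2
      then obtain m i j k where d: "d = Edge m i j k" "m \<in> {1..5}" "i < j" "k \<le> 2"
        by (auto simp: edge_dofs_def pairs_def)
      have "P (Edge 1 i j k) \<and> P (Edge 2 i j k) \<and> P (Edge 3 i j k) \<and> P (Edge 4 i j k) \<and> P (Edge 5 i j k)"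
        using R[THEN conjunct2, THEN conjunct1] d(3,4) by simp
      then show ?thesis using five[OF d(2)] d(1) by auto
    next
      case 3
      then obtain i j k p q a where d: "d = Face i j k p q a" "i < j" "j < k" "p + q \<le> 1"
        by (auto simp: face_dofs_def)
      then show ?thesis using R[THEN conjunct2, THEN conjunct2, THEN conjunct1] by simp
    qed (use R in \<open>auto simp: vertex_dofs_def avg_dofs_def mom_dofs_def\<close>)
  qed
qed

text \<open>The case distinction translates the natural number in \<open>Edge\<close> to the
  five-element type \<open>5\<close>, in which the numerals 1 to 5 are distinct and 5 equals 0. The
  value 0 at \<open>Div\<close> makes the divergence affine.\<close>

definition target :: "(4 \<Rightarrow> real^3^3) \<Rightarrow> (5 \<Rightarrow> 4 \<Rightarrow> 4 \<Rightarrow> nat \<Rightarrow> real) \<Rightarrow>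
    (4 \<Rightarrow> 4 \<Rightarrow> 4 \<Rightarrow> nat \<Rightarrow> nat \<Rightarrow> real^3) \<Rightarrow> real^3^3 \<Rightarrow> ((real^3 \<Rightarrow> real^3^3) \<Rightarrow> real) \<Rightarrow> dof \<Rightarrow> real" where
  "target A e F B l d = (case d of
      Vertex i a b \<Rightarrow> A i $ a $ b
    | Edge m i j k \<Rightarrow> (if m = 1 then e 1 i j k else if m = 2 then e 2 i j k else if m = 3 then e 3 i j k
        else if m = 4 then e 4 i j k else e 5 i j k)
    | Face i j k p q a \<Rightarrow> F i j k p q $ a
    | Avg a b \<Rightarrow> B $ a $ b
    | Mom z \<Rightarrow> l (U z)
    | Div \<alpha> i \<Rightarrow> 0)"

text \<open>Symmetric matrices agree once their upper entries do, which settles vertex values and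
  averages; moments against the six \<open>U z\<close> determine those against all of
  \<open>M_space K\<close> because both sides are linear there.\<close>

lemma interpolation_conditions_iff:
  assumes A: "\<And>i. A i \<in> sym_matrices" and B: "B \<in> sym_matrices" and l: "linear_functional_on (M_space K) l"
    and T: "T \<in> P4"
  shows "(\<forall>d\<in>dofs. functional d T = target A e F B l d) \<longleftrightarrow>
      T \<in> Sigma_space \<and>
        (\<forall>i. T (v i) = A i) \<and>
        (\<forall>i j k. i < j \<longrightarrow> k \<le> 2 \<longrightarrow>
          edge_moment (v i) (v j) k (\<lambda>x. s i j \<bullet> (T x *v nm i j)) = e 1 i j k \<and>
          edge_moment (v i) (v j) k (\<lambda>x. s i j \<bullet> (T x *v np i j)) = e 2 i j k \<and>
          edge_moment (v i) (v j) k (\<lambda>x. nm i j \<bullet> (T x *v nm i j)) = e 3 i j k \<and>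
          edge_moment (v i) (v j) k (\<lambda>x. np i j \<bullet> (T x *v np i j)) = e 4 i j k \<and>
          edge_moment (v i) (v j) k (\<lambda>x. nm i j \<bullet> (T x *v np i j)) = e 5 i j k) \<and>
        (\<forall>i j k p q. i < j \<longrightarrow> j < k \<longrightarrow> p + q \<le> 1 \<longrightarrow>
          face_moment (v i) (v j) (v k) p q (\<lambda>x. T x *v n i j k) = F i j k p q) \<and>
        average K T = B \<and>
        (\<forall>U\<in>M_space K. integral K (\<lambda>x. T x \<bullet> U x) = l U)"
proof -
  have Tsym: "T x \<in> sym_matrices" for x using T by (simp add: polys_mat_iff)
  have vert: "(\<forall>i a b. a \<le> b \<longrightarrow> functional (Vertex i a b) T = target A e F B l (Vertex i a b)) \<longleftrightarrow> (\<forall>i. T (v i) = A i)"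
    using sym_matrices_eqI[OF Tsym A] by (auto simp: functional_def target_def)
  have edge: "functional (Edge 1 i j k) T = target A e F B l (Edge 1 i j k) \<longleftrightarrow>
        edge_moment (v i) (v j) k (\<lambda>x. s i j \<bullet> (T x *v nm i j)) = e 1 i j k"
      "functional (Edge 2 i j k) T = target A e F B l (Edge 2 i j k) \<longleftrightarrow>
        edge_moment (v i) (v j) k (\<lambda>x. s i j \<bullet> (T x *v np i j)) = e 2 i j k"
      "functional (Edge 3 i j k) T = target A e F B l (Edge 3 i j k) \<longleftrightarrow>
        edge_moment (v i) (v j) k (\<lambda>x. nm i j \<bullet> (T x *v nm i j)) = e 3 i j k"
      "functional (Edge 4 i j k) T = target A e F B l (Edge 4 i j k) \<longleftrightarrow>
        edge_moment (v i) (v j) k (\<lambda>x. np i j \<bullet> (T x *v np i j)) = e 4 i j k"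
      "functional (Edge 5 i j k) T = target A e F B l (Edge 5 i j k) \<longleftrightarrow>
        edge_moment (v i) (v j) k (\<lambda>x. nm i j \<bullet> (T x *v np i j)) = e 5 i j k" for i j k
    by (simp_all add: functional_def target_def left_vec_def right_vec_def)
  have face: "(\<forall>a. functional (Face i j k p q a) T = target A e F B l (Face i j k p q a)) \<longleftrightarrow>
      face_moment (v i) (v j) (v k) p q (\<lambda>x. T x *v n i j k) = F i j k p q" for i j k p q
    by (simp add: functional_def target_def vec_eq_iff)
  have avg: "(\<forall>a b. a \<le> b \<longrightarrow> functional (Avg a b) T = target A e F B l (Avg a b)) \<longleftrightarrow> average K T = B"
    using sym_matrices_eqI[OF average_sym[OF T] B] by (auto simp: functional_def target_def)
  have mom: "(\<forall>z. functional (Mom z) T = target A e F B l (Mom z)) \<longleftrightarrow>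
      (\<forall>U\<in>M_space K. integral K (\<lambda>x. T x \<bullet> U x) = l U)" (is "?L \<longleftrightarrow> ?R")
  proof
    assume L: ?L
    show ?R
    proof
      fix W assume "W \<in> M_space K"
      then obtain a where a: "W = (\<lambda>x. \<Sum>z\<in>UNIV. a z *\<^sub>R U z x)" using U_span by blast
      show "integral K (\<lambda>x. T x \<bullet> W x) = l W"
        unfolding a integral_inner_combination[OF T] linear_functional_on_combination[OF l]
        using L by (simp add: target_def)
    qed
  next
    assume ?R then show ?L using U_M by (simp add: functional_def target_def)
  qed
  have div: "(\<forall>d\<in>div_dofs. functional d T = target A e F B l d) \<longleftrightarrow> T \<in> Sigma_space"
    using T by (auto simp: Sigma_iff div_dofs_def target_def)
  show ?thesis unfolding all_dofs_iff vert edge face avg mom div by blast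
qed

end

theorem lemma3p1:
  fixes v :: "4 \<Rightarrow> real^3" and K :: "(real^3) set"
    and s nm np :: "4 \<Rightarrow> 4 \<Rightarrow> real^3" and n :: "4 \<Rightarrow> 4 \<Rightarrow> 4 \<Rightarrow> real^3"
  assumes "inj v" and "\<not> affine_dependent (range v)" and "K = convex hull (range v)"
    and "\<And>i j. i < j \<Longrightarrow> edge_frame (v i) (v j) (s i j) (nm i j) (np i j)"
    and "\<And>i j k. i < j \<Longrightarrow> j < k \<Longrightarrow> face_unit_normal (v i) (v j) (v k) (n i j k)"
  shows "field.dim (M_space K) = 6 \<and>
    (\<forall>(A :: 4 \<Rightarrow> real^3^3) (e :: 5 \<Rightarrow> 4 \<Rightarrow> 4 \<Rightarrow> nat \<Rightarrow> real)
      (F :: 4 \<Rightarrow> 4 \<Rightarrow> 4 \<Rightarrow> nat \<Rightarrow> nat \<Rightarrow> real^3) (B :: real^3^3)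
      (l :: (real^3 \<Rightarrow> real^3^3) \<Rightarrow> real).
      (\<forall>i. A i \<in> sym_matrices) \<longrightarrow> B \<in> sym_matrices \<longrightarrow> linear_functional_on (M_space K) l \<longrightarrow>
      (\<exists>!T. T \<in> Sigma_space \<and>
        (\<forall>i. T (v i) = A i) \<and>
        (\<forall>i j k. i < j \<longrightarrow> k \<le> 2 \<longrightarrow>
          edge_moment (v i) (v j) k (\<lambda>x. s i j \<bullet> (T x *v nm i j)) = e 1 i j k \<and>
          edge_moment (v i) (v j) k (\<lambda>x. s i j \<bullet> (T x *v np i j)) = e 2 i j k \<and>
          edge_moment (v i) (v j) k (\<lambda>x. nm i j \<bullet> (T x *v nm i j)) = e 3 i j k \<and>
          edge_moment (v i) (v j) k (\<lambda>x. np i j \<bullet> (T x *v np i j)) = e 4 i j k \<and>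
          edge_moment (v i) (v j) k (\<lambda>x. nm i j \<bullet> (T x *v np i j)) = e 5 i j k) \<and>
        (\<forall>i j k p q. i < j \<longrightarrow> j < k \<longrightarrow> p + q \<le> 1 \<longrightarrow>
          face_moment (v i) (v j) (v k) p q (\<lambda>x. T x *v n i j k) = F i j k p q) \<and>
        average K T = B \<and>
        (\<forall>U\<in>M_space K. integral K (\<lambda>x. T x \<bullet> U x) = l U)))"
proof -
  obtain c g where cg: "\<And>i j. c i + g i \<bullet> v j = (if i = j then 1 else 0)"
    "\<And>x. (\<Sum>i\<in>UNIV. c i + g i \<bullet> x) = 1" "\<And>x. (\<Sum>i\<in>UNIV. (c i + g i \<bullet> x) *\<^sub>R v i) = x"
    using barycentric_coordinates_exist[OF assms(1,2)] by blast
  interpret tetrahedron v K c g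
    by unfold_locales (fact assms(1-3) cg)+
  obtain U :: "6 \<Rightarrow> real^3 \<Rightarrow> real^3^3" where U: "\<forall>z. U z \<in> M_space K"
    "\<forall>T\<in>M_space K. \<exists>a. T = (\<lambda>x. \<Sum>z\<in>UNIV. a z *\<^sub>R U z x)"
    using M_space_spanned_by_6 by blast
  interpret tetrahedral_element v K c g s nm np n U
    by unfold_locales (fact assms(4,5) U(1)[rule_format] U(2)[rule_format])+
  have Sigma_P4: "T \<in> Sigma_space \<Longrightarrow> T \<in> P4" for T by (simp add: Sigma_space_def)
  \<comment> \<open>The equivalence of the two descriptions is known only on \<open>P4\<close>, so
    uniqueness is transferred with the help of the last premise.\<close>
  have ex1: "\<exists>!T. Q T"
    if "\<exists>!T. T \<in> P4 \<and> (\<forall>d\<in>dofs. functional d T = y d)"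
      "\<And>T. T \<in> P4 \<Longrightarrow> (\<forall>d\<in>dofs. functional d T = y d) \<longleftrightarrow> Q T" "\<And>T. Q T \<Longrightarrow> T \<in> P4" for Q y
    using that by blast
  show ?thesis
  proof (intro conjI allI impI)
    show "field.dim (M_space K) = 6" by (rule dim_M_space)
    fix A :: "4 \<Rightarrow> real^3^3" and e :: "5 \<Rightarrow> 4 \<Rightarrow> 4 \<Rightarrow> nat \<Rightarrow> real"
      and F :: "4 \<Rightarrow> 4 \<Rightarrow> 4 \<Rightarrow> nat \<Rightarrow> nat \<Rightarrow> real^3" and B :: "real^3^3"
      and l :: "(real^3 \<Rightarrow> real^3^3) \<Rightarrow> real"
    assume "\<forall>i. A i \<in> sym_matrices" "B \<in> sym_matrices" "linear_functional_on (M_space K) l"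
    then show "\<exists>!T. T \<in> Sigma_space \<and>
        (\<forall>i. T (v i) = A i) \<and>
        (\<forall>i j k. i < j \<longrightarrow> k \<le> 2 \<longrightarrow>
          edge_moment (v i) (v j) k (\<lambda>x. s i j \<bullet> (T x *v nm i j)) = e 1 i j k \<and>
          edge_moment (v i) (v j) k (\<lambda>x. s i j \<bullet> (T x *v np i j)) = e 2 i j k \<and>
          edge_moment (v i) (v j) k (\<lambda>x. nm i j \<bullet> (T x *v nm i j)) = e 3 i j k \<and>
          edge_moment (v i) (v j) k (\<lambda>x. np i j \<bullet> (T x *v np i j)) = e 4 i j k \<and>
          edge_moment (v i) (v j) k (\<lambda>x. nm i j \<bullet> (T x *v np i j)) = e 5 i j k) \<and>
        (\<forall>i j k p q. i < j \<longrightarrow> j < k \<longrightarrow> p + q \<le> 1 \<longrightarrow>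
          face_moment (v i) (v j) (v k) p q (\<lambda>x. T x *v n i j k) = F i j k p q) \<and>
        average K T = B \<and>
        (\<forall>U\<in>M_space K. integral K (\<lambda>x. T x \<bullet> U x) = l U)"
      by (intro ex1[OF functional_unique_interpolation[of "target A e F B l"]] interpolation_conditions_iff)
        (auto dest: Sigma_P4)
  qed
qed

end
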